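(* Let $p$ be a prime, let $\rho$ be a shift, and let $f$ be a positive integer. Then the set of possible sets of jumps of characters of the free filtered $\mathbb{Z}_p$-module $M_\rho^f$ is exactly $\mathrm{Jump}_\rho$. Moreover, two characters of $M_\rho^f$ have the same set of jumps if and only if they are in the same orbit under the group $\mathrm{Aut}_{\mathrm{filt}}(M_\rho^f)$.
   Context: A filtered $\mathbb{Z}_p$-module $M_\bullet$ is a sequence of $\mathbb{Z}_p$-modules $M_1\supseteq M_2\supseteq\cdots$ with $\bigcap_iM_i=\{0\}$; its weight map $w(x)=\sup\{i:x\in M_i\}$ determines the filtration; $M_1$ is topologized with the $M_i$ as a fundamental system of neighbourhoods of $0$. Morphisms are $\mathbb{Z}_p$-linear maps $\phi:M_1\to N_1$ with $\phi(M_i)\subseteq N_i$ for all $i$; $\mathrm{Aut}_{\mathrm{filt}}(M_\bullet)$ is the group of invertible morphisms. Products and sums carry the termwise filtration. A shift is a strictly increasing $\rho:\mathbb{Z}_{\ge1}\to\mathbb{Z}_{\ge1}$ with $\rho(1)>1$; $T_\rho=\mathbb{Z}_{\ge1}\setminus\rho(\mathbb{Z}_{\ge1})$. $S_i$ is the filtered module $\mathbb{Z}_p$ with weight map $w(x)=\rho^{\mathrm{ord}_p(x)}(i)$ (iterate of $\rho$; $w(0)=\infty$). $M_\rho=\prod_{i\in T_\rho}S_i$; $M_\rho^f$ is the direct sum of $f$ copies. A character of $M_\bullet$ is a continuous $\mathbb{Z}_p$-linear homomorphism $\chi:M_1\to\mathbb{Q}_p/\mathbb{Z}_p$ (discrete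 target); its set of jumps is $J_\chi=\{i\in\mathbb{Z}_{\ge1}:\chi(M_i)\ne\chi(M_{i+1})\}$. $\mathrm{Aut}_{\mathrm{filt}}(M_\bullet)$ acts on characters by precomposition. $\mathrm{Jump}_\rho$, the set of $\rho$-jump sets, is the set of finite subsets $A\subseteq\mathbb{Z}_{\ge1}$ such that (i) if $a,b\in A$ and $a<b$ then $\rho(a)\le b$; (ii) $A\setminus\rho(A)\subseteq T_\rho$. *)

theory Defs
  imports
    "HOL-Computational_Algebra.Primes"
    "HOL-Library.Extended_Nat"
    "HOL-Analysis.Abstract_Topology"
    "HOL-Algebra.Divisibility"
    "HOL-Algebra.QuotRing"
    "HOL-Algebra.Module"
    "HOL-Algebra.Group_Action"
begin

section \<open>The \<open>p\<close>-adic numbers\<close>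

text \<open>
  \<open>\<rat>\<^sub>p\<close> is the completion of \<open>\<rat>\<close>: \<open>p\<close>-adic Cauchy sequences of rationals modulo null sequences.
  The ring \<open>\<int>\<^sub>p\<close> is its closed unit ball.
\<close>

definition padic_abs :: "nat \<Rightarrow> rat \<Rightarrow> real" where
  "padic_abs p x =
     (if x = 0 then 0
      else real p powi (int (multiplicity (int p) (snd (quotient_of x)))
                      - int (multiplicity (int p) (fst (quotient_of x)))))"

definition padic_Cauchy :: "nat \<Rightarrow> (nat \<Rightarrow> rat) ring" where
  "padic_Cauchy p =
     \<lparr>carrier = {s. \<forall>e>0. \<exists>N. \<forall>m\<ge>N. \<forall>n\<ge>N. padic_abs p (s m - s n) < e},
      mult = (\<lambda>s t n. s n * t n), one = (\<lambda>n. 1),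
      zero = (\<lambda>n. 0), add = (\<lambda>s t n. s n + t n)\<rparr>"

definition padic_null :: "nat \<Rightarrow> (nat \<Rightarrow> rat) set" where
  "padic_null p = {s. (\<lambda>n. padic_abs p (s n)) \<longlonglongrightarrow> 0}"

type_synonym padic = "(nat \<Rightarrow> rat) set"

definition Qp :: "nat \<Rightarrow> padic ring" where
  "Qp p = padic_Cauchy p Quot padic_null p"

definition padic_norm :: "nat \<Rightarrow> padic \<Rightarrow> real" where
  "padic_norm p x = (THE l. \<forall>s\<in>x. (\<lambda>n. padic_abs p (s n)) \<longlonglongrightarrow> l)"

definition Zp :: "nat \<Rightarrow> padic ring" where
  "Zp p = (Qp p)\<lparr>carrier := {x \<in> carrier (Qp p). padic_norm p x \<le> 1}\<rparr>"

text \<open>The value at \<open>0\<close> is irrelevant; see \<open>S_weight\<close>.\<close>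

definition padic_ord :: "nat \<Rightarrow> padic \<Rightarrow> nat" where
  "padic_ord p x =
     (GREATEST n. ([p] \<cdot>\<^bsub>Zp p\<^esub> \<one>\<^bsub>Zp p\<^esub>) [^]\<^bsub>Zp p\<^esub> n divides\<^bsub>Zp p\<^esub> x)"

text \<open>
  The quotient \<open>\<rat>\<^sub>p/\<int>\<^sub>p\<close> as a \<open>\<int>\<^sub>p\<close>-module.  Here and below, the fields
  \<^const>\<open>mult\<close> and \<^const>\<open>one\<close> of a module record carry no meaning.
\<close>

definition Qp_mod_Zp :: "nat \<Rightarrow> (padic, padic set) module" where
  "Qp_mod_Zp p =
     \<lparr>carrier = a_rcosets\<^bsub>Qp p\<^esub> (carrier (Zp p)),
      mult = undefined, one = undefined,
      zero = carrier (Zp p), add = set_add (Qp p),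
      smult = (\<lambda>a X. \<Union>x\<in>X. carrier (Zp p) +>\<^bsub>Qp p\<^esub> (a \<otimes>\<^bsub>Qp p\<^esub> x))\<rparr>"


section \<open>Filtered modules\<close>

text \<open>
  The filtration of a filtered module \<open>M\<close> is \<open>filt M 1 \<supseteq> filt M 2 \<supseteq> \<dots>\<close>,
  where \<open>filt M 1 = carrier M\<close>; the value \<open>filt M 0\<close> is never used.
\<close>

record ('a, 'b) filtered_module = "('a, 'b) module" +
  filt :: "nat \<Rightarrow> 'b set"

text \<open>As usual in \<^theory>\<open>HOL-Algebra.Bij\<close>, maps are taken to be extensional.\<close>

definition linear_maps ::
  "('a, 'r) ring_scheme \<Rightarrow> ('a, 'b, 'm) module_scheme \<Rightarrow> ('a, 'c, 'n) module_scheme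
     \<Rightarrow> ('b \<Rightarrow> 'c) set" where
  "linear_maps R M N =
     {h \<in> carrier M \<rightarrow>\<^sub>E carrier N.
        (\<forall>x\<in>carrier M. \<forall>y\<in>carrier M. h (x \<oplus>\<^bsub>M\<^esub> y) = h x \<oplus>\<^bsub>N\<^esub> h y) \<and>
        (\<forall>a\<in>carrier R. \<forall>x\<in>carrier M. h (a \<odot>\<^bsub>M\<^esub> x) = a \<odot>\<^bsub>N\<^esub> h x)}"

definition filt_hom ::
  "('a, 'r) ring_scheme \<Rightarrow> ('a, 'b) filtered_module \<Rightarrow> ('a, 'c) filtered_module
     \<Rightarrow> ('b \<Rightarrow> 'c) set" where
  "filt_hom R M N = {h \<in> linear_maps R M N. \<forall>i\<ge>1. h ` filt M i \<subseteq> filt N i}"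

definition filt_Aut :: "('a, 'r) ring_scheme \<Rightarrow> ('a, 'b) filtered_module \<Rightarrow> ('b \<Rightarrow> 'b) monoid" where
  "filt_Aut R M =
     \<lparr>carrier = {g \<in> filt_hom R M M. \<exists>h\<in>filt_hom R M M.
         compose (carrier M) h g = (\<lambda>x\<in>carrier M. x) \<and>
         compose (carrier M) g h = (\<lambda>x\<in>carrier M. x)},
      mult = (\<lambda>g h. compose (carrier M) g h),
      one = (\<lambda>x\<in>carrier M. x)\<rparr>"

definition filt_topology :: "('a, 'b) filtered_module \<Rightarrow> 'b topology" where
  "filt_topology M =
     topology (\<lambda>U. U \<subseteq> carrier M \<and> (\<forall>x\<in>U. \<exists>i\<ge>1. \<forall>y\<in>filt M i. x \<oplus>\<^bsub>M\<^esub> y \<in> U))"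

definition prod_filtered :: "'i set \<Rightarrow> ('i \<Rightarrow> ('a, 'b) filtered_module) \<Rightarrow> ('a, 'i \<Rightarrow> 'b) filtered_module" where
  "prod_filtered I M =
     \<lparr>carrier = (\<Pi>\<^sub>E i\<in>I. carrier (M i)),
      mult = undefined, one = undefined,
      zero = (\<lambda>i\<in>I. \<zero>\<^bsub>M i\<^esub>),
      add = (\<lambda>x y. \<lambda>i\<in>I. x i \<oplus>\<^bsub>M i\<^esub> y i),
      smult = (\<lambda>a x. \<lambda>i\<in>I. a \<odot>\<^bsub>M i\<^esub> x i),
      filt = (\<lambda>j. \<Pi>\<^sub>E i\<in>I. filt (M i) j)\<rparr>"

definition sum_filtered :: "'i set \<Rightarrow> ('i \<Rightarrow> ('a, 'b) filtered_module) \<Rightarrow> ('a, 'i \<Rightarrow> 'b) filtered_module" where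
  "sum_filtered I M =
     (prod_filtered I M)
       \<lparr>carrier := {x \<in> carrier (prod_filtered I M). finite {i \<in> I. x i \<noteq> \<zero>\<^bsub>M i\<^esub>}},
        filt := (\<lambda>j. {x \<in> filt (prod_filtered I M) j. finite {i \<in> I. x i \<noteq> \<zero>\<^bsub>M i\<^esub>}})\<rparr>"


section \<open>Shifts and the free filtered modules\<close>

definition shift :: "(nat \<Rightarrow> nat) \<Rightarrow> bool" where
  "shift \<rho> \<longleftrightarrow> \<rho> \<in> {1..} \<rightarrow> {1..} \<and> strict_mono_on {1..} \<rho> \<and> \<rho> 1 > 1"

definition T_rho :: "(nat \<Rightarrow> nat) \<Rightarrow> nat set" where
  "T_rho \<rho> = {1..} - \<rho> ` {1..}"

definition S_weight :: "nat \<Rightarrow> (nat \<Rightarrow> nat) \<Rightarrow> nat \<Rightarrow> padic \<Rightarrow> enat" where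
  "S_weight p \<rho> i x = (if x = \<zero>\<^bsub>Zp p\<^esub> then \<infinity> else enat ((\<rho> ^^ padic_ord p x) i))"

definition S_rho :: "nat \<Rightarrow> (nat \<Rightarrow> nat) \<Rightarrow> nat \<Rightarrow> (padic, padic) filtered_module" where
  "S_rho p \<rho> i =
     \<lparr>carrier = carrier (Zp p), mult = undefined, one = undefined,
      zero = \<zero>\<^bsub>Zp p\<^esub>, add = add (Zp p), smult = mult (Zp p),
      filt = (\<lambda>j. {x \<in> carrier (Zp p). enat j \<le> S_weight p \<rho> i x})\<rparr>"

definition M_rho :: "nat \<Rightarrow> (nat \<Rightarrow> nat) \<Rightarrow> (padic, nat \<Rightarrow> padic) filtered_module" where
  "M_rho p \<rho> = prod_filtered (T_rho \<rho>) (S_rho p \<rho>)"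

definition M_rho_power ::
  "nat \<Rightarrow> (nat \<Rightarrow> nat) \<Rightarrow> nat \<Rightarrow> (padic, nat \<Rightarrow> nat \<Rightarrow> padic) filtered_module" where
  "M_rho_power p \<rho> f = sum_filtered {..<f} (\<lambda>_. M_rho p \<rho>)"


section \<open>Characters and jump sets\<close>

definition characters :: "nat \<Rightarrow> (padic, 'b) filtered_module \<Rightarrow> ('b \<Rightarrow> padic set) set" where
  "characters p M =
     {\<chi> \<in> linear_maps (Zp p) M (Qp_mod_Zp p).
        continuous_map (filt_topology M) (discrete_topology (carrier (Qp_mod_Zp p))) \<chi>}"

definition jumps :: "('a, 'b) filtered_module \<Rightarrow> ('b \<Rightarrow> 'c) \<Rightarrow> nat set" where
  "jumps M \<chi> = {i. i \<ge> 1 \<and> \<chi> ` filt M i \<noteq> \<chi> ` filt M (i + 1)}"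

definition Jump :: "(nat \<Rightarrow> nat) \<Rightarrow> nat set set" where
  "Jump \<rho> = {A. A \<subseteq> {1..} \<and> finite A \<and>
                 (\<forall>a\<in>A. \<forall>b\<in>A. a < b \<longrightarrow> \<rho> a \<le> b) \<and>
                 A - \<rho> ` A \<subseteq> T_rho \<rho>}"

text \<open>Precomposition is a right action, but its orbits are given by the same formula.\<close>

definition character_orbit ::
  "nat \<Rightarrow> (padic, 'b) filtered_module \<Rightarrow> ('b \<Rightarrow> padic set) \<Rightarrow> ('b \<Rightarrow> padic set) set" where
  "character_orbit p M = orbit (filt_Aut (Zp p) M) (\<lambda>g \<chi>. compose (carrier M) \<chi> g)"

end

theory Submission
  imports Defs "HOL-Algebra.Subrings"
begin

text \<open>
  Write \<open>M\<close> for \<open>M\<^sub>\<rho>\<^sup>f\<close> and \<open>e k t\<close> (\<open>k < f\<close>, \<open>t \<in> T\<^sub>\<rho>\<close>) for its standard basis vectors.  A coordinate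
  with index \<open>t\<close> has to be divisible by \<open>p\<^sup>m\<^sup>+\<^sup>1\<close> in the step \<open>M\<^sub>i\<close> exactly when \<open>\<rho>\<^sup>m(t) < i\<close>.

  A bounded submodule of \<open>\<rat>\<^sub>p/\<int>\<^sub>p\<close> is the \<open>p\<^sup>n\<close>-torsion for some \<open>n\<close>, so a character \<open>\<chi>\<close> has levels:
  \<open>\<chi>(M\<^sub>i)\<close> is the \<open>p\<^sup>n\<close>-torsion for \<open>n = level \<chi> i\<close>.  The jumps are the places where the level drops, and
  the level is eventually \<open>0\<close> because \<open>\<chi>\<close> is continuous.  Two relations between the steps control the
  drops.  From \<open>p M\<^sub>i \<subseteq> M\<^sub>\<rho>\<^sub>(\<^sub>i\<^sub>)\<close> it follows that the level drops by at most one between \<open>i\<close> and \<open>\<rho>(i)\<close>; in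
  particular the jumps determine all levels, and distinct jumps \<open>a < b\<close> satisfy \<open>\<rho>(a) \<le> b\<close>.  From
  \<open>M\<^sub>\<rho>\<^sub>(\<^sub>b\<^sub>) = p M\<^sub>b + M\<^sub>\<rho>\<^sub>(\<^sub>b\<^sub>)\<^sub>+\<^sub>1\<close> it follows that a jump at \<open>\<rho>(b)\<close> forces a jump at \<open>b\<close>.  This is
  \<open>jumps_in_Jump\<close>.

  Conversely, a jump set \<open>A\<close> prescribes the level \<open>#{b \<in> A. i \<le> b}\<close> at \<open>i\<close>.  The character that sends
  \<open>e 0 a\<close> to the class of \<open>p\<close> to the power \<open>- #{b \<in> A. a \<le> b}\<close> for \<open>a \<in> A \<inter> T\<^sub>\<rho>\<close>, and all other basis
  vectors to \<open>0\<close>, has these levels (\<open>Jump_realised\<close>).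

  An automorphism maps each \<open>M\<^sub>i\<close> onto itself, so it does not change the jumps.  For the converse, let
  \<open>\<chi>\<close> and \<open>\<chi>'\<close> have the same jumps, hence the same image on every \<open>M\<^sub>i\<close>.  They differ on finitely many basis
  vectors only, and it suffices to remove one difference at a time.  The tool is \<open>basis_change\<close>: a basis
  vector \<open>e k t\<close> can be replaced by any vector of \<open>M\<^sub>t\<close> whose coordinate at \<open>(k, t)\<close> is a unit.  So one
  looks for such a vector \<open>v\<close> with \<open>\<chi>(v) = \<chi>'(e k t)\<close>.  It exists if \<open>\<chi>'(e k t)\<close> generates \<open>\<chi>'(M\<^sub>t)\<close>, and also
  if some vector of \<open>M\<^sub>t\<close> with a non-unit coordinate at \<open>(k, t)\<close> has an image that generates \<open>\<chi>(M\<^sub>t)\<close>,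
  since a multiple of it then corrects the value of \<open>\<chi>\<close> at \<open>e k t\<close>.  If the basis vectors of index \<open>t\<close> on
  which \<open>\<chi>'\<close> generates are treated first, one of the two cases always applies (\<open>reduce_disagreement\<close>).

  All this takes place over a discrete valuation ring \<open>R\<close> with fraction field \<open>K\<close> and the torsion module
  \<open>K/R\<close>, through the axioms of the locales \<open>dvr_torsion\<close> and \<open>free_filtered\<close>.  The last sections check the
  axioms for \<open>\<int>\<^sub>p\<close> and \<open>\<rat>\<^sub>p/\<int>\<^sub>p\<close>, where the ultrametric absolute value supplies units and denominators.
\<close>

section \<open>Torsion over a discrete valuation ring\<close>

text \<open>The axioms describe a discrete valuation ring \<open>R\<close> with uniformizer \<open>\<pi>\<close> and the module
  \<open>W = K/R\<close>, where \<open>K\<close> is the fraction field and \<open>\<omega> n\<close> is the class of \<open>\<pi>\<close> to the power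
  \<open>-n\<close>.\<close>

locale dvr_torsion = R?: domain R + W?: module R W for R (structure) and W (structure) +
  fixes \<pi> and \<omega> :: "nat \<Rightarrow> 'c"
  assumes unif_closed [simp]: "\<pi> \<in> carrier R"
    and unif_factor: "x \<in> carrier R \<Longrightarrow> x \<noteq> \<zero> \<Longrightarrow>
      \<exists>n u. u \<in> Units R \<and> x = \<pi> [^] (n::nat) \<otimes> u"
    and omega_closed [simp]: "\<omega> n \<in> carrier W"
    and omega_0 [simp]: "\<omega> 0 = \<zero>\<^bsub>W\<^esub>"
    and omega_1: "\<omega> 1 \<noteq> \<zero>\<^bsub>W\<^esub>"
    and unif_omega: "\<pi> \<odot>\<^bsub>W\<^esub> \<omega> (Suc n) = \<omega> n"
    and unit_multiple_omega: "w \<in> carrier W \<Longrightarrow> \<exists>n u. u \<in> Units R \<and> w = u \<odot>\<^bsub>W\<^esub> \<omega> n"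
begin

lemma smult_left_commute:
  "a \<in> carrier R \<Longrightarrow> b \<in> carrier R \<Longrightarrow> w \<in> carrier W \<Longrightarrow>
    a \<odot>\<^bsub>W\<^esub> (b \<odot>\<^bsub>W\<^esub> w) = b \<odot>\<^bsub>W\<^esub> (a \<odot>\<^bsub>W\<^esub> w)"
  using smult_assoc1[of a b w] smult_assoc1[of b a w] R.m_comm[of a b] by simp

lemma inv_smult:
  assumes "u \<in> Units R" "w \<in> carrier W"
  shows "inv u \<odot>\<^bsub>W\<^esub> (u \<odot>\<^bsub>W\<^esub> w) = w"
  using smult_assoc1[of "inv u" u w] assms by (simp add: R.Units_closed)

lemma unif_pow_omega: "\<pi> [^] (m::nat) \<odot>\<^bsub>W\<^esub> \<omega> n = \<omega> (n - m)"
proof (induction m arbitrary: n)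
  case (Suc m)
  have "\<pi> [^] Suc m \<odot>\<^bsub>W\<^esub> \<omega> n = \<pi> [^] m \<odot>\<^bsub>W\<^esub> (\<pi> \<odot>\<^bsub>W\<^esub> \<omega> n)"
    by (simp add: smult_assoc1)
  also have "\<pi> \<odot>\<^bsub>W\<^esub> \<omega> n = \<omega> (n - 1)"
    by (cases n) (simp_all add: unif_omega)
  finally show ?case by (simp add: Suc.IH)
qed simp

lemma omega_eq_zero_iff: "\<omega> n = \<zero>\<^bsub>W\<^esub> \<longleftrightarrow> n = 0"
proof (cases n)
  case (Suc m)
  have "\<omega> 1 = \<pi> [^] m \<odot>\<^bsub>W\<^esub> \<omega> n" by (simp add: unif_pow_omega Suc)
  then show ?thesis using omega_1 Suc by auto
qed simp

lemma unit_smult_eq_zero_iff: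
  assumes "u \<in> Units R" "w \<in> carrier W"
  shows "u \<odot>\<^bsub>W\<^esub> w = \<zero>\<^bsub>W\<^esub> \<longleftrightarrow> w = \<zero>\<^bsub>W\<^esub>"
proof
  assume "u \<odot>\<^bsub>W\<^esub> w = \<zero>\<^bsub>W\<^esub>"
  then have "inv u \<odot>\<^bsub>W\<^esub> (u \<odot>\<^bsub>W\<^esub> w) = \<zero>\<^bsub>W\<^esub>" using assms by simp
  then show "w = \<zero>\<^bsub>W\<^esub>" using inv_smult[OF assms] by simp
qed (use assms in \<open>simp add: R.Units_closed\<close>)

definition tors :: "nat \<Rightarrow> 'c set" where
  "tors n = {w \<in> carrier W. \<pi> [^] n \<odot>\<^bsub>W\<^esub> w = \<zero>\<^bsub>W\<^esub>}"

lemma tors_add: "v \<in> tors n \<Longrightarrow> w \<in> tors n \<Longrightarrow> v \<oplus>\<^bsub>W\<^esub> w \<in> tors n"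
  by (simp add: tors_def smult_r_distr)

lemma tors_smult:
  assumes "a \<in> carrier R" "w \<in> tors n"
  shows "a \<odot>\<^bsub>W\<^esub> w \<in> tors n"
proof -
  have "\<pi> [^] n \<odot>\<^bsub>W\<^esub> (a \<odot>\<^bsub>W\<^esub> w) = a \<odot>\<^bsub>W\<^esub> (\<pi> [^] n \<odot>\<^bsub>W\<^esub> w)"
    using assms by (intro smult_left_commute) (auto simp: tors_def)
  then show ?thesis using assms by (simp add: tors_def)
qed

lemma tors_0 [simp]: "tors 0 = {\<zero>\<^bsub>W\<^esub>}"
  by (auto simp: tors_def)

lemma zero_tors [simp]: "\<zero>\<^bsub>W\<^esub> \<in> tors n"
  by (simp add: tors_def)

lemma tors_carrier: "w \<in> tors n \<Longrightarrow> w \<in> carrier W"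
  by (simp add: tors_def)

lemma unit_omega_tors_iff:
  assumes u: "u \<in> Units R"
  shows "u \<odot>\<^bsub>W\<^esub> \<omega> m \<in> tors n \<longleftrightarrow> m \<le> n"
proof -
  have "\<pi> [^] n \<odot>\<^bsub>W\<^esub> (u \<odot>\<^bsub>W\<^esub> \<omega> m) = u \<odot>\<^bsub>W\<^esub> (\<pi> [^] n \<odot>\<^bsub>W\<^esub> \<omega> m)"
    using u by (intro smult_left_commute) (auto simp: R.Units_closed)
  also have "\<dots> = u \<odot>\<^bsub>W\<^esub> \<omega> (m - n)" by (simp add: unif_pow_omega)
  finally show ?thesis
    using u by (simp add: tors_def unit_smult_eq_zero_iff omega_eq_zero_iff R.Units_closed)
qed

lemma omega_tors_iff: "\<omega> m \<in> tors n \<longleftrightarrow> m \<le> n"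
  using unit_omega_tors_iff[of \<one> m n] by simp

lemma tors_subset_iff: "tors m \<subseteq> tors n \<longleftrightarrow> m \<le> n"
proof
  assume "tors m \<subseteq> tors n"
  moreover have "\<omega> m \<in> tors m" by (simp add: omega_tors_iff)
  ultimately have "\<omega> m \<in> tors n" by blast
  then show "m \<le> n" by (simp add: omega_tors_iff)
next
  assume "m \<le> n"
  show "tors m \<subseteq> tors n"
  proof
    fix w assume w: "w \<in> tors m"
    obtain k u where u: "u \<in> Units R" "w = u \<odot>\<^bsub>W\<^esub> \<omega> k"
      using unit_multiple_omega[OF tors_carrier[OF w]] by blast
    then show "w \<in> tors n" using w \<open>m \<le> n\<close> by (simp add: unit_omega_tors_iff)
  qed
qed

lemma tors_eq_iff: "tors m = tors n \<longleftrightarrow> m = n"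
  using tors_subset_iff[of m n] tors_subset_iff[of n m] by auto

text \<open>An element of exact order \<open>\<pi>\<^sup>n\<close> is a unit multiple of \<open>\<omega> n\<close>, and all torsion of order
  at most \<open>\<pi>\<^sup>n\<close> consists of multiples of \<open>\<omega> n\<close>.\<close>

lemma tors_generator:
  assumes w: "w \<in> tors n" "n = 0 \<or> w \<notin> tors (n - 1)" and y: "y \<in> tors n"
  obtains c where "c \<in> carrier R" "y = c \<odot>\<^bsub>W\<^esub> w"
proof -
  obtain m u where u: "u \<in> Units R" "w = u \<odot>\<^bsub>W\<^esub> \<omega> m"
    using unit_multiple_omega[OF tors_carrier[OF w(1)]] by blast
  obtain k v where v: "v \<in> Units R" "y = v \<odot>\<^bsub>W\<^esub> \<omega> k"
    using unit_multiple_omega[OF tors_carrier[OF y]] by blast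
  have m: "m = n" using w u by (auto simp: unit_omega_tors_iff)
  have k: "k \<le> n" using y v by (simp add: unit_omega_tors_iff)
  have "\<omega> n = inv u \<odot>\<^bsub>W\<^esub> w" using u m by (simp add: inv_smult)
  moreover have "\<omega> k = \<pi> [^] (n - k) \<odot>\<^bsub>W\<^esub> \<omega> n" using k by (simp add: unif_pow_omega)
  ultimately have "y = (v \<otimes> \<pi> [^] (n - k) \<otimes> inv u) \<odot>\<^bsub>W\<^esub> w"
    using v u tors_carrier[OF w(1)] by (simp add: smult_assoc1 R.Units_closed)
  then show ?thesis using that[of "v \<otimes> \<pi> [^] (n - k) \<otimes> inv u"] u v by (simp add: R.Units_closed)
qed

text \<open>The submodules of \<open>W\<close> form a chain: if \<open>n\<close> is maximal with \<open>\<omega> n \<in> H\<close>, every element of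
  \<open>H\<close> is a unit multiple of some \<open>\<omega> k\<close> with \<open>k \<le> n\<close>.\<close>

lemma smult_closed_subset_eq_tors:
  assumes "H \<subseteq> tors N" "H \<noteq> {}"
    and smult: "\<And>a w. a \<in> carrier R \<Longrightarrow> w \<in> H \<Longrightarrow> a \<odot>\<^bsub>W\<^esub> w \<in> H"
  obtains n where "H = tors n"
proof -
  define n where "n = (GREATEST n. \<omega> n \<in> H)"
  have bound: "k \<le> N" if "\<omega> k \<in> H" for k using assms(1) that omega_tors_iff by blast
  obtain w where w: "w \<in> H" using assms(2) by blast
  then have "w \<in> carrier W" using assms(1) tors_carrier by blast
  then have "\<omega> 0 \<in> H" using smult[OF R.zero_closed w] by simp
  then have n: "\<omega> n \<in> H" unfolding n_def using bound by (rule GreatestI_nat)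
  have max: "k \<le> n" if "\<omega> k \<in> H" for k
    unfolding n_def using that bound by (rule Greatest_le_nat)
  have "H = tors n"
  proof
    show "H \<subseteq> tors n"
    proof
      fix w assume w: "w \<in> H"
      then have "w \<in> carrier W" using assms(1) tors_carrier by blast
      then obtain k u where u: "u \<in> Units R" "w = u \<odot>\<^bsub>W\<^esub> \<omega> k"
        using unit_multiple_omega by blast
      then have "\<omega> k = inv u \<odot>\<^bsub>W\<^esub> w" by (simp add: inv_smult)
      then have "\<omega> k \<in> H" using smult[of "inv u" w] u w by simp
      then show "w \<in> tors n" using max u by (simp add: unit_omega_tors_iff)
    qed
    show "tors n \<subseteq> H"
    proof
      fix y assume y: "y \<in> tors n"
      have "\<omega> n \<in> tors n" "n = 0 \<or> \<omega> n \<notin> tors (n - 1)" by (auto simp: omega_tors_iff)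
      then obtain c where "c \<in> carrier R" "y = c \<odot>\<^bsub>W\<^esub> \<omega> n" using y by (rule tors_generator)
      then show "y \<in> H" using smult n by simp
    qed
  qed
  then show ?thesis by (rule that)
qed

lemma unif_mult_not_Unit:
  assumes y: "y \<in> carrier R"
  shows "\<pi> \<otimes> y \<notin> Units R"
proof
  assume "\<pi> \<otimes> y \<in> Units R"
  moreover have "(\<pi> \<otimes> y) \<odot>\<^bsub>W\<^esub> \<omega> 1 = \<zero>\<^bsub>W\<^esub>"
    using y unif_omega[of 0] by (simp add: R.m_comm[of \<pi> y] smult_assoc1)
  ultimately show False using omega_1 by (simp add: unit_smult_eq_zero_iff)
qed

lemma not_Unit_unif_mult:
  assumes "x \<in> carrier R" "x \<notin> Units R"
  obtains y where "y \<in> carrier R" "x = \<pi> \<otimes> y"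
proof (cases "x = \<zero>")
  case True
  then show ?thesis using that[of \<zero>] by simp
next
  case False
  then obtain n u where u: "u \<in> Units R" "x = \<pi> [^] (n::nat) \<otimes> u"
    using unif_factor assms(1) by blast
  then have "n \<noteq> 0" using assms(2) by (intro notI) simp
  then obtain m where "n = Suc m" by (cases n) auto
  then have "x = \<pi> \<otimes> (\<pi> [^] m \<otimes> u)" using u by (simp add: R.m_ac R.Units_closed)
  then show ?thesis using that[of "\<pi> [^] m \<otimes> u"] u by (simp add: R.Units_closed)
qed

text \<open>This is where the locality of the ring enters: its non-units form the ideal generated by
  the uniformizer.\<close>

lemma one_plus_mult_not_Unit:
  assumes "x \<in> carrier R" "x \<notin> Units R" "c \<in> carrier R"
  shows "\<one> \<oplus> c \<otimes> x \<in> Units R"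
proof (rule ccontr)
  assume "\<one> \<oplus> c \<otimes> x \<notin> Units R"
  moreover have "\<one> \<oplus> c \<otimes> x \<in> carrier R" using assms by simp
  ultimately obtain y where y: "y \<in> carrier R" "\<one> \<oplus> c \<otimes> x = \<pi> \<otimes> y"
    using not_Unit_unif_mult by blast
  obtain z where z: "z \<in> carrier R" "x = \<pi> \<otimes> z" using assms(1,2) by (rule not_Unit_unif_mult)
  have "\<one> = (\<one> \<oplus> c \<otimes> x) \<ominus> c \<otimes> x"
    using assms by (simp add: R.minus_eq R.a_assoc R.r_neg)
  also have "\<dots> = \<pi> \<otimes> (y \<ominus> c \<otimes> z)"
    using y z assms(3) by (simp add: R.minus_eq R.r_distr R.r_minus R.m_lcomm)
  finally have "\<pi> \<otimes> (y \<ominus> c \<otimes> z) \<in> Units R" using R.Units_one_closed by simp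
  then show False using unif_mult_not_Unit y z assms(3) by simp
qed

lemma unif_pow_divides_le:
  assumes "\<pi> [^] (n::nat) divides x" "m \<le> n" "x \<in> carrier R"
  shows "\<pi> [^] m divides x"
proof -
  obtain c where c: "c \<in> carrier R" "x = \<pi> [^] n \<otimes> c" using assms(1) by (auto simp: factor_def)
  have "\<pi> [^] n = \<pi> [^] m \<otimes> \<pi> [^] (n - m)"
    using assms(2) by (simp add: R.nat_pow_mult)
  then have "x = \<pi> [^] m \<otimes> (\<pi> [^] (n - m) \<otimes> c)" using c by (simp add: R.m_assoc)
  then show ?thesis using c by (intro dividesI) auto
qed

lemma unif_pow_divides_mult:
  assumes "\<pi> [^] (m::nat) divides x" "\<pi> [^] (n::nat) divides y"
  shows "\<pi> [^] (m + n) divides (x \<otimes> y)"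
proof -
  obtain c d where "c \<in> carrier R" "x = \<pi> [^] m \<otimes> c" "d \<in> carrier R" "y = \<pi> [^] n \<otimes> d"
    using assms by (auto simp: factor_def)
  then have "x \<otimes> y = \<pi> [^] (m + n) \<otimes> (c \<otimes> d)" "c \<otimes> d \<in> carrier R"
    by (simp_all add: R.m_ac flip: R.nat_pow_mult)
  then show ?thesis by (intro dividesI) auto
qed

lemma unif_pow_divides_add:
  assumes "\<pi> [^] (m::nat) divides x" "\<pi> [^] m divides y"
  shows "\<pi> [^] m divides (x \<oplus> y)"
proof -
  obtain c d where "c \<in> carrier R" "x = \<pi> [^] m \<otimes> c" "d \<in> carrier R" "y = \<pi> [^] m \<otimes> d"
    using assms by (auto simp: factor_def)
  then have "x \<oplus> y = \<pi> [^] m \<otimes> (c \<oplus> d)" "c \<oplus> d \<in> carrier R"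
    by (simp_all add: R.r_distr)
  then show ?thesis by (intro dividesI) auto
qed

lemma divides_zero_R: "a \<in> carrier R \<Longrightarrow> a divides \<zero>"
  by (rule dividesI[of \<zero>]) simp_all

text \<open>The valuation, given by the property through which the filtration uses it.\<close>

lemma unif_pow_divides_iff_ord:
  assumes "x \<in> carrier R" "x \<noteq> \<zero>"
  obtains n where "\<And>m. \<pi> [^] (m::nat) divides x \<longleftrightarrow> m \<le> n"
proof -
  obtain n u where u: "u \<in> Units R" "x = \<pi> [^] (n::nat) \<otimes> u"
    using unif_factor assms by blast
  have "m \<le> n" if "\<pi> [^] m divides x" for m
  proof (rule ccontr)
    assume "\<not> m \<le> n"
    then have "\<pi> [^] Suc n divides x" using unif_pow_divides_le[OF that, of "Suc n"] assms(1) by linarith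
    then obtain c where c: "c \<in> carrier R" "x = \<pi> [^] Suc n \<otimes> c" by (auto simp: factor_def)
    then have "\<pi> [^] n \<otimes> u = \<pi> [^] n \<otimes> (\<pi> \<otimes> c)" using u by (simp add: R.m_assoc R.Units_closed)
    moreover have "\<pi> [^] n \<noteq> \<zero>" using assms u by (auto simp: R.Units_closed)
    ultimately have "u = \<pi> \<otimes> c" using u c R.m_lcancel by (simp add: R.Units_closed)
    then show False using unif_mult_not_Unit u c by blast
  qed
  moreover have "\<pi> [^] n divides x" using u by (intro dividesI[of u]) (auto simp: R.Units_closed)
  ultimately have "\<pi> [^] m divides x \<longleftrightarrow> m \<le> n" for m
    using unif_pow_divides_le assms(1) by blast
  then show ?thesis by (rule that)
qed

end

section \<open>Shifts and jump sets\<close>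

locale shift_map =
  fixes \<rho> :: "nat \<Rightarrow> nat"
  assumes shift: "shift \<rho>"
begin

lemma rho_less: "1 \<le> a \<Longrightarrow> a < b \<Longrightarrow> \<rho> a < \<rho> b"
  using shift by (auto simp: shift_def strict_mono_on_def)

lemma rho_le: "1 \<le> a \<Longrightarrow> a \<le> b \<Longrightarrow> \<rho> a \<le> \<rho> b"
  using rho_less[of a b] by (cases "a = b") auto

lemma rho_gt: "1 \<le> n \<Longrightarrow> n < \<rho> n"
proof (induction n rule: dec_induct)
  case base
  then show ?case using shift by (simp add: shift_def)
next
  case (step n)
  then show ?case using rho_less[of n "Suc n"] by simp
qed

lemma iter_ge: "1 \<le> t \<Longrightarrow> t + m \<le> (\<rho> ^^ m) t"
proof (induction m)
  case (Suc m)
  then show ?case using rho_gt[of "(\<rho> ^^ m) t"] by simp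
qed simp

lemma iter_ge_1: "1 \<le> t \<Longrightarrow> 1 \<le> (\<rho> ^^ m) t"
  using iter_ge[of t m] by simp

lemma iter_le_left: "1 \<le> t \<Longrightarrow> m \<le> n \<Longrightarrow> (\<rho> ^^ m) t \<le> (\<rho> ^^ n) t"
  using iter_ge[OF iter_ge_1[of t m], of "n - m"] funpow_add[of "n - m" m \<rho>] by simp

lemma iter_le_right: "1 \<le> s \<Longrightarrow> s \<le> t \<Longrightarrow> (\<rho> ^^ m) s \<le> (\<rho> ^^ m) t"
proof (induction m)
  case (Suc m)
  then show ?case using rho_le[OF iter_ge_1] by simp
qed simp

lemma T_rho_ge_1: "t \<in> T_rho \<rho> \<Longrightarrow> 1 \<le> t"
  by (simp add: T_rho_def)

text \<open>The combinatorial half of the characterisation of jump sets; \<open>e i\<close> stands for the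
  level of a character at \<open>i\<close>. Two jumps before \<open>\<rho> a\<close> would make the level drop by two
  between \<open>a\<close> and \<open>\<rho> a\<close>, against \<open>step\<close>. At a jump \<open>a = \<rho> b\<close> the hypothesis \<open>lift\<close> gives
  \<open>e a < e b\<close>; were \<open>b\<close> not a jump, then \<open>e b = e (b + 1)\<close> would be at most
  \<open>e (a + 1) + 1 \<le> e a\<close>, because \<open>\<rho> (b + 1) > a\<close>.\<close>

lemma level_jumps_in_Jump:
  assumes anti: "\<And>i. 1 \<le> i \<Longrightarrow> e (Suc i) \<le> (e i :: nat)"
    and step: "\<And>i. 1 \<le> i \<Longrightarrow> e i \<le> Suc (e (\<rho> i))"
    and lift: "\<And>b. 1 \<le> b \<Longrightarrow> e (\<rho> b) \<le> max (e b - 1) (e (Suc (\<rho> b)))"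
    and "1 \<le> N" "e N = 0"
  shows "{i. 1 \<le> i \<and> e i \<noteq> e (Suc i)} \<in> Jump \<rho>"
proof -
  define A where "A = {i. 1 \<le> i \<and> e i \<noteq> e (Suc i)}"
  have anti': "e j \<le> e i" if "1 \<le> i" "i \<le> j" for i j
    using that(2,1)
  proof (induction rule: dec_induct)
    case (step n)
    then show ?case using anti[of n] by simp
  qed simp
  have drop: "e (Suc i) < e i" if "i \<in> A" for i
    using anti[of i] that by (auto simp: A_def)
  have "A \<subseteq> {..N}"
  proof
    fix i assume i: "i \<in> A"
    show "i \<in> {..N}"
    proof (rule ccontr)
      assume "i \<notin> {..N}"
      then show False using anti'[of N i] drop[OF i] assms(4,5) by simp
    qed
  qed
  then have fin: "finite A" using finite_subset by blast
  have gap: "\<rho> a \<le> b" if ab: "a \<in> A" "b \<in> A" "a < b" for a b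
  proof (rule ccontr)
    assume "\<not> \<rho> a \<le> b"
    then have "e (\<rho> a) \<le> e (Suc b)" using ab by (intro anti') auto
    moreover have "e b \<le> e (Suc a)" using ab by (intro anti') (auto simp: A_def)
    ultimately show False
      using drop[OF ab(1)] drop[OF ab(2)] step[of a] ab by (auto simp: A_def)
  qed
  have "a \<in> T_rho \<rho>" if a: "a \<in> A" "a \<notin> \<rho> ` A" for a
  proof (rule ccontr)
    assume "a \<notin> T_rho \<rho>"
    then obtain b where b: "1 \<le> b" "a = \<rho> b" using a by (auto simp: T_rho_def A_def)
    then have "b \<notin> A" using a by auto
    then have "e b = e (Suc b)" using b by (simp add: A_def)
    also have "\<dots> \<le> Suc (e (\<rho> (Suc b)))" using step by simp
    also have "\<dots> \<le> Suc (e (Suc a))" using rho_less[of b "Suc b"] b anti'[of "Suc a"] by simp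
    finally show False using drop[OF a(1)] lift[OF b(1)] b by auto
  qed
  then show ?thesis
    using fin gap unfolding A_def[symmetric] by (auto simp: Jump_def A_def)
qed

text \<open>Every drop is by exactly one, so the jumps recover the levels, starting from a place
  where both sequences agree and going down.\<close>

lemma level_eq_of_jumps_eq:
  assumes "\<And>i. 1 \<le> i \<Longrightarrow> e (Suc i) \<le> (e i :: nat) \<and> e i \<le> Suc (e (Suc i))"
    and "\<And>i. 1 \<le> i \<Longrightarrow> e' (Suc i) \<le> (e' i :: nat) \<and> e' i \<le> Suc (e' (Suc i))"
    and jumps: "{i. 1 \<le> i \<and> e i \<noteq> e (Suc i)} = {i. 1 \<le> i \<and> e' i \<noteq> e' (Suc i)}"
    and N: "e N = e' N" "i \<le> N" "1 \<le> i"
  shows "e i = e' i"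
  using N(2,1,3)
proof (induction rule: inc_induct)
  case (step n)
  then have n: "e (Suc n) = e' (Suc n)" "1 \<le> n" by auto
  have "e n \<noteq> e (Suc n) \<longleftrightarrow> e' n \<noteq> e' (Suc n)" using jumps n(2) by blast
  then show ?case using n assms(1)[of n] assms(2)[of n] by linarith
qed

text \<open>The level that a jump set \<open>A\<close> prescribes at \<open>i\<close>.\<close>

definition count_ge :: "nat set \<Rightarrow> nat \<Rightarrow> nat" where
  "count_ge A i = card {a \<in> A. i \<le> a}"

context
  fixes A assumes A: "A \<in> Jump \<rho>"
begin

lemma Jump_finite: "finite A" and Jump_ge_1: "a \<in> A \<Longrightarrow> 1 \<le> a"
  and Jump_gap: "a \<in> A \<Longrightarrow> b \<in> A \<Longrightarrow> a < b \<Longrightarrow> \<rho> a \<le> b"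
  and Jump_T_rho: "a \<in> A \<Longrightarrow> a \<notin> \<rho> ` A \<Longrightarrow> a \<in> T_rho \<rho>"
  using A by (auto simp: Jump_def)

lemma count_ge_antimono: "i \<le> j \<Longrightarrow> count_ge A j \<le> count_ge A i"
  unfolding count_ge_def using Jump_finite by (intro card_mono) auto

lemma count_ge_Suc: "count_ge A i = count_ge A (Suc i) + (if i \<in> A then 1 else 0)"
proof (cases "i \<in> A")
  case True
  then have "{a \<in> A. i \<le> a} = insert i {a \<in> A. Suc i \<le> a}" by auto
  then show ?thesis using True Jump_finite by (simp add: count_ge_def)
next
  case False
  then have "{a \<in> A. i \<le> a} = {a \<in> A. Suc i \<le> a}" by (auto simp: Suc_le_eq order_le_less)
  then show ?thesis using False by (simp add: count_ge_def)
qed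

text \<open>Between \<open>i\<close> and \<open>\<rho> i\<close> there is room for one element of a jump set.\<close>

lemma count_ge_rho:
  assumes "1 \<le> i"
  shows "count_ge A i \<le> Suc (count_ge A (\<rho> i))"
proof -
  define B where "B = {a \<in> A. i \<le> a \<and> a < \<rho> i}"
  have fin: "finite B" using Jump_finite by (simp add: B_def)
  have not_less: "\<not> a < b" if "a \<in> B" "b \<in> B" for a b
    using Jump_gap[of a b] rho_le[of i a] assms that by (auto simp: B_def)
  have "a = b" if "a \<in> B" "b \<in> B" for a b
    using not_less[OF that] not_less[OF that(2,1)] by simp
  then have "card B \<le> 1" using card_le_Suc0_iff_eq[OF fin] by simp
  moreover have "card {a \<in> A. i \<le> a} \<le> card (B \<union> {a \<in> A. \<rho> i \<le> a})"
    using Jump_finite by (intro card_mono) (auto simp: B_def)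
  moreover have "card (B \<union> {a \<in> A. \<rho> i \<le> a}) \<le> card B + card {a \<in> A. \<rho> i \<le> a}"
    by (rule card_Un_le)
  ultimately show ?thesis by (simp add: count_ge_def)
qed

lemma count_ge_iter:
  assumes "1 \<le> a" "i \<le> (\<rho> ^^ n) a"
  shows "count_ge A a \<le> n + count_ge A i"
proof -
  have "count_ge A a \<le> n + count_ge A ((\<rho> ^^ n) a)"
  proof (induction n)
    case (Suc n)
    then show ?case using count_ge_rho[of "(\<rho> ^^ n) a"] iter_ge_1[OF assms(1), of n] by simp
  qed simp
  then show ?thesis using count_ge_antimono[OF assms(2)] by simp
qed

text \<open>An element of \<open>A\<close> that is not in \<open>T\<close> is the image under \<open>\<rho>\<close> of an element of \<open>A\<close>;
  going back as far as possible ends in \<open>T\<close>, and each step passes exactly one element of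
  \<open>A\<close>.\<close>

lemma Jump_root:
  assumes "b \<in> A"
  obtains a m where "a \<in> A \<inter> T_rho \<rho>" "b = (\<rho> ^^ m) a" "count_ge A a = m + count_ge A b"
proof -
  have "\<exists>a m. a \<in> A \<inter> T_rho \<rho> \<and> b = (\<rho> ^^ m) a \<and> count_ge A a = m + count_ge A b"
    using assms
  proof (induction b rule: less_induct)
    case (less b)
    show ?case
    proof (cases "b \<in> T_rho \<rho>")
      case True
      then show ?thesis using less.prems by (intro exI[of _ b] exI[of _ 0]) simp
    next
      case False
      then obtain c where c: "c \<in> A" "b = \<rho> c" using Jump_T_rho less.prems by blast
      have "c < b" using rho_gt Jump_ge_1 c by simp
      then obtain a m where am: "a \<in> A \<inter> T_rho \<rho>" "c = (\<rho> ^^ m) a" "count_ge A a = m + count_ge A c"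
        using less.IH c(1) by blast
      have "count_ge A c = Suc (count_ge A b)"
        using count_ge_rho[of c] count_ge_Suc[of c] count_ge_antimono[of "Suc c" b] c \<open>c < b\<close> Jump_ge_1
        by simp
      then show ?thesis using am c by (intro exI[of _ a] exI[of _ "Suc m"]) simp
    qed
  qed
  then show ?thesis using that by blast
qed

lemma count_ge_min:
  assumes "count_ge A i \<noteq> 0"
  obtains b where "b \<in> A" "i \<le> b" "count_ge A b = count_ge A i"
proof -
  let ?B = "{a \<in> A. i \<le> a}"
  have B: "finite ?B" "?B \<noteq> {}" using Jump_finite assms by (auto simp: count_ge_def card_gt_0_iff)
  then have m: "Min ?B \<in> ?B" by (rule Min_in)
  have "{a \<in> A. Min ?B \<le> a} = ?B" using m Min_le[OF B(1)] by (blast intro: le_trans)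
  then show ?thesis using that[of "Min ?B"] m by (simp add: count_ge_def)
qed

end
end

section \<open>The filtered module and its basis\<close>

text \<open>The module \<open>M\<close> is \<open>R\<close> to the power \<open>{..<f} \<times> T\<close>. The filtration is stated by
  divisibility of the coordinates rather than by their weights: a weight \<open>\<rho>\<^sup>n(t)\<close>, with \<open>n\<close>
  the valuation, is at least \<open>i\<close> if and only if \<open>m < n\<close> whenever \<open>\<rho>\<^sup>m(t) < i\<close>.\<close>

locale free_filtered = dvr_torsion R W \<pi> \<omega> + shift_map \<rho>
  for R (structure) and W (structure) and \<pi> and \<omega> :: "nat \<Rightarrow> 'c" and \<rho> +
  fixes f :: nat and M :: "('a, nat \<Rightarrow> nat \<Rightarrow> 'a) filtered_module"
  assumes f_pos: "1 \<le> f"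
    and carrier_M: "carrier M = (\<Pi>\<^sub>E k\<in>{..<f}. \<Pi>\<^sub>E t\<in>T_rho \<rho>. carrier R)"
    and zero_M: "\<zero>\<^bsub>M\<^esub> = (\<lambda>k\<in>{..<f}. \<lambda>t\<in>T_rho \<rho>. \<zero>)"
    and add_M: "x \<oplus>\<^bsub>M\<^esub> y = (\<lambda>k\<in>{..<f}. \<lambda>t\<in>T_rho \<rho>. x k t \<oplus> y k t)"
    and smult_M: "a \<odot>\<^bsub>M\<^esub> x = (\<lambda>k\<in>{..<f}. \<lambda>t\<in>T_rho \<rho>. a \<otimes> x k t)"
    and filt_M: "filt M i = {x \<in> carrier M.
      \<forall>k<f. \<forall>t\<in>T_rho \<rho>. \<forall>m. (\<rho> ^^ m) t < i \<longrightarrow> \<pi> [^] Suc m divides x k t}"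
begin

abbreviation "T \<equiv> T_rho \<rho>"

definition tuple :: "(nat \<Rightarrow> nat \<Rightarrow> 'a) \<Rightarrow> nat \<Rightarrow> nat \<Rightarrow> 'a" where
  "tuple g = (\<lambda>k\<in>{..<f}. \<lambda>t\<in>T. g k t)"

lemma tuple_apply [simp]: "k < f \<Longrightarrow> t \<in> T \<Longrightarrow> tuple g k t = g k t"
  by (simp add: tuple_def)

lemma tuple_closed: "(\<And>k t. k < f \<Longrightarrow> t \<in> T \<Longrightarrow> g k t \<in> carrier R) \<Longrightarrow> tuple g \<in> carrier M"
  by (auto simp: tuple_def carrier_M)

lemma coord_closed [simp]: "x \<in> carrier M \<Longrightarrow> k < f \<Longrightarrow> t \<in> T \<Longrightarrow> x k t \<in> carrier R"
  by (auto simp: carrier_M PiE_iff)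

lemma M_eqI:
  assumes "x \<in> carrier M" "y \<in> carrier M" "\<And>k t. k < f \<Longrightarrow> t \<in> T \<Longrightarrow> x k t = y k t"
  shows "x = y"
proof (rule PiE_ext)
  show "x \<in> (\<Pi>\<^sub>E k\<in>{..<f}. \<Pi>\<^sub>E t\<in>T. carrier R)" "y \<in> (\<Pi>\<^sub>E k\<in>{..<f}. \<Pi>\<^sub>E t\<in>T. carrier R)"
    using assms(1,2) by (auto simp: carrier_M)
  fix k assume k: "k \<in> {..<f}"
  show "x k = y k"
  proof (rule PiE_ext)
    show "x k \<in> (\<Pi>\<^sub>E t\<in>T. carrier R)" "y k \<in> (\<Pi>\<^sub>E t\<in>T. carrier R)"
      using assms(1,2) k by (auto simp: carrier_M)
  qed (use assms(3) k in auto)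
qed

lemma zero_apply [simp]: "k < f \<Longrightarrow> t \<in> T \<Longrightarrow> \<zero>\<^bsub>M\<^esub> k t = \<zero>"
  by (simp add: zero_M)

lemma add_apply [simp]: "k < f \<Longrightarrow> t \<in> T \<Longrightarrow> (x \<oplus>\<^bsub>M\<^esub> y) k t = x k t \<oplus> y k t"
  by (simp add: add_M)

lemma smult_apply [simp]: "k < f \<Longrightarrow> t \<in> T \<Longrightarrow> (a \<odot>\<^bsub>M\<^esub> x) k t = a \<otimes> x k t"
  by (simp add: smult_M)

lemma M_zero_closed: "\<zero>\<^bsub>M\<^esub> \<in> carrier M"
  by (auto simp: zero_M carrier_M)

lemma M_add_closed:
  assumes "x \<in> carrier M" "y \<in> carrier M"
  shows "x \<oplus>\<^bsub>M\<^esub> y \<in> carrier M"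
  using tuple_closed[of "\<lambda>k t. x k t \<oplus> y k t"] assms by (simp add: add_M tuple_def)

lemma M_smult_closed:
  assumes "a \<in> carrier R" "x \<in> carrier M"
  shows "a \<odot>\<^bsub>M\<^esub> x \<in> carrier M"
  using tuple_closed[of "\<lambda>k t. a \<otimes> x k t"] assms by (simp add: smult_M tuple_def)

lemma M_module: "module R M"
proof (rule moduleI)
  show "abelian_group M"
  proof (rule abelian_groupI)
    fix x y z assume "x \<in> carrier M" "y \<in> carrier M" "z \<in> carrier M"
    then show "x \<oplus>\<^bsub>M\<^esub> y \<oplus>\<^bsub>M\<^esub> z = x \<oplus>\<^bsub>M\<^esub> (y \<oplus>\<^bsub>M\<^esub> z)"
      by (intro M_eqI M_add_closed) (simp_all add: R.a_assoc)
  next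
    fix x y assume "x \<in> carrier M" "y \<in> carrier M"
    then show "x \<oplus>\<^bsub>M\<^esub> y = y \<oplus>\<^bsub>M\<^esub> x"
      by (intro M_eqI M_add_closed) (simp_all add: R.a_comm)
  next
    fix x assume x: "x \<in> carrier M"
    then show "\<zero>\<^bsub>M\<^esub> \<oplus>\<^bsub>M\<^esub> x = x"
      by (intro M_eqI M_add_closed M_zero_closed) simp_all
    have "(\<ominus> \<one>) \<odot>\<^bsub>M\<^esub> x \<oplus>\<^bsub>M\<^esub> x = \<zero>\<^bsub>M\<^esub>"
      using x by (intro M_eqI M_add_closed M_smult_closed M_zero_closed) (simp_all add: R.l_minus R.l_neg)
    then show "\<exists>y\<in>carrier M. y \<oplus>\<^bsub>M\<^esub> x = \<zero>\<^bsub>M\<^esub>" using x M_smult_closed[of "\<ominus> \<one>" x] by auto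
  qed (rule M_add_closed M_zero_closed; assumption)+
next
  fix a b x assume *: "a \<in> carrier R" "b \<in> carrier R" "x \<in> carrier M"
  then show "(a \<oplus> b) \<odot>\<^bsub>M\<^esub> x = a \<odot>\<^bsub>M\<^esub> x \<oplus>\<^bsub>M\<^esub> b \<odot>\<^bsub>M\<^esub> x"
    by (intro M_eqI M_add_closed M_smult_closed) (simp_all add: R.l_distr)
  show "(a \<otimes> b) \<odot>\<^bsub>M\<^esub> x = a \<odot>\<^bsub>M\<^esub> (b \<odot>\<^bsub>M\<^esub> x)"
    using * by (intro M_eqI M_smult_closed) (simp_all add: R.m_assoc)
next
  fix a x y assume "a \<in> carrier R" "x \<in> carrier M" "y \<in> carrier M"
  then show "a \<odot>\<^bsub>M\<^esub> (x \<oplus>\<^bsub>M\<^esub> y) = a \<odot>\<^bsub>M\<^esub> x \<oplus>\<^bsub>M\<^esub> a \<odot>\<^bsub>M\<^esub> y"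
    by (intro M_eqI M_add_closed M_smult_closed) (simp_all add: R.r_distr)
next
  fix x assume "x \<in> carrier M"
  then show "\<one> \<odot>\<^bsub>M\<^esub> x = x"
    by (intro M_eqI M_smult_closed) simp_all
qed (rule R.is_cring M_smult_closed; assumption?)+

sublocale M: module R M
  by (rule M_module)

lemma filt_iff:
  "x \<in> filt M i \<longleftrightarrow> x \<in> carrier M \<and>
     (\<forall>k<f. \<forall>t\<in>T. \<forall>m. (\<rho> ^^ m) t < i \<longrightarrow> \<pi> [^] Suc m divides x k t)"
  by (simp add: filt_M)

lemma filt_carrier: "x \<in> filt M i \<Longrightarrow> x \<in> carrier M"
  by (simp add: filt_iff)

lemma filt_divides:
  "x \<in> filt M i \<Longrightarrow> k < f \<Longrightarrow> t \<in> T \<Longrightarrow> (\<rho> ^^ m) t < i \<Longrightarrow> \<pi> [^] Suc m divides x k t"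
  by (simp add: filt_iff)

lemma filtI:
  "x \<in> carrier M \<Longrightarrow>
    (\<And>k t m. k < f \<Longrightarrow> t \<in> T \<Longrightarrow> (\<rho> ^^ m) t < i \<Longrightarrow> \<pi> [^] Suc m divides x k t) \<Longrightarrow> x \<in> filt M i"
  by (simp add: filt_iff)

lemma filt_1: "filt M 1 = carrier M"
proof
  show "carrier M \<subseteq> filt M 1"
  proof
    fix x assume "x \<in> carrier M"
    then show "x \<in> filt M 1"
    proof (rule filtI)
      fix k t m assume "t \<in> T" "(\<rho> ^^ m) t < 1"
      then show "\<pi> [^] Suc m divides x k t" using iter_ge_1[OF T_rho_ge_1, of t m] by linarith
    qed
  qed
qed (use filt_carrier in blast)

lemma filt_antimono: "i \<le> j \<Longrightarrow> filt M j \<subseteq> filt M i"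
  by (auto simp: filt_iff)

lemma filt_zero: "\<zero>\<^bsub>M\<^esub> \<in> filt M i"
  by (rule filtI) (simp_all add: divides_zero_R del: R.nat_pow_Suc)

lemma filt_add: "x \<in> filt M i \<Longrightarrow> y \<in> filt M i \<Longrightarrow> x \<oplus>\<^bsub>M\<^esub> y \<in> filt M i"
proof (rule filtI)
  fix k t m assume x: "x \<in> filt M i" and y: "y \<in> filt M i" and *: "k < f" "t \<in> T" "(\<rho> ^^ m) t < i"
  show "\<pi> [^] Suc m divides (x \<oplus>\<^bsub>M\<^esub> y) k t"
    unfolding add_apply[OF *(1,2)]
    by (intro unif_pow_divides_add filt_divides[OF x] filt_divides[OF y] *)
qed (use filt_carrier in simp)

lemma filt_smult:
  assumes "a \<in> carrier R" "x \<in> filt M i"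
  shows "a \<odot>\<^bsub>M\<^esub> x \<in> filt M i"
proof (rule filtI)
  fix k t m assume *: "k < f" "t \<in> T" "(\<rho> ^^ m) t < i"
  then have "\<pi> [^] Suc m divides x k t" using assms filt_divides by blast
  then have "\<pi> [^] (0 + Suc m) divides (a \<otimes> x k t)"
    using assms(1) by (intro unif_pow_divides_mult) (auto intro: dividesI[of a])
  then show "\<pi> [^] Suc m divides (a \<odot>\<^bsub>M\<^esub> x) k t" using * by simp
qed (use assms filt_carrier in simp)

text \<open>The coefficient \<open>x l t\<close> lies in the ideal that multiplies \<open>basis l t\<close> into step \<open>i\<close>.
  The same ideal multiplies any \<open>v\<close> of step \<open>t\<close> into step \<open>i\<close>: if \<open>j\<close> is minimal with
  \<open>\<rho>\<^sup>j(s) \<ge> t\<close>, then \<open>\<pi>\<^sup>j\<close> divides the coordinate of \<open>v\<close> at \<open>s\<close>, and \<open>\<rho>\<^sup>m\<^sup>-\<^sup>j(t) \<le> \<rho>\<^sup>m(s)\<close>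
  for \<open>m \<ge> j\<close>, so that the two divisibilities add up. This makes maps that are prescribed on
  basis vectors respect the filtration.\<close>

lemma filt_coord_smult:
  assumes c: "x \<in> filt M i" "l < f" "t \<in> T" and v: "v \<in> filt M t"
  shows "x l t \<odot>\<^bsub>M\<^esub> v \<in> filt M i"
proof (rule filtI)
  fix k s m assume *: "k < f" "s \<in> T" "(\<rho> ^^ m) s < i"
  have cR: "x l t \<in> carrier R" using c filt_carrier by simp
  have vR: "v k s \<in> carrier R" using v filt_carrier * by simp
  have s1: "1 \<le> s" and t1: "1 \<le> t" using * c T_rho_ge_1 by auto
  define j where "j = (LEAST j. t \<le> (\<rho> ^^ j) s)"
  have "t \<le> (\<rho> ^^ t) s" using iter_ge[OF s1, of t] by simp
  then have j: "t \<le> (\<rho> ^^ j) s" unfolding j_def by (rule LeastI)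
  have pj: "\<pi> [^] j divides v k s"
  proof (cases j)
    case 0
    then show ?thesis using vR by (auto intro: dividesI[of "v k s"])
  next
    case (Suc j')
    then have "(\<rho> ^^ j') s < t" using not_less_Least[of j' "\<lambda>j. t \<le> (\<rho> ^^ j) s"] by (simp add: j_def)
    then show ?thesis using filt_divides[OF v] * Suc by blast
  qed
  have "\<pi> [^] Suc m divides (x l t \<otimes> v k s)"
  proof (cases "m < j")
    case True
    have "\<pi> [^] (0 + j) divides (x l t \<otimes> v k s)"
      using cR pj by (intro unif_pow_divides_mult) (auto intro: dividesI[of "x l t"])
    then show ?thesis using True cR vR unif_pow_divides_le[of j _ "Suc m"] by simp
  next
    case False
    have "(\<rho> ^^ (m - j)) t \<le> (\<rho> ^^ (m - j)) ((\<rho> ^^ j) s)" using t1 j by (rule iter_le_right)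
    also have "\<dots> = (\<rho> ^^ m) s" using False funpow_add[of "m - j" j \<rho>] by simp
    finally have "(\<rho> ^^ (m - j)) t < i" using * by simp
    then have "\<pi> [^] Suc (m - j) divides x l t" using filt_divides c by blast
    then have "\<pi> [^] (Suc (m - j) + j) divides (x l t \<otimes> v k s)"
      using pj by (rule unif_pow_divides_mult)
    moreover have "Suc (m - j) + j = Suc m" using False by simp
    ultimately show ?thesis by metis
  qed
  then show "\<pi> [^] Suc m divides (x l t \<odot>\<^bsub>M\<^esub> v) k s" using * by simp
qed (use c v filt_carrier in simp)

lemma unif_smult_filt:
  assumes x: "x \<in> filt M i" and "1 \<le> i"
  shows "\<pi> \<odot>\<^bsub>M\<^esub> x \<in> filt M (\<rho> i)"
proof (rule filtI)
  fix k t m assume *: "k < f" "t \<in> T" "(\<rho> ^^ m) t < \<rho> i"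
  have xR: "x k t \<in> carrier R" using x filt_carrier * by simp
  have "\<pi> [^] m divides x k t"
  proof (cases m)
    case 0
    then show ?thesis using xR by (auto intro: dividesI[of "x k t"])
  next
    case (Suc m')
    have "(\<rho> ^^ m') t < i"
      using rho_le[OF assms(2), of "(\<rho> ^^ m') t"] *(3) Suc
      by (cases "(\<rho> ^^ m') t < i") simp_all
    then show ?thesis using filt_divides[OF x] * Suc by blast
  qed
  then have "\<pi> [^] (1 + m) divides (\<pi> \<otimes> x k t)"
    by (intro unif_pow_divides_mult) (auto intro: dividesI[of \<one>])
  then show "\<pi> [^] Suc m divides (\<pi> \<odot>\<^bsub>M\<^esub> x) k t" using * by simp
qed (use x filt_carrier in simp)

definition basis :: "nat \<Rightarrow> nat \<Rightarrow> nat \<Rightarrow> nat \<Rightarrow> 'a" where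
  "basis k t = tuple (\<lambda>k' t'. if k' = k \<and> t' = t then \<one> else \<zero>)"

lemma basis_apply [simp]:
  "k' < f \<Longrightarrow> t' \<in> T \<Longrightarrow> basis k t k' t' = (if k' = k \<and> t' = t then \<one> else \<zero>)"
  by (simp add: basis_def)

lemma basis_closed [simp]: "basis k t \<in> carrier M"
  unfolding basis_def by (rule tuple_closed) simp

lemma basis_filt:
  assumes "t \<in> T"
  shows "basis k t \<in> filt M t"
proof (rule filtI)
  fix k' t' m assume *: "k' < f" "t' \<in> T" "(\<rho> ^^ m) t' < t"
  then have "t' \<noteq> t" using iter_ge[of t m] T_rho_ge_1[OF assms] by auto
  then show "\<pi> [^] Suc m divides basis k t k' t'"
    using * by (simp add: divides_zero_R del: R.nat_pow_Suc)
qed simp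

definition restr :: "(nat \<Rightarrow> bool) \<Rightarrow> (nat \<Rightarrow> nat \<Rightarrow> 'a) \<Rightarrow> nat \<Rightarrow> nat \<Rightarrow> 'a" where
  "restr P x = tuple (\<lambda>k t. if P t then x k t else \<zero>)"

lemma restr_closed [simp]: "x \<in> carrier M \<Longrightarrow> restr P x \<in> carrier M"
  unfolding restr_def by (rule tuple_closed) simp

lemma restr_apply [simp]:
  "k < f \<Longrightarrow> t \<in> T \<Longrightarrow> restr P x k t = (if P t then x k t else \<zero>)"
  by (simp add: restr_def)

lemma restr_split: "x \<in> carrier M \<Longrightarrow> x = restr P x \<oplus>\<^bsub>M\<^esub> restr (\<lambda>t. \<not> P t) x"
  by (rule M_eqI) simp_all

lemma restr_filtI:
  assumes "x \<in> carrier M"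
    and "\<And>k t m. k < f \<Longrightarrow> t \<in> T \<Longrightarrow> P t \<Longrightarrow> (\<rho> ^^ m) t < i \<Longrightarrow> \<pi> [^] Suc m divides x k t"
  shows "restr P x \<in> filt M i"
  by (rule filtI) (use assms in \<open>simp_all add: divides_zero_R del: R.nat_pow_Suc\<close>)

text \<open>The set \<open>H\<close> plays the part of a submodule that contains finitely many given basis
  vectors.\<close>

lemma finite_support_span:
  assumes H: "\<zero>\<^bsub>M\<^esub> \<in> H" "\<And>x y. x \<in> H \<Longrightarrow> y \<in> H \<Longrightarrow> x \<oplus>\<^bsub>M\<^esub> y \<in> H"
      "\<And>a x. a \<in> carrier R \<Longrightarrow> x \<in> H \<Longrightarrow> a \<odot>\<^bsub>M\<^esub> x \<in> H"
    and "finite F" "x \<in> carrier M"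
    and "\<And>k t. k < f \<Longrightarrow> t \<in> T \<Longrightarrow> (k, t) \<notin> F \<Longrightarrow> x k t = \<zero>"
    and "\<And>k t. k < f \<Longrightarrow> t \<in> T \<Longrightarrow> (k, t) \<in> F \<Longrightarrow> basis k t \<in> H"
  shows "x \<in> H"
  using assms(4-)
proof (induction F arbitrary: x rule: finite_induct)
  case empty
  then have "x = \<zero>\<^bsub>M\<^esub>" by (intro M_eqI) simp_all
  then show ?case using H(1) by simp
next
  case (insert q F)
  obtain k t where q: "q = (k, t)" by (cases q)
  show ?case
  proof (cases "k < f \<and> t \<in> T")
    case True
    define y where "y = tuple (\<lambda>k' t'. if k' = k \<and> t' = t then \<zero> else x k' t')"
    have y: "y \<in> carrier M" unfolding y_def using insert.prems by (intro tuple_closed) simp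
    have "y \<in> H"
      by (rule insert.IH[OF y]) (use insert.prems q in \<open>auto simp: y_def\<close>)
    moreover have "x k t \<odot>\<^bsub>M\<^esub> basis k t \<in> H" using True insert.prems q by (intro H(3)) auto
    moreover have "x = y \<oplus>\<^bsub>M\<^esub> x k t \<odot>\<^bsub>M\<^esub> basis k t"
      using y insert.prems True by (intro M_eqI) (auto simp: y_def)
    ultimately show ?thesis using H(2) by metis
  next
    case False
    show ?thesis
    proof (rule insert.IH[OF insert.prems(1)])
      fix k' t' assume "k' < f" "t' \<in> T"
      then show "(k', t') \<notin> F \<Longrightarrow> x k' t' = \<zero>" "(k', t') \<in> F \<Longrightarrow> basis k' t' \<in> H"
        using insert.prems(2,3)[of k' t'] q False by auto
    qed
  qed
qed

section \<open>The levels of a character\<close>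

text \<open>Continuity is stated as vanishing on a step of the filtration; the equivalence is
  \<open>is_char_iff_continuous\<close>.\<close>

definition is_char :: "((nat \<Rightarrow> nat \<Rightarrow> 'a) \<Rightarrow> 'c) \<Rightarrow> bool" where
  "is_char \<chi> \<longleftrightarrow> \<chi> \<in> linear_maps R M W \<and> (\<exists>N\<ge>1. \<forall>x\<in>filt M N. \<chi> x = \<zero>\<^bsub>W\<^esub>)"

lemma linear_maps_add:
  "\<chi> \<in> linear_maps R M W \<Longrightarrow> x \<in> carrier M \<Longrightarrow> y \<in> carrier M \<Longrightarrow> \<chi> (x \<oplus>\<^bsub>M\<^esub> y) = \<chi> x \<oplus>\<^bsub>W\<^esub> \<chi> y"
  by (simp add: linear_maps_def)

lemma linear_maps_smult:
  "\<chi> \<in> linear_maps R M W \<Longrightarrow> a \<in> carrier R \<Longrightarrow> x \<in> carrier M \<Longrightarrow> \<chi> (a \<odot>\<^bsub>M\<^esub> x) = a \<odot>\<^bsub>W\<^esub> \<chi> x"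
  by (simp add: linear_maps_def)

lemma linear_maps_closed: "\<chi> \<in> linear_maps R M W \<Longrightarrow> x \<in> carrier M \<Longrightarrow> \<chi> x \<in> carrier W"
  by (auto simp: linear_maps_def)

lemma linear_maps_zero:
  assumes "\<chi> \<in> linear_maps R M W"
  shows "\<chi> \<zero>\<^bsub>M\<^esub> = \<zero>\<^bsub>W\<^esub>"
  using linear_maps_smult[OF assms, of \<zero> "\<zero>\<^bsub>M\<^esub>"] linear_maps_closed[OF assms, of "\<zero>\<^bsub>M\<^esub>"] by simp

text \<open>The powers \<open>\<pi>\<^sup>N\<close> map the whole module into its \<open>N\<close>-th step, so that a character has a bounded
  image.\<close>

lemma unif_pow_smult_filt:
  assumes x: "x \<in> carrier M"
  shows "\<pi> [^] N \<odot>\<^bsub>M\<^esub> x \<in> filt M N"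
proof (rule filtI)
  fix k t m assume *: "k < f" "t \<in> T" "(\<rho> ^^ m) t < N"
  then have m: "Suc m \<le> N" using iter_ge[of t m] T_rho_ge_1[of t] by simp
  have xR: "x k t \<in> carrier R" using x * by simp
  then have "\<pi> [^] N divides (\<pi> [^] N \<otimes> x k t)" by (auto intro: dividesI[of "x k t"])
  then have "\<pi> [^] Suc m divides (\<pi> [^] N \<otimes> x k t)"
    by (rule unif_pow_divides_le) (use m xR in simp_all)
  then show "\<pi> [^] Suc m divides (\<pi> [^] N \<odot>\<^bsub>M\<^esub> x) k t" using * by (simp only: smult_apply)
qed (use x in simp)

text \<open>The image is bounded by the previous lemma, and closed under multiplication by
  scalars.\<close>

lemma char_image_tors:
  assumes "is_char \<chi>"
  shows "\<exists>n. \<chi> ` filt M i = tors n"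
proof -
  obtain N where lin: "\<chi> \<in> linear_maps R M W" and N: "\<forall>x\<in>filt M N. \<chi> x = \<zero>\<^bsub>W\<^esub>"
    using assms by (auto simp: is_char_def)
  have sub: "\<chi> ` filt M i \<subseteq> tors N"
  proof
    fix w assume "w \<in> \<chi> ` filt M i"
    then obtain x where x: "x \<in> carrier M" "w = \<chi> x" using filt_carrier by blast
    then have "\<pi> [^] N \<odot>\<^bsub>W\<^esub> w = \<zero>\<^bsub>W\<^esub>"
      using N unif_pow_smult_filt[OF x(1), of N] linear_maps_smult[OF lin _ x(1), of "\<pi> [^] N"] by simp
    then show "w \<in> tors N" using x linear_maps_closed[OF lin] by (simp add: tors_def)
  qed
  show ?thesis
  proof (rule smult_closed_subset_eq_tors[OF sub])
    show "\<chi> ` filt M i \<noteq> {}" using filt_zero by blast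
    fix a w assume a: "a \<in> carrier R" and "w \<in> \<chi> ` filt M i"
    then obtain x where x: "x \<in> filt M i" "w = \<chi> x" by blast
    then have "a \<odot>\<^bsub>W\<^esub> w = \<chi> (a \<odot>\<^bsub>M\<^esub> x)" using linear_maps_smult[OF lin a] filt_carrier by simp
    then show "a \<odot>\<^bsub>W\<^esub> w \<in> \<chi> ` filt M i" using filt_smult[OF a x(1)] by blast
  qed blast
qed

definition level :: "((nat \<Rightarrow> nat \<Rightarrow> 'a) \<Rightarrow> 'c) \<Rightarrow> nat \<Rightarrow> nat" where
  "level \<chi> i = (SOME n. \<chi> ` filt M i = tors n)"

lemma image_level: "is_char \<chi> \<Longrightarrow> \<chi> ` filt M i = tors (level \<chi> i)"
  unfolding level_def using char_image_tors by (rule someI_ex)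

lemma jumps_eq_level:
  "is_char \<chi> \<Longrightarrow> jumps M \<chi> = {i. 1 \<le> i \<and> level \<chi> i \<noteq> level \<chi> (Suc i)}"
  by (simp add: jumps_def image_level tors_eq_iff)

lemma level_antimono:
  assumes "is_char \<chi>" "i \<le> j"
  shows "level \<chi> j \<le> level \<chi> i"
  using image_mono[OF filt_antimono[OF assms(2)], of \<chi>]
  by (simp add: image_level[OF assms(1)] tors_subset_iff)

text \<open>The generator \<open>\<omega> (level \<chi> i)\<close> of the image is some \<open>\<chi> x\<close>, and \<open>\<pi>\<close> moves \<open>x\<close> to step
  \<open>\<rho> i\<close>.\<close>

lemma level_rho:
  assumes \<chi>: "is_char \<chi>" and "1 \<le> i"
  shows "level \<chi> i \<le> Suc (level \<chi> (\<rho> i))"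
proof -
  have lin: "\<chi> \<in> linear_maps R M W" using \<chi> by (simp add: is_char_def)
  have "\<omega> (level \<chi> i) \<in> \<chi> ` filt M i" by (simp add: image_level[OF \<chi>] omega_tors_iff)
  then obtain x where x: "x \<in> filt M i" "\<omega> (level \<chi> i) = \<chi> x" by blast
  have "\<omega> (level \<chi> i - 1) = \<pi> \<odot>\<^bsub>W\<^esub> \<omega> (level \<chi> i)"
    using unif_pow_omega[of 1] by simp
  also have "\<dots> = \<chi> (\<pi> \<odot>\<^bsub>M\<^esub> x)"
    using x linear_maps_smult[OF lin] filt_carrier by simp
  also have "\<dots> \<in> tors (level \<chi> (\<rho> i))"
    using unif_smult_filt[OF x(1) assms(2)] image_level[OF \<chi>] by blast
  finally show ?thesis by (simp add: omega_tors_iff)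
qed

lemma level_Suc:
  assumes "is_char \<chi>" "1 \<le> i"
  shows "level \<chi> i \<le> Suc (level \<chi> (Suc i))"
  using level_rho[OF assms] level_antimono[OF assms(1), of "Suc i" "\<rho> i"] rho_gt[OF assms(2)] by simp

text \<open>Split \<open>x\<close> into the coordinates whose orbit under \<open>\<rho>\<close> passes through \<open>\<rho> b\<close> and the
  others. For the others the conditions of step \<open>\<rho> b\<close> and of the next step coincide. The
  former are divisible by \<open>\<pi>\<close>, and the quotient lies in step \<open>b\<close>.\<close>

lemma filt_rho_decomp:
  assumes b: "1 \<le> b" and x: "x \<in> filt M (\<rho> b)"
  obtains y z where "y \<in> filt M b" "z \<in> filt M (Suc (\<rho> b))" "x = \<pi> \<odot>\<^bsub>M\<^esub> y \<oplus>\<^bsub>M\<^esub> z"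
proof -
  let ?P = "\<lambda>t. \<exists>m. (\<rho> ^^ m) t = \<rho> b"
  define z where "z = restr (\<lambda>t. \<not> ?P t) x"
  define x' where "x' = restr ?P x"
  have z: "z \<in> filt M (Suc (\<rho> b))"
    unfolding z_def
  proof (rule restr_filtI)
    fix k t m assume *: "k < f" "t \<in> T" "\<not> ?P t" "(\<rho> ^^ m) t < Suc (\<rho> b)"
    then have "(\<rho> ^^ m) t \<noteq> \<rho> b" by blast
    then have "(\<rho> ^^ m) t < \<rho> b" using *(4) by simp
    then show "\<pi> [^] Suc m divides x k t" by (rule filt_divides[OF x *(1,2)])
  qed (rule filt_carrier[OF x])
  \<comment> \<open>An index \<open>t\<close> whose orbit meets \<open>\<rho> b\<close> does so at a positive step, since \<open>t\<close> is not in the image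
    of \<open>\<rho>\<close>; by then the coordinate is divisible by \<open>\<pi>\<close>.\<close>
  have div: "\<exists>c\<in>carrier R. x' k t = \<pi> \<otimes> c \<and> (\<forall>m. (\<rho> ^^ m) t < b \<longrightarrow> \<pi> [^] Suc m divides c)"
    if kt: "k < f" "t \<in> T" for k t
  proof (cases "?P t")
    case False
    then show ?thesis using kt
      by (intro bexI[of _ \<zero>]) (simp_all add: x'_def divides_zero_R del: R.nat_pow_Suc)
  next
    case True
    then obtain m where m: "(\<rho> ^^ m) t = \<rho> b" by blast
    have t1: "1 \<le> t" using kt T_rho_ge_1 by simp
    have "m \<noteq> 0"
    proof
      assume "m = 0"
      then show False using m kt b by (auto simp: T_rho_def)
    qed
    then obtain n where n: "m = Suc n" by (cases m) auto
    have "\<not> (\<rho> ^^ n) t < b" "\<not> b < (\<rho> ^^ n) t"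
      using rho_less[OF iter_ge_1[OF t1], of n b] rho_less[OF b, of "(\<rho> ^^ n) t"] m n by auto
    then have nb: "(\<rho> ^^ n) t = b" by simp
    then have "(\<rho> ^^ n) t < \<rho> b" using rho_gt b by simp
    then have "\<pi> [^] Suc n divides x k t" using filt_divides[OF x kt] by blast
    then obtain c where c: "c \<in> carrier R" "x k t = \<pi> [^] Suc n \<otimes> c" by (auto simp: factor_def)
    have "x' k t = \<pi> \<otimes> (\<pi> [^] n \<otimes> c)"
      using c True kt by (simp add: x'_def R.m_ac)
    moreover have "\<pi> [^] Suc i divides (\<pi> [^] n \<otimes> c)" if "(\<rho> ^^ i) t < b" for i
    proof -
      have "\<not> n \<le> i" using iter_le_left[OF t1, of n i] that nb by auto
      moreover have "\<pi> [^] n divides (\<pi> [^] n \<otimes> c)" using c by (auto intro: dividesI[of c])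
      ultimately show ?thesis using unif_pow_divides_le[of n _ "Suc i"] c(1)
        by (meson R.m_closed R.nat_pow_closed Suc_leI not_le unif_closed)
    qed
    ultimately show ?thesis using c(1) by (intro bexI[of _ "\<pi> [^] n \<otimes> c"]) auto
  qed
  then obtain c where c: "\<And>k t. k < f \<Longrightarrow> t \<in> T \<Longrightarrow> c k t \<in> carrier R \<and> x' k t = \<pi> \<otimes> c k t \<and>
      (\<forall>m. (\<rho> ^^ m) t < b \<longrightarrow> \<pi> [^] Suc m divides c k t)"
    by metis
  have y: "tuple c \<in> filt M b"
  proof (rule filtI)
    show "tuple c \<in> carrier M" using c by (intro tuple_closed) blast
    show "\<pi> [^] Suc m divides tuple c k t" if "k < f" "t \<in> T" "(\<rho> ^^ m) t < b" for k t m
      unfolding tuple_apply[OF that(1,2)] using c that by blast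
  qed
  have "x' = \<pi> \<odot>\<^bsub>M\<^esub> tuple c"
    using filt_carrier[OF x] filt_carrier[OF y] c by (intro M_eqI) (simp_all add: x'_def)
  then have "x = \<pi> \<odot>\<^bsub>M\<^esub> tuple c \<oplus>\<^bsub>M\<^esub> z"
    using restr_split[OF filt_carrier[OF x], of ?P] by (simp add: x'_def z_def)
  then show ?thesis by (rule that[OF y z])
qed

lemma level_lift:
  assumes \<chi>: "is_char \<chi>" and b: "1 \<le> b"
  shows "level \<chi> (\<rho> b) \<le> max (level \<chi> b - 1) (level \<chi> (Suc (\<rho> b)))" (is "_ \<le> max ?m ?n")
proof -
  have lin: "\<chi> \<in> linear_maps R M W" using \<chi> by (simp add: is_char_def)
  have "\<omega> (level \<chi> (\<rho> b)) \<in> \<chi> ` filt M (\<rho> b)" by (simp add: image_level[OF \<chi>] omega_tors_iff)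
  then obtain x where x: "x \<in> filt M (\<rho> b)" "\<omega> (level \<chi> (\<rho> b)) = \<chi> x" by blast
  obtain y z where yz: "y \<in> filt M b" "z \<in> filt M (Suc (\<rho> b))" "x = \<pi> \<odot>\<^bsub>M\<^esub> y \<oplus>\<^bsub>M\<^esub> z"
    using filt_rho_decomp[OF b x(1)] by blast
  have yM: "y \<in> carrier M" and zM: "z \<in> carrier M" using yz filt_carrier by auto
  have eq: "\<omega> (level \<chi> (\<rho> b)) = \<pi> \<odot>\<^bsub>W\<^esub> \<chi> y \<oplus>\<^bsub>W\<^esub> \<chi> z"
    using x(2) yz(3) yM zM by (simp add: linear_maps_add[OF lin] linear_maps_smult[OF lin])
  have "\<chi> y \<in> tors (level \<chi> b)" using yz(1) image_level[OF \<chi>] by blast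
  then have "\<pi> \<odot>\<^bsub>W\<^esub> \<chi> y \<in> tors ?m"
  proof (cases "level \<chi> b")
    case (Suc n)
    have "\<pi> [^] n \<odot>\<^bsub>W\<^esub> (\<pi> \<odot>\<^bsub>W\<^esub> \<chi> y) = \<pi> [^] Suc n \<odot>\<^bsub>W\<^esub> \<chi> y"
      using linear_maps_closed[OF lin yM] by (simp add: smult_assoc1)
    then show ?thesis
      using \<open>\<chi> y \<in> tors (level \<chi> b)\<close> linear_maps_closed[OF lin yM] Suc by (simp add: tors_def)
  qed simp
  then have "\<pi> \<odot>\<^bsub>W\<^esub> \<chi> y \<in> tors (max ?m ?n)" using tors_subset_iff[of ?m "max ?m ?n"] by auto
  moreover have "\<chi> z \<in> tors ?n" using yz(2) image_level[OF \<chi>] by blast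
  then have "\<chi> z \<in> tors (max ?m ?n)" using tors_subset_iff[of ?n "max ?m ?n"] by auto
  ultimately have "\<omega> (level \<chi> (\<rho> b)) \<in> tors (max ?m ?n)" unfolding eq by (rule tors_add)
  then show ?thesis by (simp only: omega_tors_iff)
qed

lemma level_eventually_0:
  assumes "is_char \<chi>"
  obtains N where "1 \<le> N" "level \<chi> N = 0"
proof -
  obtain N where N: "1 \<le> N" "\<forall>x\<in>filt M N. \<chi> x = \<zero>\<^bsub>W\<^esub>"
    using assms by (auto simp: is_char_def)
  then have "tors (level \<chi> N) \<subseteq> tors 0" unfolding image_level[OF assms, symmetric] by auto
  then have "level \<chi> N = 0" unfolding tors_subset_iff by simp
  then show ?thesis using N(1) that by blast
qed

theorem jumps_in_Jump:
  assumes "is_char \<chi>"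
  shows "jumps M \<chi> \<in> Jump \<rho>"
proof -
  obtain N where "1 \<le> N" "level \<chi> N = 0" using level_eventually_0[OF assms] .
  then show ?thesis
    unfolding jumps_eq_level[OF assms]
    using level_antimono[OF assms] level_rho[OF assms] level_lift[OF assms]
    by (intro level_jumps_in_Jump) auto
qed

lemma level_eq_of_same_jumps:
  assumes \<chi>: "is_char \<chi>" "is_char \<chi>'" and "jumps M \<chi> = jumps M \<chi>'" "1 \<le> i"
  shows "level \<chi> i = level \<chi>' i"
proof -
  obtain N N' where N: "level \<chi> N = 0" "level \<chi>' N' = 0"
    using level_eventually_0 \<chi> by metis
  define K where "K = max i (max N N')"
  have K: "level \<chi> K = level \<chi>' K"
    using level_antimono[OF \<chi>(1), of N K] level_antimono[OF \<chi>(2), of N' K] N by (simp add: K_def)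
  have step: "level \<psi> (Suc j) \<le> level \<psi> j \<and> level \<psi> j \<le> Suc (level \<psi> (Suc j))"
    if "is_char \<psi>" "1 \<le> j" for \<psi> j
    using level_antimono[OF that(1), of j "Suc j"] level_Suc[OF that] by simp
  show ?thesis
  proof (rule level_eq_of_jumps_eq[of "level \<chi>" "level \<chi>'" K i])
    fix j :: nat assume j: "1 \<le> j"
    show "level \<chi> (Suc j) \<le> level \<chi> j \<and> level \<chi> j \<le> Suc (level \<chi> (Suc j))"
      using \<chi>(1) j by (rule step)
    show "level \<chi>' (Suc j) \<le> level \<chi>' j \<and> level \<chi>' j \<le> Suc (level \<chi>' (Suc j))"
      using \<chi>(2) j by (rule step)
  next
    show "{i. 1 \<le> i \<and> level \<chi> i \<noteq> level \<chi> (Suc i)} = {i. 1 \<le> i \<and> level \<chi>' i \<noteq> level \<chi>' (Suc i)}"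
      using assms(3) by (simp only: jumps_eq_level \<chi>)
    show "i \<le> K" by (simp add: K_def)
  qed (rule K assms(4))+
qed

section \<open>Characters with a prescribed jump set\<close>

lemma unif_pow_smult_filt_iter:
  assumes "x \<in> filt M i" "1 \<le> i"
  shows "\<pi> [^] m \<odot>\<^bsub>M\<^esub> x \<in> filt M ((\<rho> ^^ m) i)"
proof (induction m)
  case 0
  then show ?case using assms filt_carrier by simp
next
  case (Suc m)
  have "\<pi> [^] Suc m \<odot>\<^bsub>M\<^esub> x = \<pi> \<odot>\<^bsub>M\<^esub> (\<pi> [^] m \<odot>\<^bsub>M\<^esub> x)"
    using filt_carrier[OF assms(1)] by (simp add: R.m_comm M.smult_assoc1[symmetric])
  then show ?case using unif_smult_filt[OF Suc.IH iter_ge_1[OF assms(2)]] by simp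
qed

lemma finsum_tors:
  assumes "finite F" "\<And>a. a \<in> F \<Longrightarrow> g a \<in> tors n"
  shows "finsum W g F \<in> tors n"
  using assms
proof (induction F rule: finite_induct)
  case (insert a F)
  then have "finsum W g (insert a F) = g a \<oplus>\<^bsub>W\<^esub> finsum W g F"
    by (intro W.M.finsum_insert) (auto intro: tors_carrier)
  then show ?case using insert by (simp add: tors_add)
qed simp

text \<open>The basis vector of index \<open>a\<close> gets an image of order exactly \<open>\<pi>\<close> to the power
  \<open>count_ge A a\<close>; its multiple by \<open>\<pi>\<^sup>m\<close> then has the order prescribed at \<open>\<rho>\<^sup>m(a)\<close> if that is
  in \<open>A\<close> along with all previous iterates.\<close>

definition Jump_char :: "nat set \<Rightarrow> (nat \<Rightarrow> nat \<Rightarrow> 'a) \<Rightarrow> 'c" where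
  "Jump_char A = (\<lambda>x\<in>carrier M. \<Oplus>\<^bsub>W\<^esub>a\<in>A \<inter> T. x 0 a \<odot>\<^bsub>W\<^esub> \<omega> (count_ge A a))"

lemma zero_less_f: "0 < f"
  using f_pos by simp

lemma Jump_char_linear:
  assumes A: "A \<in> Jump \<rho>"
  shows "Jump_char A \<in> linear_maps R M W"
proof -
  have fin: "finite (A \<inter> T)" using Jump_finite[OF A] by simp
  have summand: "x 0 a \<odot>\<^bsub>W\<^esub> \<omega> (count_ge A a) \<in> carrier W" if "x \<in> carrier M" "a \<in> A \<inter> T" for x a
    using that zero_less_f by simp
  show ?thesis
    unfolding linear_maps_def
  proof (intro CollectI conjI ballI)
    show "Jump_char A \<in> carrier M \<rightarrow>\<^sub>E carrier W"
    proof
      show "Jump_char A x \<in> carrier W" if "x \<in> carrier M" for x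
        using summand[OF that] that unfolding Jump_char_def by (simp add: W.M.finsum_closed Pi_def)
    qed (simp add: Jump_char_def)
  next
    fix x y assume x: "x \<in> carrier M" and y: "y \<in> carrier M"
    have "Jump_char A (x \<oplus>\<^bsub>M\<^esub> y) =
        (\<Oplus>\<^bsub>W\<^esub>a\<in>A \<inter> T. x 0 a \<odot>\<^bsub>W\<^esub> \<omega> (count_ge A a) \<oplus>\<^bsub>W\<^esub> y 0 a \<odot>\<^bsub>W\<^esub> \<omega> (count_ge A a))"
    proof -
      have "(x \<oplus>\<^bsub>M\<^esub> y) 0 a \<odot>\<^bsub>W\<^esub> \<omega> (count_ge A a) =
          x 0 a \<odot>\<^bsub>W\<^esub> \<omega> (count_ge A a) \<oplus>\<^bsub>W\<^esub> y 0 a \<odot>\<^bsub>W\<^esub> \<omega> (count_ge A a)"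
        if "a \<in> A \<inter> T" for a
        using that x y zero_less_f by (simp add: smult_l_distr)
      then have "(\<Oplus>\<^bsub>W\<^esub>a\<in>A \<inter> T. (x \<oplus>\<^bsub>M\<^esub> y) 0 a \<odot>\<^bsub>W\<^esub> \<omega> (count_ge A a)) =
        (\<Oplus>\<^bsub>W\<^esub>a\<in>A \<inter> T. x 0 a \<odot>\<^bsub>W\<^esub> \<omega> (count_ge A a) \<oplus>\<^bsub>W\<^esub> y 0 a \<odot>\<^bsub>W\<^esub> \<omega> (count_ge A a))"
        using summand x y by (intro W.M.finsum_cong') auto
      then show ?thesis using x y by (simp add: Jump_char_def)
    qed
    also have "\<dots> = Jump_char A x \<oplus>\<^bsub>W\<^esub> Jump_char A y"
      using summand x y by (simp add: Jump_char_def W.M.finsum_addf Pi_def)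
    finally show "Jump_char A (x \<oplus>\<^bsub>M\<^esub> y) = Jump_char A x \<oplus>\<^bsub>W\<^esub> Jump_char A y" .
  next
    fix a x assume a: "a \<in> carrier R" and x: "x \<in> carrier M"
    have "Jump_char A (a \<odot>\<^bsub>M\<^esub> x) = (\<Oplus>\<^bsub>W\<^esub>b\<in>A \<inter> T. a \<odot>\<^bsub>W\<^esub> (x 0 b \<odot>\<^bsub>W\<^esub> \<omega> (count_ge A b)))"
      unfolding Jump_char_def using x a
      by (auto intro!: W.M.finsum_cong' simp: zero_less_f smult_assoc1)
    also have "\<dots> = a \<odot>\<^bsub>W\<^esub> Jump_char A x"
      using summand x a fin by (simp add: Jump_char_def finsum_smult_ldistr Pi_def)
    finally show "Jump_char A (a \<odot>\<^bsub>M\<^esub> x) = a \<odot>\<^bsub>W\<^esub> Jump_char A x" .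
  qed
qed

text \<open>A coordinate of index \<open>a\<close> of a vector of step \<open>i\<close> is divisible by \<open>\<pi>\<^sup>n\<close> for the least
  \<open>n\<close> with \<open>\<rho>\<^sup>n(a) \<ge> i\<close>, and at most \<open>n\<close> elements of \<open>A\<close> lie in between (\<open>count_ge_iter\<close>).
  Conversely the level is reached at the first \<open>b \<in> A\<close> after \<open>i\<close>, by a multiple of the basis
  vector of the root of \<open>b\<close>.\<close>

lemma Jump_char_image:
  assumes A: "A \<in> Jump \<rho>" and i: "1 \<le> i"
  shows "Jump_char A ` filt M i = tors (count_ge A i)"
proof
  note lin = Jump_char_linear[OF A]
  have fin: "finite (A \<inter> T)" using Jump_finite[OF A] by simp
  show "Jump_char A ` filt M i \<subseteq> tors (count_ge A i)"
  proof
    fix w assume "w \<in> Jump_char A ` filt M i"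
    then obtain x where x: "x \<in> filt M i" "w = Jump_char A x" by blast
    have "x 0 a \<odot>\<^bsub>W\<^esub> \<omega> (count_ge A a) \<in> tors (count_ge A i)" if a: "a \<in> A \<inter> T" for a
    proof -
      have a1: "1 \<le> a" using Jump_ge_1[OF A] a by blast
      define n where "n = (LEAST n. i \<le> (\<rho> ^^ n) a)"
      have "i \<le> (\<rho> ^^ i) a" using iter_ge[OF a1, of i] by simp
      then have n: "i \<le> (\<rho> ^^ n) a" unfolding n_def by (rule LeastI)
      have xR: "x 0 a \<in> carrier R" using x(1) filt_carrier a zero_less_f by simp
      have "\<pi> [^] n divides x 0 a"
      proof (cases n)
        case 0
        then show ?thesis using xR by (auto intro: dividesI[of "x 0 a"])
      next
        case (Suc n')
        then have "(\<rho> ^^ n') a < i" using not_less_Least[of n' "\<lambda>n. i \<le> (\<rho> ^^ n) a"] by (simp add: n_def)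
        then show ?thesis using filt_divides[OF x(1) zero_less_f] a Suc by blast
      qed
      then obtain c where c: "c \<in> carrier R" "x 0 a = \<pi> [^] n \<otimes> c" by (auto simp: factor_def)
      then have "x 0 a \<odot>\<^bsub>W\<^esub> \<omega> (count_ge A a) = c \<odot>\<^bsub>W\<^esub> \<omega> (count_ge A a - n)"
        by (simp add: R.m_comm[of "\<pi> [^] n"] smult_assoc1 unif_pow_omega)
      moreover have "\<omega> (count_ge A a - n) \<in> tors (count_ge A i)"
        using count_ge_iter[OF A a1 n] by (simp add: omega_tors_iff)
      ultimately show ?thesis using tors_smult c(1) by simp
    qed
    then have "(\<Oplus>\<^bsub>W\<^esub>a\<in>A \<inter> T. x 0 a \<odot>\<^bsub>W\<^esub> \<omega> (count_ge A a)) \<in> tors (count_ge A i)"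
      using fin by (intro finsum_tors)
    then show "w \<in> tors (count_ge A i)" using x filt_carrier by (simp add: Jump_char_def)
  qed
  have "\<exists>x\<in>filt M i. Jump_char A x = \<omega> (count_ge A i)"
  proof (cases "count_ge A i = 0")
    case True
    then show ?thesis using filt_zero linear_maps_zero[OF lin] by (intro bexI[of _ "\<zero>\<^bsub>M\<^esub>"]) simp_all
  next
    case False
    then obtain b where b: "b \<in> A" "i \<le> b" "count_ge A b = count_ge A i"
      using count_ge_min[OF A] by blast
    obtain a m where a: "a \<in> A \<inter> T" "b = (\<rho> ^^ m) a" "count_ge A a = m + count_ge A b"
      using Jump_root[OF A b(1)] by blast
    define x where "x = \<pi> [^] m \<odot>\<^bsub>M\<^esub> basis 0 a"
    have "x \<in> filt M b"
      unfolding x_def a(2) using a(1) Jump_ge_1[OF A] by (intro unif_pow_smult_filt_iter basis_filt) auto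
    then have x: "x \<in> filt M i" using filt_antimono b(2) by blast
    have "Jump_char A x = (\<Oplus>\<^bsub>W\<^esub>c\<in>A \<inter> T. if a = c then \<pi> [^] m \<odot>\<^bsub>W\<^esub> \<omega> (count_ge A c) else \<zero>\<^bsub>W\<^esub>)"
      using filt_carrier[OF x] by (auto simp: Jump_char_def x_def zero_less_f intro!: W.M.finsum_cong')
    also have "\<dots> = \<pi> [^] m \<odot>\<^bsub>W\<^esub> \<omega> (count_ge A a)"
      using a(1) fin by (intro W.M.finsum_singleton) auto
    also have "\<dots> = \<omega> (count_ge A i)" using a b by (simp add: unif_pow_omega)
    finally show ?thesis using x by blast
  qed
  then obtain x where x: "x \<in> filt M i" "Jump_char A x = \<omega> (count_ge A i)" by blast
  show "tors (count_ge A i) \<subseteq> Jump_char A ` filt M i"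
  proof
    fix y assume "y \<in> tors (count_ge A i)"
    moreover have "\<omega> (count_ge A i) \<in> tors (count_ge A i)"
      "count_ge A i = 0 \<or> \<omega> (count_ge A i) \<notin> tors (count_ge A i - 1)"
      by (auto simp: omega_tors_iff)
    ultimately obtain c where c: "c \<in> carrier R" "y = c \<odot>\<^bsub>W\<^esub> \<omega> (count_ge A i)"
      using tors_generator by blast
    then have "y = Jump_char A (c \<odot>\<^bsub>M\<^esub> x)"
      using x linear_maps_smult[OF lin c(1)] filt_carrier by simp
    then show "y \<in> Jump_char A ` filt M i" using filt_smult[OF c(1) x(1)] by blast
  qed
qed

theorem Jump_realised:
  assumes A: "A \<in> Jump \<rho>"
  shows "is_char (Jump_char A)" "jumps M (Jump_char A) = A"
proof -
  define N where "N = Suc (Max (insert 0 A))"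
  have "a < N" if "a \<in> A" for a
    using that Jump_finite[OF A] by (simp add: N_def less_Suc_eq_le)
  then have "{a \<in> A. N \<le> a} = {}" by fastforce
  then have "count_ge A N = 0" unfolding count_ge_def by (simp only: card.empty)
  moreover have "1 \<le> N" by (simp add: N_def)
  ultimately have "Jump_char A ` filt M N = {\<zero>\<^bsub>W\<^esub>}" using Jump_char_image[OF A] by simp
  then have "\<forall>x\<in>filt M N. Jump_char A x = \<zero>\<^bsub>W\<^esub>" by blast
  then show "is_char (Jump_char A)"
    unfolding is_char_def using Jump_char_linear[OF A] \<open>1 \<le> N\<close> by blast
  have "jumps M (Jump_char A) = {i. 1 \<le> i \<and> count_ge A i \<noteq> count_ge A (Suc i)}"
  proof -
    have "Jump_char A ` filt M i \<noteq> Jump_char A ` filt M (Suc i) \<longleftrightarrow> count_ge A i \<noteq> count_ge A (Suc i)"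
      if "1 \<le> i" for i
      using Jump_char_image[OF A that] Jump_char_image[OF A, of "Suc i"] by (simp add: tors_eq_iff)
    then show ?thesis unfolding jumps_def Suc_eq_plus1[symmetric] by blast
  qed
  also have "\<dots> = A"
  proof -
    have "count_ge A i \<noteq> count_ge A (Suc i) \<longleftrightarrow> i \<in> A" for i
      by (subst count_ge_Suc[OF A, of i]) simp
    then show ?thesis using Jump_ge_1[OF A] by blast
  qed
  finally show "jumps M (Jump_char A) = A" .
qed

section \<open>Elementary automorphisms\<close>

text \<open>The linear map that fixes all basis vectors except \<open>basis k t\<close>, to which it adds \<open>v\<close>.\<close>

definition transvection :: "nat \<Rightarrow> nat \<Rightarrow> (nat \<Rightarrow> nat \<Rightarrow> 'a) \<Rightarrow> (nat \<Rightarrow> nat \<Rightarrow> 'a) \<Rightarrow> nat \<Rightarrow> nat \<Rightarrow> 'a" where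
  "transvection k t v = (\<lambda>x\<in>carrier M. x \<oplus>\<^bsub>M\<^esub> x k t \<odot>\<^bsub>M\<^esub> v)"

lemma transvection_filt_hom:
  assumes kt: "k < f" "t \<in> T" and v: "v \<in> filt M t"
  shows "transvection k t v \<in> filt_hom R M M"
proof -
  have vM: "v \<in> carrier M" using v by (rule filt_carrier)
  show ?thesis
    unfolding filt_hom_def linear_maps_def
  proof (intro CollectI conjI ballI allI impI)
    show "transvection k t v \<in> carrier M \<rightarrow>\<^sub>E carrier M"
      using vM kt by (auto simp: transvection_def)
  next
    fix x y assume x: "x \<in> carrier M" and y: "y \<in> carrier M"
    show "transvection k t v (x \<oplus>\<^bsub>M\<^esub> y) = transvection k t v x \<oplus>\<^bsub>M\<^esub> transvection k t v y"
      using x y vM kt by (simp add: transvection_def M.smult_l_distr M.M.a_ac)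
  next
    fix a x assume a: "a \<in> carrier R" and x: "x \<in> carrier M"
    show "transvection k t v (a \<odot>\<^bsub>M\<^esub> x) = a \<odot>\<^bsub>M\<^esub> transvection k t v x"
      using a x vM kt by (simp add: transvection_def M.smult_r_distr M.smult_assoc1)
  next
    fix i :: nat
    show "transvection k t v ` filt M i \<subseteq> filt M i"
    proof
      fix y assume "y \<in> transvection k t v ` filt M i"
      then obtain x where x: "x \<in> filt M i" "y = transvection k t v x" by blast
      then show "y \<in> filt M i"
        using filt_add[OF x(1) filt_coord_smult[OF x(1) kt v]] filt_carrier
        by (simp add: transvection_def)
    qed
  qed
qed

text \<open>The transvections along the multiples of a fixed \<open>v\<close> compose like the maps
  \<open>c \<mapsto> c (1 + d v\<^sub>k\<^sub>t)\<close> on the coefficient at \<open>(k, t)\<close>.\<close>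

lemma transvection_left_inverse:
  assumes kt: "k < f" "t \<in> T" and v: "v \<in> carrier M" and d: "d \<in> carrier R"
    and inv: "\<one> \<oplus> (\<one> \<oplus> v k t) \<otimes> d = \<zero>"
  shows "compose (carrier M) (transvection k t (d \<odot>\<^bsub>M\<^esub> v)) (transvection k t v) = (\<lambda>x\<in>carrier M. x)"
  unfolding compose_def
proof (rule restrict_ext)
  fix x assume x: "x \<in> carrier M"
  let ?c = "x k t" and ?a = "\<one> \<oplus> v k t"
  have cR: "?c \<in> carrier R" and aR: "?a \<in> carrier R" using x v kt by auto
  have "(x \<oplus>\<^bsub>M\<^esub> ?c \<odot>\<^bsub>M\<^esub> v) k t = ?c \<otimes> ?a"
    using cR kt v by (simp add: R.r_distr)
  then have "transvection k t (d \<odot>\<^bsub>M\<^esub> v) (transvection k t v x) =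
      (x \<oplus>\<^bsub>M\<^esub> ?c \<odot>\<^bsub>M\<^esub> v) \<oplus>\<^bsub>M\<^esub> (?c \<otimes> ?a) \<odot>\<^bsub>M\<^esub> (d \<odot>\<^bsub>M\<^esub> v)"
    using x v cR by (simp add: transvection_def)
  also have "\<dots> = x \<oplus>\<^bsub>M\<^esub> (?c \<odot>\<^bsub>M\<^esub> v \<oplus>\<^bsub>M\<^esub> (?c \<otimes> ?a) \<odot>\<^bsub>M\<^esub> (d \<odot>\<^bsub>M\<^esub> v))"
    using x v d cR aR by (simp add: M.M.a_assoc)
  also have "?c \<odot>\<^bsub>M\<^esub> v \<oplus>\<^bsub>M\<^esub> (?c \<otimes> ?a) \<odot>\<^bsub>M\<^esub> (d \<odot>\<^bsub>M\<^esub> v) = (?c \<otimes> (\<one> \<oplus> ?a \<otimes> d)) \<odot>\<^bsub>M\<^esub> v"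
    using v d cR aR by (simp only: M.smult_assoc1[symmetric] M.smult_l_distr[symmetric] R.m_closed
        R.r_distr R.one_closed R.r_one R.m_assoc)
  also have "\<dots> = \<zero>\<^bsub>M\<^esub>" using inv v cR by simp
  finally show "transvection k t (d \<odot>\<^bsub>M\<^esub> v) (transvection k t v x) = x" using x by simp
qed

text \<open>With \<open>u = 1 + v\<^sub>k\<^sub>t\<close> the inverse is the transvection along \<open>-u\<^sup>-\<^sup>1 v\<close>.\<close>

lemma transvection_Aut:
  assumes kt: "k < f" "t \<in> T" and v: "v \<in> filt M t" and u: "\<one> \<oplus> v k t \<in> Units R"
  shows "transvection k t v \<in> carrier (filt_Aut R M)"
proof -
  have vM: "v \<in> carrier M" using v by (rule filt_carrier)
  then have vR: "v k t \<in> carrier R" using kt by simp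
  define u where "u = \<one> \<oplus> v k t"
  define d where "d = \<ominus> (inv u)"
  have uU: "u \<in> Units R" using u by (simp add: u_def)
  then have uR: "u \<in> carrier R" "inv u \<in> carrier R" "u \<otimes> inv u = \<one>" "inv u \<otimes> u = \<one>"
    by (auto simp: R.Units_closed)
  have dR: "d \<in> carrier R" using uR by (simp add: d_def)
  have 1: "\<one> \<oplus> (\<one> \<oplus> v k t) \<otimes> d = \<zero>"
    unfolding u_def[symmetric] d_def using uR by (simp add: R.r_minus R.r_neg)
  have "\<one> \<oplus> (d \<odot>\<^bsub>M\<^esub> v) k t = inv u"
  proof -
    have "\<one> \<oplus> (d \<odot>\<^bsub>M\<^esub> v) k t = inv u \<otimes> u \<oplus> d \<otimes> v k t" using kt uR by simp
    also have "\<dots> = inv u \<otimes> (u \<ominus> v k t)"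
      using uR vR by (simp add: d_def R.minus_eq R.r_distr R.l_minus R.r_minus)
    also have "u \<ominus> v k t = \<one>" using vR by (simp add: u_def R.minus_eq R.a_assoc R.r_neg)
    finally show ?thesis using uR by simp
  qed
  then have 2: "\<one> \<oplus> (\<one> \<oplus> (d \<odot>\<^bsub>M\<^esub> v) k t) \<otimes> (\<ominus> u) = \<zero>"
    using uR by (simp add: R.r_minus R.r_neg)
  have "(\<ominus> u) \<otimes> d = \<one>" using uR by (simp add: d_def R.l_minus R.r_minus)
  then have v_eq: "(\<ominus> u) \<odot>\<^bsub>M\<^esub> (d \<odot>\<^bsub>M\<^esub> v) = v"
    using vM uR dR by (simp flip: M.smult_assoc1)
  have h: "transvection k t (d \<odot>\<^bsub>M\<^esub> v) \<in> filt_hom R M M"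
    using kt v dR by (intro transvection_filt_hom filt_smult)
  have "compose (carrier M) (transvection k t v) (transvection k t (d \<odot>\<^bsub>M\<^esub> v)) = (\<lambda>x\<in>carrier M. x)"
    using transvection_left_inverse[of k t "d \<odot>\<^bsub>M\<^esub> v" "\<ominus> u"] 2 kt v_eq vM uR dR by simp
  then show ?thesis
    using h transvection_filt_hom[OF kt v] transvection_left_inverse[OF kt vM dR 1]
    by (auto simp: filt_Aut_def)
qed

text \<open>Take the transvection along \<open>v = w - basis k t\<close>, for which \<open>1 + v\<^sub>k\<^sub>t = w\<^sub>k\<^sub>t\<close>.\<close>

lemma basis_change:
  assumes kt: "k < f" "t \<in> T" and w: "w \<in> filt M t" and u: "w k t \<in> Units R"
  obtains g where "g \<in> carrier (filt_Aut R M)" "g (basis k t) = w"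
    "\<And>k' t'. (k', t') \<noteq> (k, t) \<Longrightarrow> g (basis k' t') = basis k' t'"
proof -
  define v where "v = w \<oplus>\<^bsub>M\<^esub> (\<ominus> \<one>) \<odot>\<^bsub>M\<^esub> basis k t"
  have wM: "w \<in> carrier M" using w by (rule filt_carrier)
  then have wR: "w k t \<in> carrier R" using kt by simp
  have vf: "v \<in> filt M t" unfolding v_def using w kt by (intro filt_add filt_smult basis_filt) auto
  then have vM: "v \<in> carrier M" by (rule filt_carrier)
  have "\<one> \<oplus> (w k t \<oplus> \<ominus> \<one>) = w k t"
    using wR by (simp add: R.a_lcomm[of \<one> "w k t"] R.r_neg)
  then have "\<one> \<oplus> v k t = w k t"
    using kt by (simp add: v_def)
  then have "transvection k t v \<in> carrier (filt_Aut R M)"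
    using u by (intro transvection_Aut[OF kt vf]) simp
  moreover have "transvection k t v (basis k t) = w"
  proof -
    have "transvection k t v (basis k t) = basis k t \<oplus>\<^bsub>M\<^esub> v"
      using kt vM by (simp add: transvection_def)
    also have "\<dots> = w"
      using wM by (intro M_eqI) (auto simp: v_def R.a_ac R.r_neg R.l_minus)
    finally show ?thesis .
  qed
  moreover have "transvection k t v (basis k' t') = basis k' t'" if "(k', t') \<noteq> (k, t)" for k' t'
    using that kt vM by (auto simp: transvection_def)
  ultimately show ?thesis by (rule that)
qed

section \<open>Automorphisms and characters\<close>

lemma filt_Aut_iff:
  "g \<in> carrier (filt_Aut R M) \<longleftrightarrow> g \<in> filt_hom R M M \<and>
     (\<exists>h\<in>filt_hom R M M. \<forall>x\<in>carrier M. h (g x) = x \<and> g (h x) = x)"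
proof -
  have "compose (carrier M) h g = (\<lambda>x\<in>carrier M. x) \<longleftrightarrow> (\<forall>x\<in>carrier M. h (g x) = x)" for h g
    by (auto simp: compose_def fun_eq_iff restrict_def)
  then show ?thesis by (auto simp: filt_Aut_def)
qed

lemma filt_hom_filt: "g \<in> filt_hom R M M \<Longrightarrow> 1 \<le> i \<Longrightarrow> x \<in> filt M i \<Longrightarrow> g x \<in> filt M i"
  unfolding filt_hom_def by blast

lemma filt_hom_closed: "g \<in> filt_hom R M M \<Longrightarrow> x \<in> carrier M \<Longrightarrow> g x \<in> carrier M"
  using filt_hom_filt[of g 1 x] by (simp add: filt_1[unfolded One_nat_def])

lemma linear_maps_compose:
  assumes \<chi>: "\<chi> \<in> linear_maps R M N" and g: "g \<in> filt_hom R M M"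
  shows "compose (carrier M) \<chi> g \<in> linear_maps R M N"
proof -
  have g': "g x \<in> carrier M" if "x \<in> carrier M" for x using filt_hom_closed[OF g that] .
  show ?thesis
    using \<chi> g g' by (auto simp: linear_maps_def filt_hom_def compose_def Pi_def PiE_def)
qed

lemma filt_hom_compose:
  assumes "g \<in> filt_hom R M M" "h \<in> filt_hom R M M"
  shows "compose (carrier M) g h \<in> filt_hom R M M"
proof -
  have "compose (carrier M) g h ` filt M i \<subseteq> filt M i" if "1 \<le> i" for i
  proof
    fix y assume "y \<in> compose (carrier M) g h ` filt M i"
    then obtain x where x: "x \<in> filt M i" "y = g (h x)"
      using filt_carrier by (auto simp: compose_def)
    then show "y \<in> filt M i" using filt_hom_filt assms that by blast
  qed
  moreover have "compose (carrier M) g h \<in> linear_maps R M M"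
    using assms by (intro linear_maps_compose) (simp_all add: filt_hom_def)
  ultimately show ?thesis unfolding filt_hom_def by blast
qed

lemma filt_Aut_compose:
  assumes "g \<in> carrier (filt_Aut R M)" "h \<in> carrier (filt_Aut R M)"
  shows "compose (carrier M) g h \<in> carrier (filt_Aut R M)"
proof -
  have gh: "g \<in> filt_hom R M M" "h \<in> filt_hom R M M" using assms by (simp_all add: filt_Aut_iff)
  obtain g' where g': "g' \<in> filt_hom R M M" "\<forall>x\<in>carrier M. g' (g x) = x \<and> g (g' x) = x"
    using assms(1) unfolding filt_Aut_iff by blast
  obtain h' where h': "h' \<in> filt_hom R M M" "\<forall>x\<in>carrier M. h' (h x) = x \<and> h (h' x) = x"
    using assms(2) unfolding filt_Aut_iff by blast
  have "compose (carrier M) h' g' (compose (carrier M) g h x) = x \<and>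
      compose (carrier M) g h (compose (carrier M) h' g' x) = x" if x: "x \<in> carrier M" for x
    using x g' h' filt_hom_closed[OF gh(2) x] filt_hom_closed[OF g'(1) x]
      filt_hom_closed[OF gh(1), of "h x"] filt_hom_closed[OF h'(1), of "g' x"]
    by (simp add: compose_def)
  then show ?thesis
    unfolding filt_Aut_iff using filt_hom_compose gh g'(1) h'(1) by blast
qed

lemma filt_Aut_id: "(\<lambda>x\<in>carrier M. x) \<in> carrier (filt_Aut R M)"
proof -
  have "(\<lambda>x\<in>carrier M. x) \<in> filt_hom R M M"
    using filt_carrier by (auto simp: filt_hom_def linear_maps_def)
  then show ?thesis unfolding filt_Aut_iff by (intro conjI bexI) auto
qed

lemma filt_Aut_image:
  assumes "g \<in> carrier (filt_Aut R M)" "1 \<le> i"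
  shows "g ` filt M i = filt M i"
proof
  have g: "g \<in> filt_hom R M M" using assms by (simp add: filt_Aut_iff)
  show "g ` filt M i \<subseteq> filt M i" using filt_hom_filt[OF g assms(2)] by blast
  obtain h where h: "h \<in> filt_hom R M M" "\<forall>x\<in>carrier M. h (g x) = x \<and> g (h x) = x"
    using assms(1) unfolding filt_Aut_iff by blast
  show "filt M i \<subseteq> g ` filt M i"
  proof
    fix x assume x: "x \<in> filt M i"
    then have "x = g (h x)" using h(2) filt_carrier by simp
    then show "x \<in> g ` filt M i" using filt_hom_filt[OF h(1) assms(2) x] by blast
  qed
qed

lemma compose_Aut_image:
  assumes "g \<in> carrier (filt_Aut R M)" "1 \<le> i"
  shows "compose (carrier M) \<chi> g ` filt M i = \<chi> ` filt M i"
proof -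
  have "compose (carrier M) \<chi> g ` filt M i = \<chi> ` (g ` filt M i)"
    unfolding image_image by (rule image_cong) (auto simp: compose_def dest: filt_carrier)
  then show ?thesis using filt_Aut_image[OF assms] by simp
qed

lemma jumps_compose_Aut:
  assumes "g \<in> carrier (filt_Aut R M)"
  shows "jumps M (compose (carrier M) \<chi> g) = jumps M \<chi>"
proof -
  have "compose (carrier M) \<chi> g ` filt M i \<noteq> compose (carrier M) \<chi> g ` filt M (i + 1) \<longleftrightarrow>
      \<chi> ` filt M i \<noteq> \<chi> ` filt M (i + 1)" if "1 \<le> i" for i
    using compose_Aut_image[OF assms that, of \<chi>] compose_Aut_image[OF assms, of "i + 1" \<chi>] by simp
  then show ?thesis unfolding jumps_def by blast
qed

lemma is_char_compose_Aut:
  assumes \<chi>: "is_char \<chi>" and g: "g \<in> carrier (filt_Aut R M)"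
  shows "is_char (compose (carrier M) \<chi> g)"
proof -
  obtain N where N: "1 \<le> N" "\<forall>x\<in>filt M N. \<chi> x = \<zero>\<^bsub>W\<^esub>" using \<chi> by (auto simp: is_char_def)
  have "compose (carrier M) \<chi> g x = \<zero>\<^bsub>W\<^esub>" if "x \<in> filt M N" for x
  proof -
    have "compose (carrier M) \<chi> g x \<in> \<chi> ` filt M N" using compose_Aut_image[OF g N(1), of \<chi>] that by blast
    then show ?thesis using N by auto
  qed
  moreover have "compose (carrier M) \<chi> g \<in> linear_maps R M W"
    using \<chi> g by (intro linear_maps_compose) (simp_all add: is_char_def filt_Aut_iff)
  ultimately show ?thesis using N(1) unfolding is_char_def by blast
qed

lemma is_char_linear: "is_char \<chi> \<Longrightarrow> \<chi> \<in> linear_maps R M W"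
  by (simp add: is_char_def)

lemma restr_ge_filt:
  assumes "x \<in> carrier M"
  shows "restr (\<lambda>t. \<not> t < N) x \<in> filt M N"
proof (rule restr_filtI[OF assms])
  fix k t m assume "t \<in> T" "\<not> t < N" "(\<rho> ^^ m) t < N"
  then show "\<pi> [^] Suc m divides x k t" using iter_ge[of t m] T_rho_ge_1[of t] by simp
qed

text \<open>Although \<open>T\<close> may be infinite, a character only sees finitely many coordinates: those
  of large index form a vector in a step on which it vanishes.\<close>

lemma char_eqI:
  assumes \<chi>: "is_char \<chi>" "is_char \<chi>'"
    and eq: "\<And>k t. k < f \<Longrightarrow> t \<in> T \<Longrightarrow> \<chi> (basis k t) = \<chi>' (basis k t)"
  shows "\<chi> = \<chi>'"
proof -
  note lin = \<chi>[THEN is_char_linear]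
  obtain N where N: "\<forall>x\<in>filt M N. \<chi> x = \<zero>\<^bsub>W\<^esub>" using \<chi>(1) by (auto simp: is_char_def)
  obtain N' where N': "\<forall>x\<in>filt M N'. \<chi>' x = \<zero>\<^bsub>W\<^esub>" using \<chi>(2) by (auto simp: is_char_def)
  define K where "K = max N N'"
  have K: "\<chi> x = \<chi>' x" if "x \<in> filt M K" for x
  proof -
    have "x \<in> filt M N" "x \<in> filt M N'"
      using that filt_antimono[of N K] filt_antimono[of N' K] unfolding K_def
      by (meson max.cobounded1 max.cobounded2 subsetD)+
    then show ?thesis using N N' by simp
  qed
  define H where "H = {x \<in> carrier M. \<chi> x = \<chi>' x}"
  have H_add: "x \<oplus>\<^bsub>M\<^esub> y \<in> H" if "x \<in> H" "y \<in> H" for x y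
    using that by (simp add: H_def linear_maps_add[OF lin(1)] linear_maps_add[OF lin(2)])
  have H_smult: "a \<odot>\<^bsub>M\<^esub> x \<in> H" if "a \<in> carrier R" "x \<in> H" for a x
    using that by (simp add: H_def linear_maps_smult[OF lin(1)] linear_maps_smult[OF lin(2)])
  have H_zero: "\<zero>\<^bsub>M\<^esub> \<in> H"
    by (simp add: H_def linear_maps_zero[OF lin(1)] linear_maps_zero[OF lin(2)])
  have "\<chi> x = \<chi>' x" if x: "x \<in> carrier M" for x
  proof -
    have "restr (\<lambda>t. t < K) x \<in> H"
    proof (rule finite_support_span[OF H_zero H_add H_smult, of "{..<f} \<times> {..<K}"])
      show "restr (\<lambda>t. t < K) x \<in> carrier M" using x by simp
      show "restr (\<lambda>t. t < K) x k t = \<zero>" if "k < f" "t \<in> T" "(k, t) \<notin> {..<f} \<times> {..<K}" for k t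
        using that by simp
      show "basis k t \<in> H" if "k < f" "t \<in> T" for k t
        using that eq by (simp add: H_def)
    qed simp_all
    moreover have "restr (\<lambda>t. \<not> t < K) x \<in> H"
      using K[OF restr_ge_filt[OF x]] x by (simp add: H_def)
    ultimately have "restr (\<lambda>t. t < K) x \<oplus>\<^bsub>M\<^esub> restr (\<lambda>t. \<not> t < K) x \<in> H" by (rule H_add)
    then have "x \<in> H" using restr_split[OF x, of "\<lambda>t. t < K"] by simp
    then show ?thesis by (simp add: H_def)
  qed
  moreover have "\<chi> \<in> extensional (carrier M)" "\<chi>' \<in> extensional (carrier M)"
    using lin by (auto simp: linear_maps_def PiE_def)
  ultimately show ?thesis by (intro extensionalityI)
qed

definition disagreement :: "((nat \<Rightarrow> nat \<Rightarrow> 'a) \<Rightarrow> 'c) \<Rightarrow> ((nat \<Rightarrow> nat \<Rightarrow> 'a) \<Rightarrow> 'c) \<Rightarrow> (nat \<times> nat) set" where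
  "disagreement \<chi> \<chi>' = {(k, t). k < f \<and> t \<in> T \<and> \<chi> (basis k t) \<noteq> \<chi>' (basis k t)}"

lemma finite_disagreement:
  assumes \<chi>: "is_char \<chi>" "is_char \<chi>'"
  shows "finite (disagreement \<chi> \<chi>')"
proof -
  obtain N where N: "\<forall>x\<in>filt M N. \<chi> x = \<zero>\<^bsub>W\<^esub>" using \<chi>(1) by (auto simp: is_char_def)
  obtain N' where N': "\<forall>x\<in>filt M N'. \<chi>' x = \<zero>\<^bsub>W\<^esub>" using \<chi>(2) by (auto simp: is_char_def)
  have "t < max N N'" if "t \<in> T" "\<chi> (basis k t) \<noteq> \<chi>' (basis k t)" for k t
  proof (rule ccontr)
    assume "\<not> t < max N N'"
    then have "N \<le> t" "N' \<le> t" by auto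
    then have "basis k t \<in> filt M N" "basis k t \<in> filt M N'"
      using basis_filt[OF that(1), of k] filt_antimono by (meson subsetD)+
    then show False using N N' that(2) by simp
  qed
  then have "disagreement \<chi> \<chi>' \<subseteq> {..<f} \<times> {..<max N N'}" by (auto simp: disagreement_def)
  then show ?thesis by (rule finite_subset) simp
qed

text \<open>For \<open>t \<in> T\<close> the step \<open>t\<close> is spanned by the basis vectors of index \<open>t\<close> and the next
  step.\<close>

lemma level_le_of_basis:
  assumes \<chi>: "is_char \<chi>" and t: "t \<in> T"
    and b: "\<And>k. k < f \<Longrightarrow> \<chi> (basis k t) \<in> tors n" and "level \<chi> (Suc t) \<le> n"
  shows "level \<chi> t \<le> n"
proof -
  note lin = is_char_linear[OF \<chi>]
  define H where "H = {x \<in> carrier M. \<chi> x \<in> tors n}"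
  have H_add: "x \<oplus>\<^bsub>M\<^esub> y \<in> H" if "x \<in> H" "y \<in> H" for x y
    using that by (simp add: H_def linear_maps_add[OF lin] tors_add)
  have H_smult: "a \<odot>\<^bsub>M\<^esub> x \<in> H" if "a \<in> carrier R" "x \<in> H" for a x
    using that by (simp add: H_def linear_maps_smult[OF lin] tors_smult)
  have H_zero: "\<zero>\<^bsub>M\<^esub> \<in> H" by (simp add: H_def linear_maps_zero[OF lin])
  have "\<chi> x \<in> tors n" if x: "x \<in> filt M t" for x
  proof -
    have xM: "x \<in> carrier M" using x by (rule filt_carrier)
    have "restr (\<lambda>s. s = t) x \<in> H"
    proof (rule finite_support_span[OF H_zero H_add H_smult, of "{..<f} \<times> {t}"])
      show "restr (\<lambda>s. s = t) x \<in> carrier M" using xM by simp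
      show "restr (\<lambda>s. s = t) x k s = \<zero>" if "k < f" "s \<in> T" "(k, s) \<notin> {..<f} \<times> {t}" for k s
        using that by simp
      show "basis k s \<in> H" if "k < f" "s \<in> T" "(k, s) \<in> {..<f} \<times> {t}" for k s
        using that b by (simp add: H_def)
    qed simp_all
    moreover have "restr (\<lambda>s. \<not> s = t) x \<in> H"
    proof -
      have "restr (\<lambda>s. \<not> s = t) x \<in> filt M (Suc t)"
      proof (rule restr_filtI[OF xM])
        fix k s m assume *: "k < f" "s \<in> T" "\<not> s = t" "(\<rho> ^^ m) s < Suc t"
        \<comment> \<open>As \<open>t\<close> is not in the image of \<open>\<rho>\<close>, no other orbit passes through it.\<close>
        have "(\<rho> ^^ m) s \<noteq> t"
        proof (cases m)
          case (Suc m')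
          then show ?thesis using t iter_ge_1[OF T_rho_ge_1[OF *(2)], of m'] by (auto simp: T_rho_def)
        qed (use * in simp)
        then have "(\<rho> ^^ m) s < t" using * by simp
        then show "\<pi> [^] Suc m divides x k s" by (rule filt_divides[OF x *(1,2)])
      qed
      then have "\<chi> (restr (\<lambda>s. \<not> s = t) x) \<in> tors (level \<chi> (Suc t))"
        using image_level[OF \<chi>] by blast
      then show ?thesis using assms(4) tors_subset_iff xM by (auto simp: H_def)
    qed
    ultimately have "restr (\<lambda>s. s = t) x \<oplus>\<^bsub>M\<^esub> restr (\<lambda>s. \<not> s = t) x \<in> H" by (rule H_add)
    then have "x \<in> H" using restr_split[OF xM, of "\<lambda>s. s = t"] by simp
    then show ?thesis by (simp add: H_def)
  qed
  then have "tors (level \<chi> t) \<subseteq> tors n" unfolding image_level[OF \<chi>, symmetric] by blast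
  then show ?thesis by (simp only: tors_subset_iff)
qed

lemma W_cancel:
  assumes "v \<in> carrier W" "w \<in> carrier W"
  shows "v \<oplus>\<^bsub>W\<^esub> (w \<oplus>\<^bsub>W\<^esub> (\<ominus> \<one>) \<odot>\<^bsub>W\<^esub> v) = w"
  using assms by (simp add: smult_l_minus W.M.a_lcomm[of v w] W.M.r_neg)

text \<open>A preimage \<open>v\<close> of \<open>w\<close> in step \<open>t\<close> may have a non-unit coordinate at \<open>(k, t)\<close>. Adding a
  vector of the kernel repairs this: as \<open>w\<close> generates, \<open>\<chi> (basis k t) = c w\<close> for some \<open>c\<close>,
  and \<open>basis k t - c v\<close> is in the kernel.\<close>

lemma retarget_generator:
  assumes \<chi>: "is_char \<chi>" and kt: "k < f" "t \<in> T"
    and w: "w \<in> tors (level \<chi> t)" "w \<notin> tors (level \<chi> t - 1)"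
  obtains v where "v \<in> filt M t" "v k t \<in> Units R" "\<chi> v = w"
proof -
  note lin = is_char_linear[OF \<chi>]
  obtain v where v: "v \<in> filt M t" "\<chi> v = w" using w(1) image_level[OF \<chi>] by (metis imageE)
  have vM: "v \<in> carrier M" using v(1) by (rule filt_carrier)
  then have vR: "v k t \<in> carrier R" using kt by simp
  have wW: "w \<in> carrier W" using w(1) by (rule tors_carrier)
  show ?thesis
  proof (cases "v k t \<in> Units R")
    case True
    then show ?thesis using that v by blast
  next
    case False
    have "\<chi> (basis k t) \<in> tors (level \<chi> t)"
      using basis_filt[OF kt(2)] image_level[OF \<chi>] by blast
    then obtain c where c: "c \<in> carrier R" "\<chi> (basis k t) = c \<odot>\<^bsub>W\<^esub> w"
      using tors_generator w by blast
    let ?v = "v \<oplus>\<^bsub>M\<^esub> (basis k t \<oplus>\<^bsub>M\<^esub> (\<ominus> c) \<odot>\<^bsub>M\<^esub> v)"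
    have "?v \<in> filt M t"
      using v(1) c(1) basis_filt[OF kt(2)] by (intro filt_add filt_smult) auto
    moreover have "\<chi> ?v = w"
      using vM v(2) c wW
      by (simp add: linear_maps_add[OF lin] linear_maps_smult[OF lin] smult_l_minus W.M.r_neg)
    moreover have "?v k t \<in> Units R"
    proof -
      have "?v k t = \<one> \<oplus> (\<one> \<oplus> \<ominus> c) \<otimes> v k t"
        using kt vR c(1) by (simp add: R.l_distr R.a_lcomm)
      then show ?thesis using one_plus_mult_not_Unit[OF vR False, of "\<one> \<oplus> \<ominus> c"] c(1) by simp
    qed
    ultimately show ?thesis by (intro that)
  qed
qed

text \<open>A multiple of \<open>v\<close> corrects the value at \<open>basis k t\<close> and keeps the coordinate a unit.\<close>

lemma retarget_with_generator:
  assumes \<chi>: "is_char \<chi>" and kt: "k < f" "t \<in> T"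
    and v: "v \<in> filt M t" "v k t \<notin> Units R" "\<chi> v \<notin> tors (level \<chi> t - 1)"
    and w: "w \<in> tors (level \<chi> t)"
  obtains u where "u \<in> filt M t" "u k t \<in> Units R" "\<chi> u = w"
proof -
  note lin = is_char_linear[OF \<chi>]
  let ?b = "basis k t"
  have vM: "v \<in> carrier M" using v(1) by (rule filt_carrier)
  then have vR: "v k t \<in> carrier R" using kt by simp
  have b: "\<chi> ?b \<in> tors (level \<chi> t)" using basis_filt[OF kt(2)] image_level[OF \<chi>] by blast
  have "\<chi> v \<in> tors (level \<chi> t)" using v(1) image_level[OF \<chi>] by blast
  moreover have "w \<oplus>\<^bsub>W\<^esub> (\<ominus> \<one>) \<odot>\<^bsub>W\<^esub> \<chi> ?b \<in> tors (level \<chi> t)"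
    using w b by (intro tors_add tors_smult) auto
  ultimately obtain c where c: "c \<in> carrier R" "w \<oplus>\<^bsub>W\<^esub> (\<ominus> \<one>) \<odot>\<^bsub>W\<^esub> \<chi> ?b = c \<odot>\<^bsub>W\<^esub> \<chi> v"
    using tors_generator v(3) by blast
  let ?u = "?b \<oplus>\<^bsub>M\<^esub> c \<odot>\<^bsub>M\<^esub> v"
  have "?u \<in> filt M t" using v(1) c(1) basis_filt[OF kt(2)] by (intro filt_add filt_smult)
  moreover have "?u k t \<in> Units R"
    using one_plus_mult_not_Unit[OF vR v(2) c(1)] kt by simp
  moreover have "\<chi> ?u = w"
  proof -
    have "\<chi> ?u = \<chi> ?b \<oplus>\<^bsub>W\<^esub> c \<odot>\<^bsub>W\<^esub> \<chi> v"
      using vM c(1) by (simp add: linear_maps_add[OF lin] linear_maps_smult[OF lin])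
    also have "\<dots> = w" unfolding c(2)[symmetric] using w b tors_carrier by (intro W_cancel)
    finally show ?thesis .
  qed
  ultimately show ?thesis by (intro that)
qed

text \<open>Take an index \<open>t\<close> at which the characters differ. If they differ on a basis vector of
  index \<open>t\<close> whose image under \<open>\<chi>'\<close> generates, \<open>retarget_generator\<close> applies. Otherwise they
  agree on the basis vectors where \<open>\<chi>'\<close> generates, so that one of these serves as \<open>v\<close> in
  \<open>retarget_with_generator\<close>; and if there are none, then \<open>t\<close> is not a jump, so that the next
  step contains a suitable \<open>v\<close>.\<close>

lemma reduce_disagreement:
  assumes \<chi>: "is_char \<chi>" "is_char \<chi>'" and jumps: "jumps M \<chi> = jumps M \<chi>'" and "\<chi> \<noteq> \<chi>'"
  obtains k t v where "(k, t) \<in> disagreement \<chi> \<chi>'" "v \<in> filt M t" "v k t \<in> Units R"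
    "\<chi> v = \<chi>' (basis k t)"
proof -
  obtain k t where kt: "k < f" "t \<in> T" "\<chi> (basis k t) \<noteq> \<chi>' (basis k t)"
    using char_eqI[OF \<chi>] \<open>\<chi> \<noteq> \<chi>'\<close> by blast
  define n where "n = level \<chi> t"
  have t1: "1 \<le> t" using T_rho_ge_1 kt(2) by simp
  have n': "level \<chi>' t = n" using level_eq_of_same_jumps[OF \<chi> jumps t1] by (simp add: n_def)
  have in_tors: "\<chi> (basis l t) \<in> tors n" "\<chi>' (basis l t) \<in> tors n" for l
    using basis_filt[OF kt(2)] image_level[OF \<chi>(1), of t] image_level[OF \<chi>(2), of t] n'
    by (auto simp: n_def)
  have "n \<noteq> 0"
  proof
    assume "n = 0"
    then show False using in_tors[of k] kt(3) by simp
  qed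
  show ?thesis
  proof (cases "\<exists>l<f. \<chi>' (basis l t) \<notin> tors (n - 1) \<and> \<chi> (basis l t) \<noteq> \<chi>' (basis l t)")
    case True
    then obtain l where l: "l < f" "\<chi>' (basis l t) \<notin> tors (n - 1)" "\<chi> (basis l t) \<noteq> \<chi>' (basis l t)"
      by blast
    obtain v where "v \<in> filt M t" "v l t \<in> Units R" "\<chi> v = \<chi>' (basis l t)"
      using retarget_generator[OF \<chi>(1) l(1) kt(2)] in_tors(2)[of l] l(2) by (metis n_def)
    then show ?thesis using that[of l t v] l kt(2) by (simp add: disagreement_def)
  next
    case False
    obtain v where v: "v \<in> filt M t" "v k t \<notin> Units R" "\<chi> v \<notin> tors (n - 1)"
    proof (cases "\<exists>l<f. \<chi>' (basis l t) \<notin> tors (n - 1)")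
      case True
      then obtain l where l: "l < f" "\<chi>' (basis l t) \<notin> tors (n - 1)" by blast
      then have eq: "\<chi> (basis l t) = \<chi>' (basis l t)" using False by blast
      then have "l \<noteq> k" using kt(3) by auto
      then have "basis l t k t = \<zero>" using kt by simp
      moreover have "\<zero> \<notin> Units R" using unif_mult_not_Unit[of \<zero>] by simp
      ultimately show ?thesis using that[of "basis l t"] basis_filt[OF kt(2)] l(2) eq by simp
    next
      case none: False
      have "\<not> level \<chi>' (Suc t) \<le> n - 1"
      proof
        assume "level \<chi>' (Suc t) \<le> n - 1"
        then have "level \<chi>' t \<le> n - 1"
          using none by (intro level_le_of_basis[OF \<chi>(2) kt(2)]) auto
        then show False using n' \<open>n \<noteq> 0\<close> by simp
      qed
      then have "n \<le> level \<chi> (Suc t)"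
        using level_eq_of_same_jumps[OF \<chi> jumps, of "Suc t"] by simp
      then have "\<omega> n \<in> \<chi> ` filt M (Suc t)" unfolding image_level[OF \<chi>(1)] by (simp add: omega_tors_iff)
      then obtain v where v: "v \<in> filt M (Suc t)" "\<chi> v = \<omega> n" by auto
      have "\<pi> [^] Suc 0 divides v k t" by (rule filt_divides[OF v(1) kt(1,2)]) simp
      then obtain c where "c \<in> carrier R" "v k t = \<pi> \<otimes> c" by (auto simp: factor_def)
      then have "v k t \<notin> Units R" using unif_mult_not_Unit by simp
      moreover have "v \<in> filt M t" using v(1) filt_antimono[of t "Suc t"] by auto
      moreover have "\<chi> v \<notin> tors (n - 1)" using v(2) \<open>n \<noteq> 0\<close> by (simp add: omega_tors_iff)
      ultimately show ?thesis using that by blast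
    qed
    then obtain u where "u \<in> filt M t" "u k t \<in> Units R" "\<chi> u = \<chi>' (basis k t)"
      using retarget_with_generator[OF \<chi>(1) kt(1,2) v(1,2)] in_tors(2)[of k] by (metis n_def)
    then show ?thesis using that[of k t u] kt by (simp add: disagreement_def)
  qed
qed

theorem Aut_equivalent_of_jumps_eq:
  assumes "is_char \<chi>" "is_char \<chi>'" "jumps M \<chi> = jumps M \<chi>'"
  shows "\<exists>g\<in>carrier (filt_Aut R M). \<chi>' = compose (carrier M) \<chi> g"
  using assms
proof (induction "card (disagreement \<chi> \<chi>')" arbitrary: \<chi> rule: less_induct)
  case less
  note \<chi> = less.prems(1,2)
  show ?case
  proof (cases "\<chi> = \<chi>'")
    case True
    have "\<chi> \<in> extensional (carrier M)"
      using is_char_linear[OF \<chi>(1)] by (auto simp: linear_maps_def PiE_def)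
    then have "compose (carrier M) \<chi> (\<lambda>x\<in>carrier M. x) = \<chi>"
      by (intro extensionalityI[of _ "carrier M"]) (auto simp: compose_def)
    then show ?thesis using filt_Aut_id True by metis
  next
    case False
    obtain k t v where kt: "(k, t) \<in> disagreement \<chi> \<chi>'"
      and v: "v \<in> filt M t" "v k t \<in> Units R" "\<chi> v = \<chi>' (basis k t)"
      using reduce_disagreement[OF \<chi> less.prems(3) False] by blast
    have kt': "k < f" "t \<in> T" using kt by (auto simp: disagreement_def)
    obtain g where g: "g \<in> carrier (filt_Aut R M)" "g (basis k t) = v"
      and g_other: "\<And>k' t'. (k', t') \<noteq> (k, t) \<Longrightarrow> g (basis k' t') = basis k' t'"
      using basis_change[OF kt' v(1,2)] by blast
    define \<psi> where "\<psi> = compose (carrier M) \<chi> g"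
    have \<psi>: "is_char \<psi>" "jumps M \<psi> = jumps M \<chi>'"
      unfolding \<psi>_def using is_char_compose_Aut[OF \<chi>(1) g(1)] jumps_compose_Aut[OF g(1), of \<chi>] less.prems(3)
      by simp_all
    have "\<psi> (basis k t) = \<chi>' (basis k t)" using g(2) v(3) by (simp add: \<psi>_def compose_def)
    moreover have "\<psi> (basis k' t') = \<chi> (basis k' t')" if "(k', t') \<noteq> (k, t)" for k' t'
      using g_other[OF that] by (simp add: \<psi>_def compose_def)
    ultimately have "disagreement \<psi> \<chi>' \<subseteq> disagreement \<chi> \<chi>' - {(k, t)}"
      unfolding disagreement_def by force
    then have "disagreement \<psi> \<chi>' \<subset> disagreement \<chi> \<chi>'" using kt by blast
    then have "card (disagreement \<psi> \<chi>') < card (disagreement \<chi> \<chi>')"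
      by (rule psubset_card_mono[OF finite_disagreement[OF \<chi>]])
    then obtain h where h: "h \<in> carrier (filt_Aut R M)" "\<chi>' = compose (carrier M) \<psi> h"
      using less.hyps[OF _ \<psi>(1) \<chi>(2) \<psi>(2)] by blast
    have "h \<in> carrier M \<rightarrow> carrier M"
      using h(1) filt_hom_closed by (auto simp: filt_Aut_iff)
    then have "compose (carrier M) \<chi> (compose (carrier M) g h) = compose (carrier M) \<psi> h"
      unfolding \<psi>_def by (rule compose_assoc)
    then show ?thesis using h filt_Aut_compose[OF g(1) h(1)] by metis
  qed
qed

section \<open>The topology of the filtration\<close>

lemma openin_filt_topology:
  "openin (filt_topology M) U \<longleftrightarrow>
     U \<subseteq> carrier M \<and> (\<forall>x\<in>U. \<exists>i\<ge>1. \<forall>y\<in>filt M i. x \<oplus>\<^bsub>M\<^esub> y \<in> U)"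
proof -
  define P where "P U \<longleftrightarrow> U \<subseteq> carrier M \<and> (\<forall>x\<in>U. \<exists>i\<ge>1. \<forall>y\<in>filt M i. x \<oplus>\<^bsub>M\<^esub> y \<in> U)" for U
  have "P (U \<inter> V)" if U: "P U" and V: "P V" for U V
    unfolding P_def
  proof (intro conjI ballI)
    show "U \<inter> V \<subseteq> carrier M" using U unfolding P_def by blast
    fix x assume x: "x \<in> U \<inter> V"
    obtain i where i: "1 \<le> i" "\<forall>y\<in>filt M i. x \<oplus>\<^bsub>M\<^esub> y \<in> U" using U x unfolding P_def by blast
    obtain j where j: "1 \<le> j" "\<forall>y\<in>filt M j. x \<oplus>\<^bsub>M\<^esub> y \<in> V" using V x unfolding P_def by blast
    have "filt M (max i j) \<subseteq> filt M i" "filt M (max i j) \<subseteq> filt M j"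
      by (intro filt_antimono; simp)+
    then have "\<forall>y\<in>filt M (max i j). x \<oplus>\<^bsub>M\<^esub> y \<in> U \<inter> V" using i(2) j(2) by blast
    moreover have "1 \<le> max i j" using i(1) by simp
    ultimately show "\<exists>k\<ge>1. \<forall>y\<in>filt M k. x \<oplus>\<^bsub>M\<^esub> y \<in> U \<inter> V" by blast
  qed
  moreover have "P (\<Union>K)" if K: "\<forall>U\<in>K. P U" for K
    unfolding P_def
  proof (intro conjI ballI)
    show "\<Union>K \<subseteq> carrier M" using K unfolding P_def by blast
    fix x assume "x \<in> \<Union>K"
    then obtain U where U: "U \<in> K" "x \<in> U" by blast
    then obtain i where "1 \<le> i" "\<forall>y\<in>filt M i. x \<oplus>\<^bsub>M\<^esub> y \<in> U" using K unfolding P_def by blast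
    then show "\<exists>i\<ge>1. \<forall>y\<in>filt M i. x \<oplus>\<^bsub>M\<^esub> y \<in> \<Union>K" using U(1) by blast
  qed
  ultimately have "istopology P" unfolding istopology_def by blast
  then have "openin (topology P) = P" by (rule topology_inverse')
  moreover have "filt_topology M = topology P"
    unfolding filt_topology_def P_def by simp
  ultimately show ?thesis by (simp add: P_def)
qed

lemma topspace_filt_topology: "topspace (filt_topology M) = carrier M"
proof
  show "topspace (filt_topology M) \<subseteq> carrier M"
    unfolding topspace_def openin_filt_topology by blast
  have "openin (filt_topology M) (carrier M)"
    unfolding openin_filt_topology using filt_carrier M_add_closed by (intro conjI) blast+
  then show "carrier M \<subseteq> topspace (filt_topology M)" by (rule openin_subset)
qed

lemma continuous_iff_trivial_on_step:
  assumes lin: "\<chi> \<in> linear_maps R M W"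
  shows "continuous_map (filt_topology M) (discrete_topology (carrier W)) \<chi> \<longleftrightarrow>
    (\<exists>N\<ge>1. \<forall>x\<in>filt M N. \<chi> x = \<zero>\<^bsub>W\<^esub>)"
proof
  assume "continuous_map (filt_topology M) (discrete_topology (carrier W)) \<chi>"
  then have "openin (filt_topology M) {x \<in> topspace (filt_topology M). \<chi> x \<in> {\<zero>\<^bsub>W\<^esub>}}"
    by (rule openin_continuous_map_preimage) simp
  then have "openin (filt_topology M) {x \<in> carrier M. \<chi> x \<in> {\<zero>\<^bsub>W\<^esub>}}"
    by (simp only: topspace_filt_topology)
  moreover have "\<zero>\<^bsub>M\<^esub> \<in> {x \<in> carrier M. \<chi> x \<in> {\<zero>\<^bsub>W\<^esub>}}" using linear_maps_zero[OF lin] by simp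
  ultimately obtain i where i: "1 \<le> i"
      "\<forall>y\<in>filt M i. \<zero>\<^bsub>M\<^esub> \<oplus>\<^bsub>M\<^esub> y \<in> {x \<in> carrier M. \<chi> x \<in> {\<zero>\<^bsub>W\<^esub>}}"
    unfolding openin_filt_topology by blast
  then have "\<forall>y\<in>filt M i. \<chi> y = \<zero>\<^bsub>W\<^esub>" using filt_carrier by simp
  then show "\<exists>N\<ge>1. \<forall>x\<in>filt M N. \<chi> x = \<zero>\<^bsub>W\<^esub>" using i(1) by blast
next
  assume "\<exists>N\<ge>1. \<forall>x\<in>filt M N. \<chi> x = \<zero>\<^bsub>W\<^esub>"
  then obtain N where N: "1 \<le> N" "\<forall>x\<in>filt M N. \<chi> x = \<zero>\<^bsub>W\<^esub>" by blast
  have "\<chi> (x \<oplus>\<^bsub>M\<^esub> y) = \<chi> x" if "x \<in> carrier M" "y \<in> filt M N" for x y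
    using that N(2) filt_carrier linear_maps_closed[OF lin] by (simp add: linear_maps_add[OF lin])
  then have "\<forall>y\<in>filt M N. x \<oplus>\<^bsub>M\<^esub> y \<in> {x \<in> carrier M. \<chi> x \<in> U}"
    if "x \<in> {x \<in> carrier M. \<chi> x \<in> U}" for x U
    using that filt_carrier M_add_closed by simp
  then have "openin (filt_topology M) {x \<in> carrier M. \<chi> x \<in> U}" for U
    unfolding openin_filt_topology using N(1) by blast
  then show "continuous_map (filt_topology M) (discrete_topology (carrier W)) \<chi>"
    unfolding continuous_map_def topspace_filt_topology topspace_discrete_topology
    using linear_maps_closed[OF lin] by blast
qed

lemma is_char_iff_continuous:
  "is_char \<chi> \<longleftrightarrow> \<chi> \<in> linear_maps R M W \<and>
     continuous_map (filt_topology M) (discrete_topology (carrier W)) \<chi>"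
  unfolding is_char_def using continuous_iff_trivial_on_step by blast

end

section \<open>The absolute value on the rational numbers\<close>

locale padic_prime =
  fixes p :: nat
  assumes prime_p: "Factorial_Ring.prime p"
begin

lemma p_gt_1: "real p > 1"
  using prime_gt_1_nat[OF prime_p] by simp

lemma prime_int_p: "Factorial_Ring.prime (int p)"
  using prime_p by simp

lemma padic_abs_zero [simp]: "padic_abs p 0 = 0"
  by (simp add: padic_abs_def)

lemma padic_abs_of_int_divide:
  assumes "a \<noteq> 0" "b \<noteq> 0"
  shows "padic_abs p (of_int a / of_int b) =
    real p powi (int (multiplicity (int p) b) - int (multiplicity (int p) a))"
proof -
  define x :: rat where "x = of_int a / of_int b"
  obtain c d where cd: "quotient_of x = (c, d)" by (cases "quotient_of x")
  have x: "x = of_int c / of_int d" using quotient_of_div[OF cd] .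
  have d: "d > 0" using quotient_of_denom_pos[OF cd] .
  have x0: "x \<noteq> 0" using assms by (simp add: x_def)
  then have c: "c \<noteq> 0" using x by auto
  have "(of_int (a * d) :: rat) = of_int (c * b)"
    using x assms d unfolding x_def by (simp add: field_simps)
  then have eq: "a * d = c * b" by (simp only: of_int_eq_iff)
  have pe: "prime_elem (int p)" using prime_int_p by blast
  have "multiplicity (int p) a + multiplicity (int p) d =
      multiplicity (int p) c + multiplicity (int p) b"
    using prime_elem_multiplicity_mult_distrib[OF pe, of a d]
      prime_elem_multiplicity_mult_distrib[OF pe, of c b] assms c d eq by simp
  then have "int (multiplicity (int p) d) - int (multiplicity (int p) c) =
      int (multiplicity (int p) b) - int (multiplicity (int p) a)"
    by linarith
  then show ?thesis using x0 cd unfolding x_def[symmetric] by (simp add: padic_abs_def)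
qed

lemma rat_quotient_cases:
  obtains a b where "(x::rat) = of_int a / of_int b" "b \<noteq> 0"
  using quotient_of_div[of x] quotient_of_denom_pos[of x]
  by (metis less_irrefl surj_pair)

lemma padic_abs_mult: "padic_abs p (x * y) = padic_abs p x * padic_abs p y"
proof (cases "x = 0 \<or> y = 0")
  case False
  obtain a b where x: "x = of_int a / of_int b" "b \<noteq> 0" by (rule rat_quotient_cases)
  obtain c d where y: "y = of_int c / of_int d" "d \<noteq> 0" by (rule rat_quotient_cases)
  have nz: "a \<noteq> 0" "c \<noteq> 0" using x y False by auto
  have xy: "x * y = of_int (a * c) / of_int (b * d)" using x y by simp
  have pe: "prime_elem (int p)" using prime_int_p by blast
  have "real p powi (int (multiplicity (int p) (b * d)) - int (multiplicity (int p) (a * c))) =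
      real p powi (int (multiplicity (int p) b) - int (multiplicity (int p) a) +
        (int (multiplicity (int p) d) - int (multiplicity (int p) c)))"
    using nz x(2) y(2) by (simp add: prime_elem_multiplicity_mult_distrib[OF pe] algebra_simps)
  also have "\<dots> = padic_abs p x * padic_abs p y"
    using nz x y p_gt_1 by (subst power_int_add) (simp_all add: padic_abs_of_int_divide)
  finally show ?thesis
    unfolding xy using nz x(2) y(2) by (subst padic_abs_of_int_divide) simp_all
qed auto

lemma padic_abs_power_int:
  assumes "x \<noteq> 0"
  obtains k where "padic_abs p x = real p powi k"
  using assms by (auto simp: padic_abs_def)

lemma padic_abs_nonneg [simp]: "padic_abs p x \<ge> 0"
  using p_gt_1 by (auto simp: padic_abs_def)

lemma padic_abs_pos: "x \<noteq> 0 \<Longrightarrow> padic_abs p x > 0"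
  using p_gt_1 by (auto simp: padic_abs_def)

lemma padic_abs_eq_0_iff [simp]: "padic_abs p x = 0 \<longleftrightarrow> x = 0"
  using padic_abs_pos[of x] by (cases "x = 0") auto

lemma padic_abs_one [simp]: "padic_abs p 1 = 1"
  using padic_abs_of_int_divide[of 1 1] by simp

lemma padic_abs_p: "padic_abs p (of_nat p) = 1 / real p"
proof -
  have "p \<noteq> 0" using prime_p by auto
  then show ?thesis
    using padic_abs_of_int_divide[of "int p" 1] prime_int_p p_gt_1
    by (simp add: power_int_minus inverse_eq_divide)
qed

lemma padic_abs_minus [simp]: "padic_abs p (- x) = padic_abs p x"
proof -
  have "padic_abs p (-1) ^ 2 = 1"
    using padic_abs_mult[of "-1" "-1"] by (simp add: power2_eq_square)
  then have "padic_abs p (-1) = 1"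
    using padic_abs_nonneg[of "-1"] by (simp add: power2_eq_1_iff)
  then show ?thesis using padic_abs_mult[of "-1" x] by simp
qed

lemma padic_abs_diff_commute: "padic_abs p (x - y) = padic_abs p (y - x)"
  using padic_abs_minus[of "x - y"] by simp

lemma padic_abs_inverse: "padic_abs p (inverse x) = inverse (padic_abs p x)"
proof (cases "x = 0")
  case False
  then have "padic_abs p x * padic_abs p (inverse x) = 1"
    using padic_abs_mult[of x "inverse x"] by simp
  then show ?thesis by (metis inverse_unique)
qed simp

text \<open>The ultrametric inequality in normalised form: a power of \<open>p\<close> that divides the
  denominator and the numerator of \<open>y = a / b\<close> divides \<open>a + b\<close>.\<close>

lemma padic_abs_one_plus_le:
  assumes "padic_abs p y \<le> 1"
  shows "padic_abs p (1 + y) \<le> 1"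
proof (cases "y = 0 \<or> 1 + y = 0")
  case False
  obtain a b where y: "y = of_int a / of_int b" "b \<noteq> 0" by (rule rat_quotient_cases)
  have a: "a \<noteq> 0" using y False by auto
  have "real p powi (int (multiplicity (int p) b) - int (multiplicity (int p) a)) \<le> 1"
    using assms padic_abs_of_int_divide[OF a y(2)] y by simp
  then have "\<not> int (multiplicity (int p) b) - int (multiplicity (int p) a) > 0"
    using p_gt_1 one_less_power_int[of "real p"] by (meson not_le)
  then have le: "multiplicity (int p) b \<le> multiplicity (int p) a" by simp
  have s: "1 + y = of_int (a + b) / of_int b" using y by (simp add: field_simps)
  then have ab: "a + b \<noteq> 0" using False by auto
  have "int p ^ multiplicity (int p) b dvd a + b"
    using le by (intro dvd_add multiplicity_dvd multiplicity_dvd')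
  then have "multiplicity (int p) b \<le> multiplicity (int p) (a + b)"
    using ab prime_int_p by (intro multiplicity_geI) auto
  moreover have "padic_abs p (1 + y) =
      real p powi (int (multiplicity (int p) b) - int (multiplicity (int p) (a + b)))"
    unfolding s using ab y(2) by (rule padic_abs_of_int_divide)
  ultimately show ?thesis
    using p_gt_1 power_int_increasing[of "int (multiplicity (int p) b) - int (multiplicity (int p) (a + b))" 0 "real p"]
    by simp
qed (use assms in auto)

lemma padic_abs_add_le: "padic_abs p (x + y) \<le> max (padic_abs p x) (padic_abs p y)"
proof -
  have *: "padic_abs p (x + y) \<le> padic_abs p x"
    if "padic_abs p y \<le> padic_abs p x" for x y
  proof (cases "x = 0")
    case True
    then show ?thesis using that by simp
  next
    case False
    have "padic_abs p (y / x) \<le> 1"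
      using that padic_abs_pos[OF False]
      unfolding divide_inverse padic_abs_mult padic_abs_inverse
      by (metis divide_inverse divide_le_eq_1_pos)
    then have "padic_abs p (1 + y / x) \<le> 1" by (rule padic_abs_one_plus_le)
    moreover have "padic_abs p (x + y) = padic_abs p x * padic_abs p (1 + y / x)"
      using False by (simp flip: padic_abs_mult add: distrib_left)
    ultimately show ?thesis by (simp add: mult_left_le)
  qed
  show ?thesis
    using *[of x y] *[of y x] by (cases "padic_abs p y \<le> padic_abs p x") (auto simp: add.commute)
qed

lemma padic_abs_add_less:
  "padic_abs p x < e \<Longrightarrow> padic_abs p y < e \<Longrightarrow> padic_abs p (x + y) < e"
  using padic_abs_add_le[of x y] by linarith

lemma padic_abs_diff_le: "padic_abs p (x - y) \<le> max (padic_abs p x) (padic_abs p y)"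
  using padic_abs_add_le[of x "- y"] by simp

lemma padic_abs_eq_of_diff_less:
  assumes "padic_abs p (x - y) < padic_abs p x"
  shows "padic_abs p y = padic_abs p x"
  using padic_abs_diff_le[of x "x - y"] padic_abs_add_le[of "x - y" y] assms by auto

lemma abs_padic_abs_diff_le: "\<bar>padic_abs p x - padic_abs p y\<bar> \<le> padic_abs p (x - y)"
proof (cases "padic_abs p (x - y) < max (padic_abs p x) (padic_abs p y)")
  case True
  then have "padic_abs p x = padic_abs p y"
    using padic_abs_eq_of_diff_less[of x y] padic_abs_eq_of_diff_less[of y x]
    by (auto simp: padic_abs_diff_commute max_def split: if_splits)
  then show ?thesis by simp
next
  case False
  then show ?thesis using padic_abs_nonneg[of x] padic_abs_nonneg[of y] by linarith
qed

section \<open>Cauchy sequences\<close>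

abbreviation "C \<equiv> padic_Cauchy p"

lemma Cauchy_carrier_iff:
  "s \<in> carrier C \<longleftrightarrow> (\<forall>e>0. \<exists>N. \<forall>m\<ge>N. \<forall>n\<ge>N. padic_abs p (s m - s n) < e)"
  by (simp add: padic_Cauchy_def)

lemma Cauchy_simps [simp]:
  "s \<otimes>\<^bsub>C\<^esub> t = (\<lambda>n. s n * t n)" "s \<oplus>\<^bsub>C\<^esub> t = (\<lambda>n. s n + t n)"
  "\<one>\<^bsub>C\<^esub> = (\<lambda>n. 1)" "\<zero>\<^bsub>C\<^esub> = (\<lambda>n. 0)"
  by (simp_all add: padic_Cauchy_def)

lemma const_Cauchy [simp]: "(\<lambda>n. c) \<in> carrier C"
  by (simp add: Cauchy_carrier_iff)

definition seq_norm :: "(nat \<Rightarrow> rat) \<Rightarrow> real" where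
  "seq_norm s = lim (\<lambda>n. padic_abs p (s n))"

lemma seq_norm_LIMSEQ:
  assumes "s \<in> carrier C"
  shows "(\<lambda>n. padic_abs p (s n)) \<longlonglongrightarrow> seq_norm s"
proof -
  have "Cauchy (\<lambda>n. padic_abs p (s n))"
  proof (rule metric_CauchyI)
    fix e :: real assume "e > 0"
    then obtain N where N: "\<forall>m\<ge>N. \<forall>n\<ge>N. padic_abs p (s m - s n) < e"
      using assms by (auto simp: Cauchy_carrier_iff)
    have "dist (padic_abs p (s m)) (padic_abs p (s n)) < e" if "m \<ge> N" "n \<ge> N" for m n
      using abs_padic_abs_diff_le[of "s m" "s n"] N that
      unfolding dist_real_def by (meson le_less_trans)
    then show "\<exists>M. \<forall>m\<ge>M. \<forall>n\<ge>M. dist (padic_abs p (s m)) (padic_abs p (s n)) < e" by blast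
  qed
  then show ?thesis
    unfolding seq_norm_def by (simp only: Cauchy_convergent convergent_LIMSEQ_iff[symmetric])
qed

lemma seq_norm_eqI:
  "(\<lambda>n. padic_abs p (s n)) \<longlonglongrightarrow> l \<Longrightarrow> seq_norm s = l"
  unfolding seq_norm_def by (rule limI)

lemma seq_norm_nonneg: "s \<in> carrier C \<Longrightarrow> seq_norm s \<ge> 0"
  using seq_norm_LIMSEQ by (rule LIMSEQ_le_const) auto

lemma Cauchy_add:
  assumes "s \<in> carrier C" "t \<in> carrier C"
  shows "(\<lambda>n. s n + t n) \<in> carrier C"
  unfolding Cauchy_carrier_iff
proof (intro allI impI)
  fix e :: real assume "e > 0"
  then obtain N K where N: "\<forall>m\<ge>N. \<forall>n\<ge>N. padic_abs p (s m - s n) < e"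
    and K: "\<forall>m\<ge>K. \<forall>n\<ge>K. padic_abs p (t m - t n) < e"
    using assms unfolding Cauchy_carrier_iff by meson
  have "padic_abs p (s m + t m - (s n + t n)) < e" if "m \<ge> max N K" "n \<ge> max N K" for m n
  proof -
    have "s m + t m - (s n + t n) = (s m - s n) + (t m - t n)" by simp
    also have "padic_abs p \<dots> < e"
      using N K that by (intro padic_abs_add_less) auto
    finally show ?thesis .
  qed
  then show "\<exists>N. \<forall>m\<ge>N. \<forall>n\<ge>N. padic_abs p (s m + t m - (s n + t n)) < e" by blast
qed

lemma Cauchy_bounded:
  assumes "s \<in> carrier C"
  obtains B where "B > 0" "\<And>n. padic_abs p (s n) \<le> B"
proof -
  have "Bseq (\<lambda>n. padic_abs p (s n))"
    using seq_norm_LIMSEQ[OF assms] convergentI convergent_imp_Bseq by blast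
  then obtain B where B: "B > 0" "\<forall>n. norm (padic_abs p (s n)) \<le> B"
    unfolding Bseq_def by blast
  show ?thesis
    by (rule that[OF B(1)]) (use B(2) in auto)
qed

lemma Cauchy_mult:
  assumes "s \<in> carrier C" "t \<in> carrier C"
  shows "(\<lambda>n. s n * t n) \<in> carrier C"
  unfolding Cauchy_carrier_iff
proof (intro allI impI)
  fix e :: real assume e: "e > 0"
  obtain B where B: "B > 0" "\<And>n. padic_abs p (s n) \<le> B" using Cauchy_bounded[OF assms(1)] by blast
  obtain D where D: "D > 0" "\<And>n. padic_abs p (t n) \<le> D" using Cauchy_bounded[OF assms(2)] by blast
  have "e / D > 0" "e / B > 0" using e B D by auto
  then obtain N K where N: "\<forall>m\<ge>N. \<forall>n\<ge>N. padic_abs p (s m - s n) < e / D"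
    and K: "\<forall>m\<ge>K. \<forall>n\<ge>K. padic_abs p (t m - t n) < e / B"
    using assms unfolding Cauchy_carrier_iff by meson
  have "padic_abs p (s m * t m - s n * t n) < e" if mn: "m \<ge> max N K" "n \<ge> max N K" for m n
  proof -
    have *: "s m * t m - s n * t n = s m * (t m - t n) + t n * (s m - s n)"
      by (simp add: algebra_simps)
    have "padic_abs p (s m * (t m - t n)) \<le> B * padic_abs p (t m - t n)"
      unfolding padic_abs_mult by (intro mult_right_mono B) simp
    also have "\<dots> < e" using K mn B(1) by (simp add: field_simps)
    finally have 1: "padic_abs p (s m * (t m - t n)) < e" .
    have "padic_abs p (t n * (s m - s n)) \<le> D * padic_abs p (s m - s n)"
      unfolding padic_abs_mult by (intro mult_right_mono D) simp
    also have "\<dots> < e" using N mn D(1) by (simp add: field_simps)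
    finally show ?thesis
      unfolding * using 1 by (intro padic_abs_add_less)
  qed
  then show "\<exists>N. \<forall>m\<ge>N. \<forall>n\<ge>N. padic_abs p (s m * t m - s n * t n) < e" by blast
qed

lemma Cauchy_minus: "s \<in> carrier C \<Longrightarrow> (\<lambda>n. - s n) \<in> carrier C"
  using Cauchy_mult[OF const_Cauchy[of "-1"]] by simp

lemma Cauchy_cring: "cring C"
proof (rule cringI)
  show "abelian_group C"
  proof (rule abelian_groupI)
    fix s assume "s \<in> carrier C"
    then show "\<exists>t\<in>carrier C. t \<oplus>\<^bsub>C\<^esub> s = \<zero>\<^bsub>C\<^esub>"
      by (intro bexI[of _ "\<lambda>n. - s n"]) (auto intro: Cauchy_minus)
  qed (simp_all add: Cauchy_add ac_simps)
  show "Group.comm_monoid C"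
    by (rule comm_monoidI) (simp_all add: Cauchy_mult ac_simps)
qed (simp add: distrib_right)

lemma Cauchy_a_inv: "s \<in> carrier C \<Longrightarrow> \<ominus>\<^bsub>C\<^esub> s = (\<lambda>n. - s n)"
proof -
  interpret cring C by (rule Cauchy_cring)
  assume "s \<in> carrier C"
  then show ?thesis using Cauchy_minus[of s] minus_equality[of "\<lambda>n. - s n" s] by simp
qed

lemma null_iff: "s \<in> padic_null p \<longleftrightarrow> (\<lambda>n. padic_abs p (s n)) \<longlonglongrightarrow> 0"
  by (simp add: padic_null_def)

lemma null_imp_Cauchy:
  assumes "s \<in> padic_null p"
  shows "s \<in> carrier C"
  unfolding Cauchy_carrier_iff
proof (intro allI impI)
  fix e :: real assume "e > 0"
  then obtain N where "\<forall>n\<ge>N. norm (padic_abs p (s n) - 0) < e"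
    using assms unfolding null_iff by (metis LIMSEQ_iff)
  then have "\<forall>n\<ge>N. padic_abs p (s n) < e" by simp
  then have "padic_abs p (s m - s n) < e" if "m \<ge> N" "n \<ge> N" for m n
    using padic_abs_add_less[of "s m" e "- s n"] that by simp
  then show "\<exists>N. \<forall>m\<ge>N. \<forall>n\<ge>N. padic_abs p (s m - s n) < e" by blast
qed

lemma null_iff_seq_norm: "s \<in> carrier C \<Longrightarrow> s \<in> padic_null p \<longleftrightarrow> seq_norm s = 0"
  unfolding null_iff using seq_norm_LIMSEQ[of s] seq_norm_eqI[of s] by metis

lemma seq_norm_mult:
  assumes "s \<in> carrier C" "t \<in> carrier C"
  shows "seq_norm (\<lambda>n. s n * t n) = seq_norm s * seq_norm t"
  by (rule seq_norm_eqI)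
     (simp only: padic_abs_mult tendsto_mult seq_norm_LIMSEQ assms)

lemma seq_norm_add_le:
  assumes "s \<in> carrier C" "t \<in> carrier C"
  shows "seq_norm (\<lambda>n. s n + t n) \<le> max (seq_norm s) (seq_norm t)"
  by (rule LIMSEQ_le[OF seq_norm_LIMSEQ[OF Cauchy_add[OF assms]]
        tendsto_max[OF seq_norm_LIMSEQ[OF assms(1)] seq_norm_LIMSEQ[OF assms(2)]]])
     (auto intro: padic_abs_add_le)

lemma null_ideal: "ideal (padic_null p) C"
proof -
  interpret cring C by (rule Cauchy_cring)
  have add: "(\<lambda>n. s n + t n) \<in> padic_null p" if "s \<in> padic_null p" "t \<in> padic_null p" for s t
  proof -
    have C: "s \<in> carrier C" "t \<in> carrier C" using that null_imp_Cauchy by auto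
    then have "seq_norm (\<lambda>n. s n + t n) = 0"
      using that seq_norm_add_le[OF C] seq_norm_nonneg[OF Cauchy_add[OF C]]
      by (simp add: null_iff_seq_norm)
    then show ?thesis using C by (simp add: null_iff_seq_norm Cauchy_add)
  qed
  have mult: "(\<lambda>n. s n * t n) \<in> padic_null p"
    if "s \<in> padic_null p" "t \<in> carrier C" for s t
  proof -
    have C: "s \<in> carrier C" using that null_imp_Cauchy by auto
    then show ?thesis using that by (simp add: null_iff_seq_norm seq_norm_mult Cauchy_mult)
  qed
  show ?thesis
  proof (rule idealI)
    show "subgroup (padic_null p) (add_monoid C)"
    proof (rule add.subgroupI)
      show "padic_null p \<noteq> {}" using null_iff[of "\<lambda>n. 0"] by auto
    next
      fix s assume "s \<in> padic_null p"
      then show "\<ominus>\<^bsub>C\<^esub> s \<in> padic_null p"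
        by (simp add: Cauchy_a_inv null_imp_Cauchy null_iff)
    next
      fix s t assume "s \<in> padic_null p" "t \<in> padic_null p"
      then show "s \<oplus>\<^bsub>C\<^esub> t \<in> padic_null p" using add by simp
    qed (use null_imp_Cauchy in blast)
  next
    fix s t assume st: "s \<in> padic_null p" "t \<in> carrier C"
    show "s \<otimes>\<^bsub>C\<^esub> t \<in> padic_null p" using mult[OF st] by simp
    then show "t \<otimes>\<^bsub>C\<^esub> s \<in> padic_null p" by (simp add: mult.commute)
  qed (rule ring_axioms)
qed

text \<open>The absolute value of a Cauchy sequence that is not null is eventually constant, because the
  ultrametric inequality forces two numbers at distance less than their absolute value to have
  the same absolute value.\<close>

lemma seq_norm_eventually_const:
  assumes s: "s \<in> carrier C" and "seq_norm s \<noteq> 0"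
  obtains N where "\<And>n. n \<ge> N \<Longrightarrow> padic_abs p (s n) = seq_norm s"
proof -
  define l where "l = seq_norm s"
  have l: "l > 0" using assms seq_norm_nonneg[OF s] by (simp add: l_def)
  have lim: "(\<lambda>n. padic_abs p (s n)) \<longlonglongrightarrow> l" unfolding l_def by (rule seq_norm_LIMSEQ[OF s])
  then obtain N where N: "\<And>n. n \<ge> N \<Longrightarrow> padic_abs p (s n) > l / 2"
    using order_tendstoD(1)[OF lim, of "l / 2"] l by (auto simp: eventually_sequentially)
  obtain K where K: "\<forall>m\<ge>K. \<forall>n\<ge>K. padic_abs p (s m - s n) < l / 2"
    using s l unfolding Cauchy_carrier_iff by (meson half_gt_zero)
  have const: "padic_abs p (s n) = padic_abs p (s (max N K))" if "n \<ge> max N K" for n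
  proof (rule padic_abs_eq_of_diff_less)
    have "padic_abs p (s (max N K) - s n) < l / 2" using K that by simp
    also have "\<dots> < padic_abs p (s (max N K))" using N[of "max N K"] by simp
    finally show "padic_abs p (s (max N K) - s n) < padic_abs p (s (max N K))" .
  qed
  have "(\<lambda>n. padic_abs p (s n)) \<longlonglongrightarrow> padic_abs p (s (max N K))"
    by (rule tendsto_eventually) (unfold eventually_sequentially, use const in blast)
  then have "l = padic_abs p (s (max N K))" using lim LIMSEQ_unique by blast
  then have "padic_abs p (s n) = seq_norm s" if "n \<ge> max N K" for n
    using const[OF that] unfolding l_def by simp
  then show ?thesis by (rule that)
qed

lemma seq_norm_power_int:
  assumes "s \<in> carrier C" "seq_norm s \<noteq> 0"
  obtains k where "seq_norm s = real p powi k"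
proof -
  obtain N where N: "\<And>n. n \<ge> N \<Longrightarrow> padic_abs p (s n) = seq_norm s"
    using seq_norm_eventually_const[OF assms] by blast
  then have eq: "padic_abs p (s N) = seq_norm s" by simp
  then have "s N \<noteq> 0" using assms(2) by auto
  then show ?thesis using that eq by (metis padic_abs_power_int)
qed

lemma Cauchy_inverse:
  assumes s: "s \<in> carrier C" and nz: "seq_norm s \<noteq> 0"
  shows "(\<lambda>n. inverse (s n)) \<in> carrier C"
    and "(\<lambda>n. s n * inverse (s n) - 1) \<in> padic_null p"
proof -
  obtain N where N: "\<And>n. n \<ge> N \<Longrightarrow> padic_abs p (s n) = seq_norm s"
    using seq_norm_eventually_const[OF assms] by blast
  define l where "l = seq_norm s"
  have l: "l > 0" using nz seq_norm_nonneg[OF s] by (simp add: l_def)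
  have snz: "s n \<noteq> 0" if "n \<ge> N" for n using N[OF that] nz by auto
  show "(\<lambda>n. inverse (s n)) \<in> carrier C"
    unfolding Cauchy_carrier_iff
  proof (intro allI impI)
    fix e :: real assume "e > 0"
    then have "e * l\<^sup>2 > 0" using l by simp
    then obtain K where K: "\<forall>m\<ge>K. \<forall>n\<ge>K. padic_abs p (s m - s n) < e * l\<^sup>2"
      using s unfolding Cauchy_carrier_iff by meson
    have "padic_abs p (inverse (s m) - inverse (s n)) < e"
      if mn: "m \<ge> max N K" "n \<ge> max N K" for m n
    proof -
      have "inverse (s m) - inverse (s n) = (s n - s m) * (inverse (s m) * inverse (s n))"
        using snz mn by (simp add: field_simps)
      then have "padic_abs p (inverse (s m) - inverse (s n)) = padic_abs p (s n - s m) / l\<^sup>2"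
        using N mn by (simp add: padic_abs_mult padic_abs_inverse power2_eq_square l_def divide_inverse)
      also have "\<dots> < e" using K mn l by (simp add: pos_divide_less_eq)
      finally show ?thesis .
    qed
    then show "\<exists>N. \<forall>m\<ge>N. \<forall>n\<ge>N. padic_abs p (inverse (s m) - inverse (s n)) < e" by blast
  qed
  show "(\<lambda>n. s n * inverse (s n) - 1) \<in> padic_null p"
    unfolding null_iff
    by (rule tendsto_eventually) (use snz in \<open>auto simp: eventually_sequentially intro!: exI[of _ N]\<close>)
qed

section \<open>The field \<open>\<rat>\<^sub>p\<close> and its valuation ring\<close>

abbreviation cls :: "(nat \<Rightarrow> rat) \<Rightarrow> padic" where
  "cls s \<equiv> padic_null p +>\<^bsub>C\<^esub> s"

lemma Qp_cring: "cring (Qp p)"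
  unfolding Qp_def by (rule ideal.quotient_is_cring[OF null_ideal Cauchy_cring])

lemma cls_ring_hom_ring: "ring_hom_ring C (Qp p) cls"
  unfolding Qp_def by (rule ideal.rcos_ring_hom_ring[OF null_ideal])

lemma carrier_Qp: "carrier (Qp p) = cls ` carrier C"
  by (auto simp: Qp_def FactRing_def A_RCOSETS_def')

lemma carrier_QpE:
  assumes "x \<in> carrier (Qp p)"
  obtains s where "s \<in> carrier C" "x = cls s"
  using assms carrier_Qp by auto

lemma cls_closed [simp]: "s \<in> carrier C \<Longrightarrow> cls s \<in> carrier (Qp p)"
  using carrier_Qp by auto

lemma cls_mult:
  "s \<in> carrier C \<Longrightarrow> t \<in> carrier C \<Longrightarrow> cls s \<otimes>\<^bsub>Qp p\<^esub> cls t = cls (\<lambda>n. s n * t n)"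
  using ring_hom_mult[OF ring_hom_ring.homh[OF cls_ring_hom_ring], of s t] by simp

lemma cls_add:
  "s \<in> carrier C \<Longrightarrow> t \<in> carrier C \<Longrightarrow> cls s \<oplus>\<^bsub>Qp p\<^esub> cls t = cls (\<lambda>n. s n + t n)"
  using ring_hom_add[OF ring_hom_ring.homh[OF cls_ring_hom_ring], of s t] by simp

lemma cls_one: "\<one>\<^bsub>Qp p\<^esub> = cls (\<lambda>n. 1)"
  using ring_hom_one[OF ring_hom_ring.homh[OF cls_ring_hom_ring]] by simp

lemma zero_Qp: "\<zero>\<^bsub>Qp p\<^esub> = padic_null p"
  by (simp add: Qp_def FactRing_def)

lemma abelian_subgroup_null: "abelian_subgroup (padic_null p) C"
  using null_ideal Cauchy_cring
  by (simp add: ideal_def abelian_subgroupI3 cring_def ring_def)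

lemma padic_norm_cls:
  assumes s: "s \<in> carrier C"
  shows "padic_norm p (cls s) = seq_norm s"
proof -
  have lim: "(\<lambda>n. padic_abs p (t n)) \<longlonglongrightarrow> seq_norm s" if t: "t \<in> cls s" for t
  proof -
    obtain z where z: "z \<in> padic_null p" "t = (\<lambda>n. z n + s n)"
      using t by (auto simp: a_r_coset_def')
    have "(\<lambda>n. padic_abs p (t n) - padic_abs p (s n)) \<longlonglongrightarrow> 0"
    proof (rule tendsto_0_le[where K = 1])
      show "(\<lambda>n. padic_abs p (z n)) \<longlonglongrightarrow> 0" using z by (simp add: null_iff)
      show "\<forall>\<^sub>F n in sequentially. norm (padic_abs p (t n) - padic_abs p (s n)) \<le> norm (padic_abs p (z n)) * 1"
      proof (intro always_eventually allI)
        fix n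
        show "norm (padic_abs p (t n) - padic_abs p (s n)) \<le> norm (padic_abs p (z n)) * 1"
          using abs_padic_abs_diff_le[of "t n" "s n"] z by simp
      qed
    qed
    from tendsto_add[OF this seq_norm_LIMSEQ[OF s]] show ?thesis by simp
  qed
  have self: "s \<in> cls s"
    using abelian_subgroup.a_rcos_self[OF abelian_subgroup_null s] .
  show ?thesis
    unfolding padic_norm_def
  proof (rule the_equality)
    show "\<forall>t\<in>cls s. (\<lambda>n. padic_abs p (t n)) \<longlonglongrightarrow> seq_norm s" using lim by blast
    show "l = seq_norm s" if "\<forall>t\<in>cls s. (\<lambda>n. padic_abs p (t n)) \<longlonglongrightarrow> l" for l
      using that self lim LIMSEQ_unique by blast
  qed
qed

lemma padic_norm_nonneg: "x \<in> carrier (Qp p) \<Longrightarrow> padic_norm p x \<ge> 0"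
  by (elim carrier_QpE) (simp add: padic_norm_cls seq_norm_nonneg)

lemma padic_norm_mult:
  assumes "x \<in> carrier (Qp p)" "y \<in> carrier (Qp p)"
  shows "padic_norm p (x \<otimes>\<^bsub>Qp p\<^esub> y) = padic_norm p x * padic_norm p y"
proof -
  obtain s where "s \<in> carrier C" "x = cls s" using assms(1) by (rule carrier_QpE)
  moreover obtain t where "t \<in> carrier C" "y = cls t" using assms(2) by (rule carrier_QpE)
  ultimately show ?thesis by (simp add: cls_mult padic_norm_cls Cauchy_mult seq_norm_mult)
qed

lemma padic_norm_add_le:
  assumes "x \<in> carrier (Qp p)" "y \<in> carrier (Qp p)"
  shows "padic_norm p (x \<oplus>\<^bsub>Qp p\<^esub> y) \<le> max (padic_norm p x) (padic_norm p y)"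
proof -
  obtain s where "s \<in> carrier C" "x = cls s" using assms(1) by (rule carrier_QpE)
  moreover obtain t where "t \<in> carrier C" "y = cls t" using assms(2) by (rule carrier_QpE)
  ultimately show ?thesis by (simp add: cls_add padic_norm_cls Cauchy_add seq_norm_add_le)
qed

lemma padic_norm_const: "padic_norm p (cls (\<lambda>n. c)) = padic_abs p c"
  by (simp add: padic_norm_cls seq_norm_eqI)

lemma padic_norm_one [simp]: "padic_norm p \<one>\<^bsub>Qp p\<^esub> = 1"
  by (simp add: cls_one padic_norm_const)

lemma cls_null: "s \<in> padic_null p \<Longrightarrow> cls s = \<zero>\<^bsub>Qp p\<^esub>"
  unfolding zero_Qp by (rule abelian_subgroup.a_rcos_const[OF abelian_subgroup_null])

lemma padic_norm_zero [simp]: "padic_norm p \<zero>\<^bsub>Qp p\<^esub> = 0"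
proof -
  have "(\<lambda>n. 0) \<in> padic_null p" by (simp add: null_iff)
  from cls_null[OF this] show ?thesis using padic_norm_const[of 0] by simp
qed

lemma padic_norm_eq_0_iff:
  assumes "x \<in> carrier (Qp p)"
  shows "padic_norm p x = 0 \<longleftrightarrow> x = \<zero>\<^bsub>Qp p\<^esub>"
proof
  assume "padic_norm p x = 0"
  moreover obtain s where s: "s \<in> carrier C" "x = cls s" using assms by (rule carrier_QpE)
  ultimately show "x = \<zero>\<^bsub>Qp p\<^esub>"
    by (simp add: padic_norm_cls null_iff_seq_norm[symmetric] cls_null)
qed simp

lemma padic_norm_power_int:
  assumes "x \<in> carrier (Qp p)" "x \<noteq> \<zero>\<^bsub>Qp p\<^esub>"
  obtains k where "padic_norm p x = real p powi k"
proof -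
  obtain s where s: "s \<in> carrier C" "x = cls s" using assms(1) by (rule carrier_QpE)
  then have "seq_norm s \<noteq> 0" using assms padic_norm_eq_0_iff[OF assms(1)] by (simp add: padic_norm_cls)
  then obtain k where "seq_norm s = real p powi k" using seq_norm_power_int[OF s(1)] by blast
  then show ?thesis using that s by (simp add: padic_norm_cls)
qed

lemma Qp_inverse:
  assumes "x \<in> carrier (Qp p)" "x \<noteq> \<zero>\<^bsub>Qp p\<^esub>"
  obtains y where "y \<in> carrier (Qp p)" "x \<otimes>\<^bsub>Qp p\<^esub> y = \<one>\<^bsub>Qp p\<^esub>"
proof -
  interpret Q: cring "Qp p" by (rule Qp_cring)
  obtain s where s: "s \<in> carrier C" "x = cls s" using assms(1) by (rule carrier_QpE)
  then have nz: "seq_norm s \<noteq> 0" using assms padic_norm_eq_0_iff[OF assms(1)] by (simp add: padic_norm_cls)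
  let ?t = "\<lambda>n. inverse (s n)"
  note t = Cauchy_inverse[OF s(1) nz]
  have "cls (\<lambda>n. s n * ?t n) = cls (\<lambda>n. s n * ?t n - 1) \<oplus>\<^bsub>Qp p\<^esub> cls (\<lambda>n. 1)"
    using cls_add[OF null_imp_Cauchy[OF t(2)] const_Cauchy[of 1]] by simp
  also have "\<dots> = \<one>\<^bsub>Qp p\<^esub>" using cls_null[OF t(2)] by (simp add: cls_one[symmetric])
  finally have "x \<otimes>\<^bsub>Qp p\<^esub> cls ?t = \<one>\<^bsub>Qp p\<^esub>" using s t cls_mult by simp
  then show ?thesis using t(1) that[of "cls ?t"] by simp
qed

lemma carrier_Zp: "carrier (Zp p) = {x \<in> carrier (Qp p). padic_norm p x \<le> 1}"
  by (simp add: Zp_def)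

lemma Zp_simps [simp]:
  "x \<otimes>\<^bsub>Zp p\<^esub> y = x \<otimes>\<^bsub>Qp p\<^esub> y" "x \<oplus>\<^bsub>Zp p\<^esub> y = x \<oplus>\<^bsub>Qp p\<^esub> y"
  "\<one>\<^bsub>Zp p\<^esub> = \<one>\<^bsub>Qp p\<^esub>" "\<zero>\<^bsub>Zp p\<^esub> = \<zero>\<^bsub>Qp p\<^esub>"
  by (simp_all add: Zp_def)

lemma Zp_subring: "subring (carrier (Zp p)) (Qp p)"
proof -
  interpret Q: cring "Qp p" by (rule Qp_cring)
  have "padic_norm p (\<ominus>\<^bsub>Qp p\<^esub> \<one>\<^bsub>Qp p\<^esub>) ^ 2 = 1"
    using padic_norm_mult[of "\<ominus>\<^bsub>Qp p\<^esub> \<one>\<^bsub>Qp p\<^esub>" "\<ominus>\<^bsub>Qp p\<^esub> \<one>\<^bsub>Qp p\<^esub>"]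
    by (simp add: power2_eq_square Q.l_minus Q.r_minus)
  then have m1: "padic_norm p (\<ominus>\<^bsub>Qp p\<^esub> \<one>\<^bsub>Qp p\<^esub>) = 1"
    using padic_norm_nonneg[of "\<ominus>\<^bsub>Qp p\<^esub> \<one>\<^bsub>Qp p\<^esub>"] by (simp add: power2_eq_1_iff)
  show ?thesis
  proof (rule Q.subringI)
    fix x assume x: "x \<in> carrier (Zp p)"
    then have "\<ominus>\<^bsub>Qp p\<^esub> x = \<ominus>\<^bsub>Qp p\<^esub> \<one>\<^bsub>Qp p\<^esub> \<otimes>\<^bsub>Qp p\<^esub> x"
      by (simp add: carrier_Zp Q.l_minus)
    moreover have "padic_norm p (\<ominus>\<^bsub>Qp p\<^esub> \<one>\<^bsub>Qp p\<^esub> \<otimes>\<^bsub>Qp p\<^esub> x) = padic_norm p x"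
      using padic_norm_mult[of "\<ominus>\<^bsub>Qp p\<^esub> \<one>\<^bsub>Qp p\<^esub>" x] m1 x by (simp add: carrier_Zp)
    ultimately show "\<ominus>\<^bsub>Qp p\<^esub> x \<in> carrier (Zp p)" using x by (simp add: carrier_Zp)
  next
    fix x y assume xy: "x \<in> carrier (Zp p)" "y \<in> carrier (Zp p)"
    then show "x \<otimes>\<^bsub>Qp p\<^esub> y \<in> carrier (Zp p)"
      by (simp add: carrier_Zp padic_norm_mult padic_norm_nonneg mult_le_one)
    have "padic_norm p (x \<oplus>\<^bsub>Qp p\<^esub> y) \<le> max (padic_norm p x) (padic_norm p y)"
      using xy by (intro padic_norm_add_le) (auto simp: carrier_Zp)
    then show "x \<oplus>\<^bsub>Qp p\<^esub> y \<in> carrier (Zp p)" using xy by (auto simp: carrier_Zp)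
  qed (auto simp: carrier_Zp)
qed

lemma Zp_domain: "domain (Zp p)"
proof -
  interpret Q: cring "Qp p" by (rule Qp_cring)
  have "cring ((Qp p)\<lparr>carrier := carrier (Zp p)\<rparr>)"
    using Q.subcringI'[OF Zp_subring] Q.subcring_iff[of "carrier (Zp p)"]
    by (auto simp: carrier_Zp)
  moreover have "(Qp p)\<lparr>carrier := carrier (Zp p)\<rparr> = Zp p"
    by (simp add: Zp_def)
  ultimately have "cring (Zp p)" by simp
  then show ?thesis
  proof (rule domain.intro, unfold_locales)
    show "\<one>\<^bsub>Zp p\<^esub> \<noteq> \<zero>\<^bsub>Zp p\<^esub>" using padic_norm_one padic_norm_zero unfolding Zp_simps by (metis zero_neq_one)
  next
    fix a b assume *: "a \<otimes>\<^bsub>Zp p\<^esub> b = \<zero>\<^bsub>Zp p\<^esub>" and "a \<in> carrier (Zp p)" "b \<in> carrier (Zp p)"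
    then have ab: "a \<in> carrier (Qp p)" "b \<in> carrier (Qp p)" by (auto simp: carrier_Zp)
    then have "padic_norm p a * padic_norm p b = 0" using * padic_norm_mult[of a b] by simp
    then show "a = \<zero>\<^bsub>Zp p\<^esub> \<or> b = \<zero>\<^bsub>Zp p\<^esub>" using ab by (simp add: padic_norm_eq_0_iff)
  qed
qed

lemma Zp_pow: "x [^]\<^bsub>Zp p\<^esub> (n::nat) = x [^]\<^bsub>Qp p\<^esub> n"
  by (induction n) (simp_all add: nat_pow_def)

lemma Zp_add_pow: "[n] \<cdot>\<^bsub>Zp p\<^esub> \<one>\<^bsub>Zp p\<^esub> = cls (\<lambda>_. of_nat n)"
proof -
  interpret Z: domain "Zp p" by (rule Zp_domain)
  show ?thesis
    unfolding Zp_simps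
  proof (induction n)
    case 0
    have "(\<lambda>n. 0) \<in> padic_null p" by (simp add: null_iff)
    then show ?case using cls_null by simp
  next
    case (Suc n)
    then show ?case using cls_add[of "\<lambda>_. of_nat n" "\<lambda>_. 1"]
      by (simp add: cls_one ac_simps)
  qed
qed

definition unif :: padic where "unif = [p] \<cdot>\<^bsub>Zp p\<^esub> \<one>\<^bsub>Zp p\<^esub>"

definition inv_unif :: padic where "inv_unif = cls (\<lambda>_. inverse (of_nat p))"

lemma unif_eq: "unif = cls (\<lambda>_. of_nat p)"
  unfolding unif_def by (rule Zp_add_pow)

lemma unif_closed [simp]: "unif \<in> carrier (Qp p)"
  by (simp add: unif_eq)

lemma inv_unif_closed [simp]: "inv_unif \<in> carrier (Qp p)"
  by (simp add: inv_unif_def)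

lemma unif_inv_unif: "unif \<otimes>\<^bsub>Qp p\<^esub> inv_unif = \<one>\<^bsub>Qp p\<^esub>"
  using p_gt_1 by (simp add: unif_eq inv_unif_def cls_mult cls_one)

lemma norm_unif: "padic_norm p unif = inverse (real p)"
  by (simp add: unif_eq padic_norm_const padic_abs_p inverse_eq_divide)

lemma norm_inv_unif: "padic_norm p inv_unif = real p"
  by (simp add: inv_unif_def padic_norm_const padic_abs_inverse padic_abs_p)

lemma unif_in_Zp: "unif \<in> carrier (Zp p)"
  using p_gt_1 by (simp add: carrier_Zp norm_unif inverse_le_1_iff)

lemma padic_norm_pow:
  assumes x: "x \<in> carrier (Qp p)"
  shows "padic_norm p (x [^]\<^bsub>Qp p\<^esub> (n::nat)) = padic_norm p x ^ n"
proof -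
  interpret Q: cring "Qp p" by (rule Qp_cring)
  show ?thesis by (induction n) (simp_all add: padic_norm_mult x)
qed

lemma unif_pow_inv_unif_pow:
  "unif [^]\<^bsub>Qp p\<^esub> (n::nat) \<otimes>\<^bsub>Qp p\<^esub> inv_unif [^]\<^bsub>Qp p\<^esub> n = \<one>\<^bsub>Qp p\<^esub>"
proof -
  interpret Q: cring "Qp p" by (rule Qp_cring)
  show ?thesis
    using Q.nat_pow_distrib[of unif inv_unif n] by (simp add: unif_inv_unif)
qed

lemma norm_one_Units:
  assumes "u \<in> carrier (Qp p)" "padic_norm p u = 1"
  shows "u \<in> Units (Zp p)"
proof -
  interpret Z: domain "Zp p" by (rule Zp_domain)
  have "u \<noteq> \<zero>\<^bsub>Qp p\<^esub>" using assms(2) by auto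
  then obtain y where y: "y \<in> carrier (Qp p)" "u \<otimes>\<^bsub>Qp p\<^esub> y = \<one>\<^bsub>Qp p\<^esub>"
    using assms(1) Qp_inverse by blast
  then have "padic_norm p y = 1" using padic_norm_mult[OF assms(1) y(1)] assms(2) by simp
  then have "u \<in> carrier (Zp p)" "y \<in> carrier (Zp p)" "u \<otimes>\<^bsub>Zp p\<^esub> y = \<one>\<^bsub>Zp p\<^esub>"
    using assms y by (auto simp: carrier_Zp)
  then show ?thesis using Z.m_comm[of u y] by (auto simp: Units_def)
qed

text \<open>Multiplying by a suitable power of \<open>1/p\<close> makes the norm equal to \<open>1\<close>, and elements of
  norm \<open>1\<close> are units of \<open>\<int>\<^sub>p\<close>.\<close>

lemma Zp_factor:
  assumes "x \<in> carrier (Zp p)" "x \<noteq> \<zero>\<^bsub>Zp p\<^esub>"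
  shows "\<exists>n u. u \<in> Units (Zp p) \<and> x = unif [^]\<^bsub>Zp p\<^esub> (n::nat) \<otimes>\<^bsub>Zp p\<^esub> u"
proof -
  interpret Q: cring "Qp p" by (rule Qp_cring)
  have x: "x \<in> carrier (Qp p)" "padic_norm p x \<le> 1" "x \<noteq> \<zero>\<^bsub>Qp p\<^esub>"
    using assms by (auto simp: carrier_Zp)
  obtain k where k: "padic_norm p x = real p powi k" using padic_norm_power_int[OF x(1,3)] .
  have "\<not> k > 0" using one_less_power_int[of "real p" k] p_gt_1 x(2) k by auto
  then obtain n where n: "k = - int n" using nonpos_int_cases[of k] by auto
  define u where "u = x \<otimes>\<^bsub>Qp p\<^esub> inv_unif [^]\<^bsub>Qp p\<^esub> n"
  have u: "u \<in> carrier (Qp p)" using x by (simp add: u_def)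
  have "padic_norm p u = 1"
    using p_gt_1 by (simp add: u_def padic_norm_mult padic_norm_pow x norm_inv_unif k n power_int_minus)
  then have "u \<in> Units (Zp p)" using u norm_one_Units by blast
  moreover have "unif [^]\<^bsub>Qp p\<^esub> n \<otimes>\<^bsub>Qp p\<^esub> u
      = x \<otimes>\<^bsub>Qp p\<^esub> (unif [^]\<^bsub>Qp p\<^esub> n \<otimes>\<^bsub>Qp p\<^esub> inv_unif [^]\<^bsub>Qp p\<^esub> n)"
    unfolding u_def using x by (simp add: Q.m_ac)
  ultimately show ?thesis using x by (intro exI[of _ n] exI[of _ u]) (simp add: Zp_pow unif_pow_inv_unif_pow)
qed

lemma Qp_factor:
  assumes "x \<in> carrier (Qp p)" "x \<notin> carrier (Zp p)"
  shows "\<exists>n u. u \<in> Units (Zp p) \<and> x = u \<otimes>\<^bsub>Qp p\<^esub> inv_unif [^]\<^bsub>Qp p\<^esub> (n::nat)"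
proof -
  interpret Q: cring "Qp p" by (rule Qp_cring)
  have x: "x \<in> carrier (Qp p)" "padic_norm p x > 1" using assms by (auto simp: carrier_Zp)
  then have "x \<noteq> \<zero>\<^bsub>Qp p\<^esub>" by auto
  then obtain k where k: "padic_norm p x = real p powi k" using padic_norm_power_int[OF x(1)] by blast
  have "k \<ge> 0"
  proof (rule ccontr)
    assume "\<not> k \<ge> 0"
    then have "real p powi k \<le> real p powi 0" using p_gt_1 by (intro power_int_increasing) auto
    then show False using x k by simp
  qed
  then obtain n where n: "k = int n" using zero_le_imp_eq_int by blast
  define u where "u = unif [^]\<^bsub>Qp p\<^esub> n \<otimes>\<^bsub>Qp p\<^esub> x"
  have u: "u \<in> carrier (Qp p)" using x by (simp add: u_def)
  have "padic_norm p u = 1"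
    using p_gt_1 by (simp add: u_def padic_norm_mult padic_norm_pow x norm_unif k n power_inverse)
  then have "u \<in> Units (Zp p)" using u norm_one_Units by blast
  moreover have "u \<otimes>\<^bsub>Qp p\<^esub> inv_unif [^]\<^bsub>Qp p\<^esub> n
      = x \<otimes>\<^bsub>Qp p\<^esub> (unif [^]\<^bsub>Qp p\<^esub> n \<otimes>\<^bsub>Qp p\<^esub> inv_unif [^]\<^bsub>Qp p\<^esub> n)"
    unfolding u_def using x by (simp add: Q.m_ac)
  ultimately show ?thesis using x by (intro exI[of _ n] exI[of _ u]) (simp add: unif_pow_inv_unif_pow)
qed

section \<open>The module \<open>\<rat>\<^sub>p/\<int>\<^sub>p\<close>\<close>

abbreviation "W \<equiv> Qp_mod_Zp p"
abbreviation qz :: "padic \<Rightarrow> padic set" where "qz x \<equiv> carrier (Zp p) +>\<^bsub>Qp p\<^esub> x"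

lemma Zp_abelian_subgroup: "abelian_subgroup (carrier (Zp p)) (Qp p)"
proof -
  interpret Q: cring "Qp p" by (rule Qp_cring)
  have "subgroup (carrier (Zp p)) (add_monoid (Qp p))"
    using Zp_subring by (simp add: subring_def)
  then show ?thesis
    by (rule abelian_subgroupI3[OF additive_subgroupI Q.is_abelian_group])
qed

lemma carrier_W: "carrier W = qz ` carrier (Qp p)"
  unfolding Qp_mod_Zp_def A_RCOSETS_def' partial_object.simps by (rule UNION_singleton_eq_range)

lemma W_add:
  "x \<in> carrier (Qp p) \<Longrightarrow> y \<in> carrier (Qp p) \<Longrightarrow> qz x \<oplus>\<^bsub>W\<^esub> qz y = qz (x \<oplus>\<^bsub>Qp p\<^esub> y)"
  using abelian_subgroup.a_rcos_sum[OF Zp_abelian_subgroup, of x y]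
  by (simp only: Qp_mod_Zp_def ring.simps)

lemma zero_W: "\<zero>\<^bsub>W\<^esub> = carrier (Zp p)"
  by (simp add: Qp_mod_Zp_def)

lemma qz_eq_zero_iff:
  assumes x: "x \<in> carrier (Qp p)"
  shows "qz x = \<zero>\<^bsub>W\<^esub> \<longleftrightarrow> x \<in> carrier (Zp p)"
proof
  assume "qz x = \<zero>\<^bsub>W\<^esub>"
  then show "x \<in> carrier (Zp p)"
    using abelian_subgroup.a_rcos_self[OF Zp_abelian_subgroup x] by (simp only: zero_W)
next
  assume "x \<in> carrier (Zp p)"
  then show "qz x = \<zero>\<^bsub>W\<^esub>"
    unfolding zero_W by (rule abelian_subgroup.a_rcos_const[OF Zp_abelian_subgroup])
qed

lemma W_smult:
  assumes a: "a \<in> carrier (Zp p)" and x: "x \<in> carrier (Qp p)"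
  shows "a \<odot>\<^bsub>W\<^esub> qz x = qz (a \<otimes>\<^bsub>Qp p\<^esub> x)"
proof -
  interpret Q: cring "Qp p" by (rule Qp_cring)
  interpret S: abelian_subgroup "carrier (Zp p)" "Qp p" by (rule Zp_abelian_subgroup)
  have a': "a \<in> carrier (Qp p)" using a by (rule S.a_Hcarr)
  have "qz (a \<otimes>\<^bsub>Qp p\<^esub> y) = qz (a \<otimes>\<^bsub>Qp p\<^esub> x)" if y: "y \<in> qz x" for y
  proof -
    obtain z where z: "z \<in> carrier (Zp p)" "y = z \<oplus>\<^bsub>Qp p\<^esub> x"
      using y unfolding a_r_coset_def' by blast
    have z': "z \<in> carrier (Qp p)" using z(1) by (rule S.a_Hcarr)
    have "a \<otimes>\<^bsub>Qp p\<^esub> z \<in> carrier (Zp p)" using a z subringE(6)[OF Zp_subring] by blast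
    then have "a \<otimes>\<^bsub>Qp p\<^esub> y \<in> qz (a \<otimes>\<^bsub>Qp p\<^esub> x)"
      unfolding a_r_coset_def' using Q.r_distr[OF z' x a'] z(2) by blast
    then show ?thesis using S.a_repr_independence'[of "a \<otimes>\<^bsub>Qp p\<^esub> y" "a \<otimes>\<^bsub>Qp p\<^esub> x"] a' x Q.m_closed by metis
  qed
  moreover have "x \<in> qz x" by (rule S.a_rcos_self[OF x])
  ultimately have "(\<Union>y\<in>qz x. qz (a \<otimes>\<^bsub>Qp p\<^esub> y)) = qz (a \<otimes>\<^bsub>Qp p\<^esub> x)" by blast
  then show ?thesis by (simp only: Qp_mod_Zp_def module.simps)
qed

lemma W_module: "module (Zp p) W"
proof -
  interpret Q: cring "Qp p" by (rule Qp_cring)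
  interpret Z: domain "Zp p" by (rule Zp_domain)
  interpret S: abelian_subgroup "carrier (Zp p)" "Qp p" by (rule Zp_abelian_subgroup)
  note ZQ = S.a_Hcarr
  have zero: "\<zero>\<^bsub>W\<^esub> = qz \<zero>\<^bsub>Qp p\<^esub>"
    using qz_eq_zero_iff[OF Q.zero_closed] Z.zero_closed by simp
  show ?thesis
  proof (rule moduleI)
    show "cring (Zp p)" by (rule Z.is_cring)
    show "abelian_group W"
    proof (rule abelian_groupI)
      show "v \<oplus>\<^bsub>W\<^esub> w \<in> carrier W" if "v \<in> carrier W" "w \<in> carrier W" for v w
        using that by (auto simp: carrier_W W_add)
      show "\<zero>\<^bsub>W\<^esub> \<in> carrier W" using zero by (auto simp: carrier_W)
      show "v \<oplus>\<^bsub>W\<^esub> w \<oplus>\<^bsub>W\<^esub> z = v \<oplus>\<^bsub>W\<^esub> (w \<oplus>\<^bsub>W\<^esub> z)"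
        if "v \<in> carrier W" "w \<in> carrier W" "z \<in> carrier W" for v w z
        using that by (auto simp: carrier_W W_add Q.a_assoc)
      show "v \<oplus>\<^bsub>W\<^esub> w = w \<oplus>\<^bsub>W\<^esub> v" if "v \<in> carrier W" "w \<in> carrier W" for v w
        using that by (auto simp: carrier_W W_add Q.a_comm)
      show "\<zero>\<^bsub>W\<^esub> \<oplus>\<^bsub>W\<^esub> v = v" if "v \<in> carrier W" for v
        using that unfolding zero by (auto simp: carrier_W W_add)
      fix v assume "v \<in> carrier W"
      then obtain x where x: "x \<in> carrier (Qp p)" "v = qz x" by (auto simp: carrier_W)
      then have "qz (\<ominus>\<^bsub>Qp p\<^esub> x) \<oplus>\<^bsub>W\<^esub> v = \<zero>\<^bsub>W\<^esub>"
        unfolding zero by (simp add: W_add Q.l_neg)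
      then show "\<exists>w\<in>carrier W. w \<oplus>\<^bsub>W\<^esub> v = \<zero>\<^bsub>W\<^esub>" using x by (auto simp: carrier_W)
    qed
  next
    fix a w assume "a \<in> carrier (Zp p)" "w \<in> carrier W"
    then show "a \<odot>\<^bsub>W\<^esub> w \<in> carrier W" using ZQ by (auto simp: carrier_W W_smult)
  next
    fix a b w assume *: "a \<in> carrier (Zp p)" "b \<in> carrier (Zp p)" "w \<in> carrier W"
    then obtain x where x: "x \<in> carrier (Qp p)" "w = qz x" by (auto simp: carrier_W)
    show "(a \<oplus>\<^bsub>Zp p\<^esub> b) \<odot>\<^bsub>W\<^esub> w = a \<odot>\<^bsub>W\<^esub> w \<oplus>\<^bsub>W\<^esub> b \<odot>\<^bsub>W\<^esub> w"
      using * x Z.add.m_closed[of a b] by (simp add: W_smult W_add ZQ Q.l_distr)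
    show "(a \<otimes>\<^bsub>Zp p\<^esub> b) \<odot>\<^bsub>W\<^esub> w = a \<odot>\<^bsub>W\<^esub> (b \<odot>\<^bsub>W\<^esub> w)"
      using * x Z.m_closed[of a b] by (simp add: W_smult ZQ Q.m_assoc)
  next
    fix a v w assume *: "a \<in> carrier (Zp p)" "v \<in> carrier W" "w \<in> carrier W"
    then obtain x y where x: "x \<in> carrier (Qp p)" "v = qz x" "y \<in> carrier (Qp p)" "w = qz y"
      by (auto simp: carrier_W)
    then show "a \<odot>\<^bsub>W\<^esub> (v \<oplus>\<^bsub>W\<^esub> w) = a \<odot>\<^bsub>W\<^esub> v \<oplus>\<^bsub>W\<^esub> a \<odot>\<^bsub>W\<^esub> w"
      using * by (simp add: W_smult W_add ZQ Q.r_distr)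
  next
    fix w assume "w \<in> carrier W"
    then obtain x where x: "x \<in> carrier (Qp p)" "w = qz x" by (auto simp: carrier_W)
    then show "\<one>\<^bsub>Zp p\<^esub> \<odot>\<^bsub>W\<^esub> w = w"
      using Z.one_closed W_smult[of "\<one>\<^bsub>Zp p\<^esub>" x] by simp
  qed
qed

definition omega :: "nat \<Rightarrow> padic set" where
  "omega n = qz (inv_unif [^]\<^bsub>Qp p\<^esub> n)"

lemma omega_closed: "omega n \<in> carrier W"
proof -
  interpret Q: cring "Qp p" by (rule Qp_cring)
  show ?thesis by (simp add: omega_def carrier_W)
qed

lemma omega_0: "omega 0 = \<zero>\<^bsub>W\<^esub>"
proof -
  interpret Q: cring "Qp p" by (rule Qp_cring)
  show ?thesis unfolding omega_def by (subst qz_eq_zero_iff) (auto simp: carrier_Zp)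
qed

lemma omega_1: "omega 1 \<noteq> \<zero>\<^bsub>W\<^esub>"
proof -
  interpret Q: cring "Qp p" by (rule Qp_cring)
  show ?thesis
    unfolding omega_def using p_gt_1 by (subst qz_eq_zero_iff) (auto simp: carrier_Zp norm_inv_unif)
qed

lemma unif_smult_omega: "unif \<odot>\<^bsub>W\<^esub> omega (Suc n) = omega n"
proof -
  interpret Q: cring "Qp p" by (rule Qp_cring)
  have "unif \<otimes>\<^bsub>Qp p\<^esub> inv_unif [^]\<^bsub>Qp p\<^esub> Suc n = inv_unif [^]\<^bsub>Qp p\<^esub> n \<otimes>\<^bsub>Qp p\<^esub> (unif \<otimes>\<^bsub>Qp p\<^esub> inv_unif)"
    by (simp add: Q.m_ac)
  also have "\<dots> = inv_unif [^]\<^bsub>Qp p\<^esub> n" by (simp add: unif_inv_unif)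
  finally show ?thesis by (simp add: omega_def W_smult unif_in_Zp)
qed

lemma W_unit_multiple_omega:
  assumes "w \<in> carrier W"
  shows "\<exists>n u. u \<in> Units (Zp p) \<and> w = u \<odot>\<^bsub>W\<^esub> omega n"
proof -
  interpret Q: cring "Qp p" by (rule Qp_cring)
  interpret Z: domain "Zp p" by (rule Zp_domain)
  interpret module "Zp p" W by (rule W_module)
  obtain x where x: "x \<in> carrier (Qp p)" "w = qz x" using assms by (auto simp: carrier_W)
  show ?thesis
  proof (cases "x \<in> carrier (Zp p)")
    case True
    then have "w = \<one>\<^bsub>Zp p\<^esub> \<odot>\<^bsub>W\<^esub> omega 0"
      using x qz_eq_zero_iff omega_0 smult_one[OF omega_closed[of 0]] by simp
    then show ?thesis using Z.Units_one_closed by blast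
  next
    case False
    then obtain n u where u: "u \<in> Units (Zp p)" "x = u \<otimes>\<^bsub>Qp p\<^esub> inv_unif [^]\<^bsub>Qp p\<^esub> (n::nat)"
      using Qp_factor x by blast
    then have "w = u \<odot>\<^bsub>W\<^esub> omega n" using x by (simp add: omega_def W_smult Z.Units_closed)
    then show ?thesis using u by blast
  qed
qed

section \<open>Jump sets and orbits of characters\<close>

lemma Zp_dvr_torsion: "dvr_torsion (Zp p) W unif omega"
  by (intro dvr_torsion.intro dvr_torsion_axioms.intro)
    (rule Zp_domain W_module unif_in_Zp Zp_factor omega_closed omega_0 omega_1 unif_smult_omega
    W_unit_multiple_omega; assumption?)+

text \<open>As \<open>m \<mapsto> \<rho>\<^sup>m(t)\<close> is monotone, \<open>i \<le> \<rho>\<^sup>n(t)\<close> for the valuation \<open>n\<close> means that every \<open>m\<close>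
  with \<open>\<rho>\<^sup>m(t) < i\<close> is less than \<open>n\<close>.\<close>

lemma S_weight_ge_iff:
  assumes "shift \<rho>" "1 \<le> t" "x \<in> carrier (Zp p)"
  shows "enat i \<le> S_weight p \<rho> t x \<longleftrightarrow>
    (\<forall>m. (\<rho> ^^ m) t < i \<longrightarrow> unif [^]\<^bsub>Zp p\<^esub> Suc m divides\<^bsub>Zp p\<^esub> x)"
proof -
  interpret dvr_torsion "Zp p" W unif omega by (rule Zp_dvr_torsion)
  interpret shift_map \<rho> by unfold_locales (rule assms(1))
  show ?thesis
  proof (cases "x = \<zero>\<^bsub>Zp p\<^esub>")
    case True
    have "unif [^]\<^bsub>Zp p\<^esub> Suc m divides\<^bsub>Zp p\<^esub> \<zero>\<^bsub>Zp p\<^esub>" for m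
      by (intro divides_zero_R R.nat_pow_closed unif_in_Zp)
    then show ?thesis using True by (simp add: S_weight_def del: Zp_simps)
  next
    case False
    obtain n where n: "\<And>m. unif [^]\<^bsub>Zp p\<^esub> (m::nat) divides\<^bsub>Zp p\<^esub> x \<longleftrightarrow> m \<le> n"
      using unif_pow_divides_iff_ord[OF assms(3) False] by blast
    have "padic_ord p x = (GREATEST m. m \<le> n)"
      unfolding padic_ord_def unif_def[symmetric] n ..
    also have "\<dots> = n" by (rule Greatest_equality) auto
    finally have "enat i \<le> S_weight p \<rho> t x \<longleftrightarrow> i \<le> (\<rho> ^^ n) t"
      using False by (simp add: S_weight_def del: Zp_simps)
    also have "\<dots> \<longleftrightarrow> (\<forall>m. (\<rho> ^^ m) t < i \<longrightarrow> m < n)"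
    proof
      assume "i \<le> (\<rho> ^^ n) t"
      then show "\<forall>m. (\<rho> ^^ m) t < i \<longrightarrow> m < n"
        using iter_le_left[OF assms(2)] by (meson le_trans not_le)
    next
      assume "\<forall>m. (\<rho> ^^ m) t < i \<longrightarrow> m < n"
      then have "\<not> (\<rho> ^^ n) t < i" by blast
      then show "i \<le> (\<rho> ^^ n) t" by simp
    qed
    finally show ?thesis unfolding n Suc_le_eq .
  qed
qed

lemma M_rho_power_free_filtered:
  assumes "shift \<rho>" "1 \<le> f"
  shows "free_filtered (Zp p) W unif omega \<rho> f (M_rho_power p \<rho> f)"
proof (intro free_filtered.intro free_filtered_axioms.intro Zp_dvr_torsion shift_map.intro assms)
  fix i
  have T: "1 \<le> t" if "t \<in> T_rho \<rho>" for t using that by (simp add: T_rho_def)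
  have "x \<in> filt (M_rho_power p \<rho> f) i \<longleftrightarrow> x \<in> carrier (M_rho_power p \<rho> f) \<and>
      (\<forall>k<f. \<forall>t\<in>T_rho \<rho>. enat i \<le> S_weight p \<rho> t (x k t))" for x
    by (auto simp: M_rho_power_def sum_filtered_def prod_filtered_def M_rho_def S_rho_def PiE_iff)
  moreover have "(\<forall>k<f. \<forall>t\<in>T_rho \<rho>. enat i \<le> S_weight p \<rho> t (x k t)) \<longleftrightarrow>
      (\<forall>k<f. \<forall>t\<in>T_rho \<rho>. \<forall>m. (\<rho> ^^ m) t < i \<longrightarrow> unif [^]\<^bsub>Zp p\<^esub> Suc m divides\<^bsub>Zp p\<^esub> x k t)"
    if "x \<in> carrier (M_rho_power p \<rho> f)" for x
  proof -
    have "x k t \<in> carrier (Zp p)" if "k < f" "t \<in> T_rho \<rho>" for k t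
      using \<open>x \<in> carrier (M_rho_power p \<rho> f)\<close> that
      by (auto simp: M_rho_power_def sum_filtered_def prod_filtered_def M_rho_def S_rho_def PiE_iff)
    then show ?thesis using S_weight_ge_iff[OF assms(1) T] by blast
  qed
  ultimately show "filt (M_rho_power p \<rho> f) i = {x \<in> carrier (M_rho_power p \<rho> f).
      \<forall>k<f. \<forall>t\<in>T_rho \<rho>. \<forall>m. (\<rho> ^^ m) t < i \<longrightarrow> unif [^]\<^bsub>Zp p\<^esub> Suc m divides\<^bsub>Zp p\<^esub> x k t}"
    by blast
qed (simp_all add: M_rho_power_def sum_filtered_def prod_filtered_def M_rho_def S_rho_def
    del: Zp_simps)

end

theorem theorem1p15:
  fixes p f :: nat and \<rho> :: "nat \<Rightarrow> nat"
  assumes "Factorial_Ring.prime p" and "shift \<rho>" and "f \<ge> 1"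
  shows "jumps (M_rho_power p \<rho> f) ` characters p (M_rho_power p \<rho> f) = Jump \<rho> \<and>
    (\<forall>\<chi>\<^sub>1 \<in> characters p (M_rho_power p \<rho> f). \<forall>\<chi>\<^sub>2 \<in> characters p (M_rho_power p \<rho> f).
       jumps (M_rho_power p \<rho> f) \<chi>\<^sub>1 = jumps (M_rho_power p \<rho> f) \<chi>\<^sub>2 \<longleftrightarrow>
       \<chi>\<^sub>2 \<in> character_orbit p (M_rho_power p \<rho> f) \<chi>\<^sub>1)"
proof -
  interpret padic_prime p by unfold_locales (rule assms(1))
  interpret free_filtered "Zp p" "Qp_mod_Zp p" unif omega \<rho> f "M_rho_power p \<rho> f"
    using assms(2,3) by (rule M_rho_power_free_filtered)
  let ?M = "M_rho_power p \<rho> f"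
  have char: "\<chi> \<in> characters p ?M \<longleftrightarrow> is_char \<chi>" for \<chi>
    unfolding characters_def is_char_iff_continuous by simp
  have orbit: "\<chi>\<^sub>2 \<in> character_orbit p ?M \<chi>\<^sub>1 \<longleftrightarrow>
      (\<exists>g\<in>carrier (filt_Aut (Zp p) ?M). \<chi>\<^sub>2 = compose (carrier ?M) \<chi>\<^sub>1 g)" for \<chi>\<^sub>1 \<chi>\<^sub>2
    unfolding character_orbit_def orbit_def by blast
  have "jumps ?M ` characters p ?M = Jump \<rho>"
  proof
    show "jumps ?M ` characters p ?M \<subseteq> Jump \<rho>" using char jumps_in_Jump by blast
    show "Jump \<rho> \<subseteq> jumps ?M ` characters p ?M"
    proof
      fix A assume "A \<in> Jump \<rho>"
      then show "A \<in> jumps ?M ` characters p ?M"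
        using Jump_realised char by (intro image_eqI[of _ _ "Jump_char A"]) simp_all
    qed
  qed
  moreover have "jumps ?M \<chi>\<^sub>1 = jumps ?M \<chi>\<^sub>2 \<longleftrightarrow> \<chi>\<^sub>2 \<in> character_orbit p ?M \<chi>\<^sub>1"
    if "\<chi>\<^sub>1 \<in> characters p ?M" "\<chi>\<^sub>2 \<in> characters p ?M" for \<chi>\<^sub>1 \<chi>\<^sub>2
    using that Aut_equivalent_of_jumps_eq jumps_compose_Aut unfolding char orbit by metis
  ultimately show ?thesis by blast
qed

end
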